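(* Let $C$ be an algebraically closed field of characteristic zero and let $G$ be a connected linear algebraic group defined over $C$. Then there exists a linear differential equation $L(y,t_1)=y^{(n)}-\sum_{i=0}^{n-1}a_i(t_1)\,y^{(i)}=0$ with coefficients $a_i(t_1)\in C\langle t_1\rangle$, for some $n$, whose differential Galois group over $C\langle t_1\rangle$ is $G$.
   Context: $C\langle t_1\rangle$ is the differential field of fractions of the differential polynomial ring $C\{t_1\}$ in one differential indeterminate $t_1$ over $C$ (elements of $C$ are constants). The differential Galois group of a linear differential equation over a differential field $F$ with field of constants $C$ is the group of differential $F$-automorphisms of a Picard-Vessiot ring of the equation over $F$, regarded as (the $C$-points of) a linear algebraic group over $C$. *)

theory Defs
  imports
    "HOL-Library.Poly_Mapping"
    "HOL-Computational_Algebra.Fraction_Field"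
    "HOL-Computational_Algebra.Polynomial"
    "HOL-Algebra.Bij"
    "HOL-Algebra.Generated_Rings"
    "HOL-Analysis.Abstract_Topology"
    "Jordan_Normal_Form.Determinant"
    "Jordan_Normal_Form.VS_Connect"
begin

section \<open>Multivariate polynomials\<close>

text \<open>Polynomials with variables indexed by \<^typ>\<open>'v\<close>: finitely supported maps from exponent
  vectors to coefficients.\<close>

type_synonym ('v, 'a) polys = "('v \<Rightarrow>\<^sub>0 nat) \<Rightarrow>\<^sub>0 'a"

definition mon_eval :: "('v \<Rightarrow> 'a::comm_ring_1) \<Rightarrow> ('v \<Rightarrow>\<^sub>0 nat) \<Rightarrow> 'a"
  where "mon_eval x e = (\<Prod>v\<in>Poly_Mapping.keys e. x v ^ Poly_Mapping.lookup e v)"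

definition poly_eval :: "('v \<Rightarrow> 'a::comm_ring_1) \<Rightarrow> ('v, 'a) polys \<Rightarrow> 'a"
  where "poly_eval x p =
    (\<Sum>e\<in>Poly_Mapping.keys p. Poly_Mapping.lookup p e * mon_eval x e)"

lemma poly_mapping_sum_single:
  "p = (\<Sum>e\<in>Poly_Mapping.keys p. Poly_Mapping.single e (Poly_Mapping.lookup p e))"
proof (rule poly_mapping_eqI)
  fix k
  show "Poly_Mapping.lookup p k = Poly_Mapping.lookup
      (\<Sum>e\<in>Poly_Mapping.keys p. Poly_Mapping.single e (Poly_Mapping.lookup p e)) k"
    by (simp add: lookup_sum lookup_single when_def in_keys_iff)
qed

lemma mon_eval_superset:
  assumes "finite V" "Poly_Mapping.keys e \<subseteq> V"
  shows "mon_eval x e = (\<Prod>v\<in>V. x v ^ Poly_Mapping.lookup e v)"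
  unfolding mon_eval_def
  by (rule prod.mono_neutral_left) (use assms in \<open>auto simp: in_keys_iff\<close>)

lemma mon_eval_add: "mon_eval x (e + f) = mon_eval x e * mon_eval x f"
proof -
  let ?V = "Poly_Mapping.keys e \<union> Poly_Mapping.keys f"
  have "mon_eval x (e + f) = (\<Prod>v\<in>?V. x v ^ Poly_Mapping.lookup (e + f) v)"
    by (rule mon_eval_superset) (use Poly_Mapping.keys_add[of e f] in auto)
  moreover have "mon_eval x e = (\<Prod>v\<in>?V. x v ^ Poly_Mapping.lookup e v)"
    by (rule mon_eval_superset) auto
  moreover have "mon_eval x f = (\<Prod>v\<in>?V. x v ^ Poly_Mapping.lookup f v)"
    by (rule mon_eval_superset) auto
  ultimately show ?thesis
    by (simp add: lookup_add power_add prod.distrib)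
qed

lemma poly_eval_0 [simp]: "poly_eval x 0 = 0"
  by (simp add: poly_eval_def)

lemma poly_eval_single: "poly_eval x (Poly_Mapping.single e c) = c * mon_eval x e"
  by (simp add: poly_eval_def)

lemma poly_eval_1 [simp]: "poly_eval x 1 = 1"
  using poly_eval_single[of x 0 1] by (simp add: mon_eval_def)

lemma poly_eval_add: "poly_eval x (p + q) = poly_eval x p + poly_eval x q"
  unfolding poly_eval_def
  by (rule setsum_keys_plus_distrib) (simp_all add: algebra_simps)

lemma poly_eval_sum: "poly_eval x (sum f A) = (\<Sum>a\<in>A. poly_eval x (f a))"
  by (induction A rule: infinite_finite_induct) (simp_all add: poly_eval_add)

lemma poly_eval_mult: "poly_eval x (p * q) = poly_eval x p * poly_eval x q"
proof -
  let ?s = "\<lambda>p e. Poly_Mapping.single e (Poly_Mapping.lookup p e)"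
  let ?p = "\<Sum>e\<in>Poly_Mapping.keys p. ?s p e" and ?q = "\<Sum>e\<in>Poly_Mapping.keys q. ?s q e"
  have "poly_eval x (?p * ?q) = poly_eval x ?p * poly_eval x ?q"
    by (simp add: poly_eval_sum sum_product mult_single poly_eval_single mon_eval_add ac_simps)
  then show ?thesis
    by (simp only: poly_mapping_sum_single[symmetric])
qed

section \<open>Linear algebraic groups\<close>

definition GL :: "nat \<Rightarrow> 'a::field mat set"
  where "GL m = {A \<in> carrier_mat m m. det A \<noteq> 0}"

definition GL_subgroup :: "nat \<Rightarrow> 'a::field mat set \<Rightarrow> 'a mat monoid"
  where "GL_subgroup m G = \<lparr>carrier = G, mult = (*), one = 1\<^sub>m m\<rparr>"

text \<open>The bounds guard against the unspecified entries outside the matrix.\<close>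

definition mat_poly :: "nat \<Rightarrow> (nat \<times> nat, 'a::comm_ring_1) polys \<Rightarrow> 'a mat \<Rightarrow> 'a"
  where "mat_poly m p A = poly_eval (\<lambda>(i, j). if i < m \<and> j < m then A $$ (i, j) else 0) p"

lemma mat_poly_mult: "mat_poly m (p * q) A = mat_poly m p A * mat_poly m q A"
  by (simp add: mat_poly_def poly_eval_mult)

text \<open>Clearing denominators, the closed subsets of \<open>GL m\<close> are the zero loci of polynomials in the
  matrix entries, \<open>1 / det\<close> not being needed.\<close>

definition GL_zeros :: "nat \<Rightarrow> (nat \<times> nat, 'a::field) polys set \<Rightarrow> 'a mat set"
  where "GL_zeros m P = {A \<in> GL m. \<forall>p\<in>P. mat_poly m p A = 0}"

definition zariski :: "nat \<Rightarrow> 'a::field mat topology"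
  where "zariski m = topology (\<lambda>U. \<exists>P. U = GL m - GL_zeros m P)"

lemma istopology_zariski:
  "istopology (\<lambda>U. \<exists>P. U = (GL m :: 'a::field mat set) - GL_zeros m P)"
  unfolding istopology_def
proof (intro conjI allI impI)
  fix S T :: "'a mat set"
  assume "\<exists>P. S = GL m - GL_zeros m P" "\<exists>P. T = GL m - GL_zeros m P"
  then obtain P Q where S: "S = GL m - GL_zeros m P" and T: "T = GL m - GL_zeros m Q"
    by blast
  have "S \<inter> T = GL m - GL_zeros m {p * q |p q. p \<in> P \<and> q \<in> Q}"
  proof (intro equalityI subsetI)
    fix A assume "A \<in> S \<inter> T"
    then obtain p q where "A \<in> GL m" "p \<in> P" "q \<in> Q" "mat_poly m p A \<noteq> 0" "mat_poly m q A \<noteq> 0"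
      unfolding S T GL_zeros_def by blast
    moreover from this have "mat_poly m (p * q) A \<noteq> 0"
      by (simp add: mat_poly_mult)
    ultimately show "A \<in> GL m - GL_zeros m {p * q |p q. p \<in> P \<and> q \<in> Q}"
      unfolding GL_zeros_def by blast
  next
    fix A assume "A \<in> GL m - GL_zeros m {p * q |p q. p \<in> P \<and> q \<in> Q}"
    then obtain p q where "A \<in> GL m" "p \<in> P" "q \<in> Q" "mat_poly m (p * q) A \<noteq> 0"
      unfolding GL_zeros_def by blast
    moreover from this have "mat_poly m p A \<noteq> 0" "mat_poly m q A \<noteq> 0"
      by (simp_all add: mat_poly_mult)
    ultimately show "A \<in> S \<inter> T"
      unfolding S T GL_zeros_def by blast
  qed
  then show "\<exists>P. S \<inter> T = GL m - GL_zeros m P"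
    by blast
next
  fix \<K> :: "'a mat set set"
  assume "\<forall>K\<in>\<K>. \<exists>P. K = GL m - GL_zeros m P"
  then obtain P where P: "\<And>K. K \<in> \<K> \<Longrightarrow> K = GL m - GL_zeros m (P K)"
    by metis
  have "\<Union>\<K> = (\<Union>K\<in>\<K>. GL m - GL_zeros m (P K))"
    using P by auto
  also have "\<dots> = GL m - GL_zeros m (\<Union>K\<in>\<K>. P K)"
    unfolding GL_zeros_def by auto
  finally show "\<exists>P. \<Union>\<K> = GL m - GL_zeros m P"
    by blast
qed

lemma openin_zariski: "openin (zariski m) U \<longleftrightarrow> (\<exists>P. U = GL m - GL_zeros m P)"
  unfolding zariski_def using topology_inverse'[OF istopology_zariski] by metis

lemma topspace_zariski [simp]: "topspace (zariski m) = GL m"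
proof -
  have "openin (zariski m) (GL m)"
    unfolding openin_zariski by (rule exI[of _ "{1}"]) (auto simp: GL_zeros_def mat_poly_def)
  moreover have "U \<subseteq> GL m" if "openin (zariski m) U" for U
    using that by (auto simp: openin_zariski)
  ultimately show ?thesis
    by (metis openin_subset openin_topspace subset_antisym)
qed

lemma closedin_zariski: "closedin (zariski m) S \<longleftrightarrow> (\<exists>P. S = GL_zeros m P)"
proof -
  have sub: "GL_zeros m P \<subseteq> GL m" for P :: "(nat \<times> nat, 'a) polys set"
    by (auto simp: GL_zeros_def)
  have "closedin (zariski m) S \<longleftrightarrow> S \<subseteq> GL m \<and> (\<exists>P. GL m - S = GL m - GL_zeros m P)"
    by (simp add: closedin_def openin_zariski)
  also have "\<dots> \<longleftrightarrow> (\<exists>P. S = GL_zeros m P)"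
    using sub by blast
  finally show ?thesis .
qed

definition linear_algebraic_group :: "nat \<Rightarrow> 'a::field mat set \<Rightarrow> bool"
  where "linear_algebraic_group m G \<longleftrightarrow>
    subgroup G (GL_subgroup m (GL m)) \<and> closedin (zariski m) G"

text \<open>The coordinate ring of a closed subset of \<open>GL m\<close> consists of the restrictions of elements of
  \<open>C[x\<^sub>i\<^sub>j, 1 / det]\<close>.\<close>

definition regular_function :: "nat \<Rightarrow> 'a::field mat set \<Rightarrow> ('a mat \<Rightarrow> 'a) \<Rightarrow> bool"
  where "regular_function m G f \<longleftrightarrow>
    (\<exists>p k. \<forall>A\<in>G. f A = mat_poly m p A / det A ^ k)"

definition regular_map :: "nat \<Rightarrow> 'a::field mat set \<Rightarrow> nat \<Rightarrow> ('a mat \<Rightarrow> 'a mat) \<Rightarrow> bool"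
  where "regular_map m G n \<phi> \<longleftrightarrow>
    (\<forall>i<n. \<forall>j<n. regular_function m G (\<lambda>A. \<phi> A $$ (i, j)))"

definition algebraic_group_iso ::
  "nat \<Rightarrow> 'a::field mat set \<Rightarrow> nat \<Rightarrow> 'a mat set \<Rightarrow> ('a mat \<Rightarrow> 'a mat) \<Rightarrow> bool"
  where "algebraic_group_iso m G n H \<phi> \<longleftrightarrow>
    linear_algebraic_group m G \<and> linear_algebraic_group n H \<and>
    \<phi> \<in> iso (GL_subgroup m G) (GL_subgroup n H) \<and>
    regular_map m G n \<phi> \<and> regular_map n H m (inv_into G \<phi>)"

section \<open>The differential field \<open>C\<langle>t\<^sub>1\<rangle>\<close>\<close>

text \<open>\<open>C{t\<^sub>1}\<close> is the polynomial ring over \<open>C\<close> in \<open>t\<^sub>1, t\<^sub>1', t\<^sub>1'', \<dots>\<close>; the variable with index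
  \<open>i\<close> is the \<open>i\<close>-th derivative of \<open>t\<^sub>1\<close>.\<close>

type_synonym 'c diff_poly = "(nat, 'c) polys"
type_synonym 'c diff_rat = "'c diff_poly fract"

text \<open>\<open>(c \<Prod>\<^sub>i x\<^sub>i ^ e\<^sub>i)' = \<Sum>\<^sub>i c e\<^sub>i x\<^sub>i\<^sub>+\<^sub>1 x\<^sub>i ^ (e\<^sub>i - 1) \<Prod>\<^sub>j\<^sub>\<noteq>\<^sub>i x\<^sub>j ^ e\<^sub>j\<close>\<close>

definition mon_deriv :: "(nat \<Rightarrow>\<^sub>0 nat) \<Rightarrow> 'c::comm_ring_1 \<Rightarrow> 'c diff_poly"
  where "mon_deriv e c = (\<Sum>i\<in>Poly_Mapping.keys e.
    Poly_Mapping.single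
      (e - Poly_Mapping.single i 1 + Poly_Mapping.single (Suc i) 1)
      (of_nat (Poly_Mapping.lookup e i) * c))"

definition diff_poly_deriv :: "'c::comm_ring_1 diff_poly \<Rightarrow> 'c diff_poly"
  where "diff_poly_deriv p =
    (\<Sum>e\<in>Poly_Mapping.keys p. mon_deriv e (Poly_Mapping.lookup p e))"

lemma mon_deriv_0 [simp]: "mon_deriv e 0 = 0"
  by (simp add: mon_deriv_def)

lemma mon_deriv_add: "mon_deriv e (c + d) = mon_deriv e c + mon_deriv e d"
  by (simp add: mon_deriv_def distrib_left single_add sum.distrib)

lemma mon_deriv_superset:
  assumes "finite V" "Poly_Mapping.keys e \<subseteq> V"
  shows "mon_deriv e c = (\<Sum>i\<in>V. Poly_Mapping.single
      (e - Poly_Mapping.single i 1 + Poly_Mapping.single (Suc i) 1)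
      (of_nat (Poly_Mapping.lookup e i) * c))"
  unfolding mon_deriv_def
  by (rule sum.mono_neutral_left) (use assms in \<open>auto simp: in_keys_iff\<close>)

lemma diff_poly_deriv_0 [simp]: "diff_poly_deriv 0 = 0"
  by (simp add: diff_poly_deriv_def)

lemma diff_poly_deriv_single: "diff_poly_deriv (Poly_Mapping.single e c) = mon_deriv e c"
  by (simp add: diff_poly_deriv_def)

lemma diff_poly_deriv_const [simp]: "diff_poly_deriv (Poly_Mapping.single 0 c) = 0"
  by (simp add: diff_poly_deriv_single mon_deriv_def)

lemma diff_poly_deriv_var:
  "diff_poly_deriv (Poly_Mapping.single (Poly_Mapping.single i 1) 1) =
   Poly_Mapping.single (Poly_Mapping.single (Suc i) 1) 1"
  by (simp add: diff_poly_deriv_single mon_deriv_def)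

lemma diff_poly_deriv_add: "diff_poly_deriv (p + q) = diff_poly_deriv p + diff_poly_deriv q"
  unfolding diff_poly_deriv_def
  by (rule setsum_keys_plus_distrib) (simp_all add: mon_deriv_add)

lemma diff_poly_deriv_sum: "diff_poly_deriv (sum f A) = (\<Sum>a\<in>A. diff_poly_deriv (f a))"
  by (induction A rule: infinite_finite_induct) (simp_all add: diff_poly_deriv_add)

lemma diff_poly_deriv_mult_single:
  fixes c d :: "'c::comm_ring_1"
  shows "mon_deriv (e + f) (c * d) =
    mon_deriv e c * Poly_Mapping.single f d + Poly_Mapping.single e c * mon_deriv f d"
proof -
  let ?V = "Poly_Mapping.keys e \<union> Poly_Mapping.keys f"
  let ?s = "\<lambda>e c i. Poly_Mapping.single
      (e - Poly_Mapping.single i 1 + Poly_Mapping.single (Suc i) 1)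
      (of_nat (Poly_Mapping.lookup e i) * c)"
  have shift: "g + h - Poly_Mapping.single i 1 = g - Poly_Mapping.single i 1 + h"
    if "Poly_Mapping.lookup g i > 0" for g h :: "nat \<Rightarrow>\<^sub>0 nat" and i
    by (rule poly_mapping_eqI)
      (use that in \<open>auto simp: lookup_add lookup_minus lookup_single when_def\<close>)
  have 1: "?s e c i * Poly_Mapping.single f d =
      Poly_Mapping.single (e + f - Poly_Mapping.single i 1 + Poly_Mapping.single (Suc i) 1)
        (of_nat (Poly_Mapping.lookup e i) * (c * d))" for i
  proof (cases "Poly_Mapping.lookup e i = 0")
    case False
    then show ?thesis
      using shift[of e i f] by (simp add: mult_single ac_simps)
  qed simp
  have 2: "Poly_Mapping.single e c * ?s f d i =
      Poly_Mapping.single (e + f - Poly_Mapping.single i 1 + Poly_Mapping.single (Suc i) 1)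
        (of_nat (Poly_Mapping.lookup f i) * (c * d))" for i
  proof (cases "Poly_Mapping.lookup f i = 0")
    case False
    then show ?thesis
      using shift[of f i e] by (simp add: mult_single ac_simps)
  qed simp
  have 3: "?s (e + f) (c * d) i =
      ?s e c i * Poly_Mapping.single f d + Poly_Mapping.single e c * ?s f d i" for i
    unfolding 1 2 by (simp add: lookup_add distrib_right single_add)
  have "mon_deriv (e + f) (c * d) = (\<Sum>i\<in>?V. ?s (e + f) (c * d) i)"
    by (rule mon_deriv_superset) (use Poly_Mapping.keys_add[of e f] in auto)
  also have "\<dots> = (\<Sum>i\<in>?V. ?s e c i) * Poly_Mapping.single f d +
      Poly_Mapping.single e c * (\<Sum>i\<in>?V. ?s f d i)"
    unfolding 3 by (simp only: sum.distrib sum_distrib_left sum_distrib_right)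
  also have "(\<Sum>i\<in>?V. ?s e c i) = mon_deriv e c"
    by (rule mon_deriv_superset[symmetric]) auto
  also have "(\<Sum>i\<in>?V. ?s f d i) = mon_deriv f d"
    by (rule mon_deriv_superset[symmetric]) auto
  finally show ?thesis .
qed

lemma diff_poly_deriv_mult:
  "diff_poly_deriv (p * q) = diff_poly_deriv p * q + p * diff_poly_deriv q"
proof -
  let ?s = "\<lambda>p e. Poly_Mapping.single e (Poly_Mapping.lookup p e)"
  let ?p = "\<Sum>e\<in>Poly_Mapping.keys p. ?s p e" and ?q = "\<Sum>e\<in>Poly_Mapping.keys q. ?s q e"
  have "diff_poly_deriv (?p * ?q) = diff_poly_deriv ?p * ?q + ?p * diff_poly_deriv ?q"
    by (simp add: diff_poly_deriv_sum sum_product mult_single diff_poly_deriv_single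
        diff_poly_deriv_mult_single sum.distrib)
  then show ?thesis
    by (simp only: poly_mapping_sum_single[symmetric])
qed

lemma quotient_rule_wd:
  fixes a b c d :: "'a::comm_ring_1"
  assumes eq: "a * d = c * b" and eq': "a' * d + a * d' = c' * b + c * b'"
  shows "(a' * b - a * b') * (d * d) = (c' * d - c * d') * (b * b)"
proof -
  have "(a' * b - a * b') * (d * d) = (a' * d + a * d') * (b * d) - (a * d) * (d' * b + b' * d)"
    by (simp add: algebra_simps)
  also have "\<dots> = (c' * b + c * b') * (b * d) - (c * b) * (d' * b + b' * d)"
    by (simp only: eq eq')
  also have "\<dots> = (c' * d - c * d') * (b * b)"
    by (simp add: algebra_simps)
  finally show ?thesis .
qed

lemma quotient_rule_add:
  fixes a b c d :: "'a::comm_ring_1"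
  shows "((a' * d + a * d' + (c' * b + c * b')) * (b * d) - (a * d + c * b) * (b' * d + b * d'))
      * ((b * b) * (d * d)) =
    ((a' * b - a * b') * (d * d) + (c' * d - c * d') * (b * b)) * ((b * d) * (b * d))"
  by (simp add: algebra_simps)

lemma quotient_rule_mult:
  fixes a b c d :: "'a::comm_ring_1"
  shows "((a' * c + a * c') * (b * d) - (a * c) * (b' * d + b * d'))
      * (((b * b) * d) * (b * (d * d))) =
    ((a' * b - a * b') * c * (b * (d * d)) + a * (c' * d - c * d') * ((b * b) * d))
      * ((b * d) * (b * d))"
  by (simp add: algebra_simps)

text \<open>The quotient rule; it does not depend on the representative by
  \<open>diff_rat_deriv_Fract\<close>.\<close>

definition diff_rat_deriv :: "'c::field diff_rat \<Rightarrow> 'c diff_rat"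
  where "diff_rat_deriv x = (THE z. \<exists>p q. q \<noteq> 0 \<and> x = Fract p q \<and>
    z = Fract (diff_poly_deriv p * q - p * diff_poly_deriv q) (q * q))"

lemma diff_rat_deriv_Fract:
  fixes p q :: "'c::field diff_poly"
  assumes "q \<noteq> 0"
  shows "diff_rat_deriv (Fract p q) =
    Fract (diff_poly_deriv p * q - p * diff_poly_deriv q) (q * q)"
proof -
  let ?d = "\<lambda>p q :: 'c diff_poly. Fract (diff_poly_deriv p * q - p * diff_poly_deriv q) (q * q)"
  have wd: "?d a b = ?d c d" if "b \<noteq> 0" "d \<noteq> 0" "Fract a b = Fract c d"
    for a b c d :: "'c diff_poly"
  proof -
    have eq: "a * d = c * b"
      using that by (simp add: eq_fract)
    have "diff_poly_deriv a * d + a * diff_poly_deriv d =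
        diff_poly_deriv c * b + c * diff_poly_deriv b"
      using arg_cong[OF eq, of diff_poly_deriv] by (simp add: diff_poly_deriv_mult)
    from eq this have "(diff_poly_deriv a * b - a * diff_poly_deriv b) * (d * d) =
        (diff_poly_deriv c * d - c * diff_poly_deriv d) * (b * b)"
      by (rule quotient_rule_wd)
    then show ?thesis
      using that by (simp add: eq_fract)
  qed
  show ?thesis
    unfolding diff_rat_deriv_def
  proof (rule the_equality)
    show "\<exists>p' q'. q' \<noteq> 0 \<and> Fract p q = Fract p' q' \<and> ?d p q = ?d p' q'"
      by (intro exI[of _ p] exI[of _ q] conjI assms refl)
  next
    fix z
    assume "\<exists>p' q'. q' \<noteq> 0 \<and> Fract p q = Fract p' q' \<and> z = ?d p' q'"
    then obtain p' q' where "q' \<noteq> 0" "Fract p q = Fract p' q'" and z: "z = ?d p' q'"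
      by (elim exE conjE)
    then show "z = ?d p q"
      unfolding z by (intro wd assms) (simp_all only: not_False_eq_True)
  qed
qed

lemma diff_rat_deriv_add: "diff_rat_deriv (x + y) = diff_rat_deriv x + diff_rat_deriv y"
proof (cases x, cases y)
  fix a b c d
  assume x: "x = Fract a b" "b \<noteq> 0" and y: "y = Fract c d" "d \<noteq> 0"
  show ?thesis
    unfolding x(1) y(1)
    by (simp only: x(2) y(2) add_fract diff_rat_deriv_Fract no_zero_divisors not_False_eq_True
        eq_fract diff_poly_deriv_add diff_poly_deriv_mult quotient_rule_add)
qed

lemma diff_rat_deriv_mult:
  "diff_rat_deriv (x * y) = diff_rat_deriv x * y + x * diff_rat_deriv y"
proof (cases x, cases y)
  fix a b c d
  assume x: "x = Fract a b" "b \<noteq> 0" and y: "y = Fract c d" "d \<noteq> 0"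
  show ?thesis
    unfolding x(1) y(1)
    by (simp only: x(2) y(2) add_fract mult_fract diff_rat_deriv_Fract no_zero_divisors
        not_False_eq_True eq_fract diff_poly_deriv_mult quotient_rule_mult)
qed

definition diff_rat_const :: "'c::field \<Rightarrow> 'c diff_rat"
  where "diff_rat_const c = Fract (Poly_Mapping.single 0 c) 1"

lemma diff_rat_deriv_const [simp]:
  "diff_rat_deriv (diff_rat_const (c :: 'c::field)) = 0"
proof -
  have "diff_poly_deriv 1 = (0 :: 'c diff_poly)"
    using diff_poly_deriv_const[of 1] by simp
  then show ?thesis
    by (simp add: diff_rat_const_def diff_rat_deriv_Fract fract_collapse)
qed

section \<open>Picard-Vessiot rings and differential Galois groups\<close>

text \<open>A base differential field is a type \<^typ>\<open>'f\<close> of sort \<^class>\<open>field\<close> with derivation \<open>D\<close>.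
  A differential ring extension of it is a ring \<open>R\<close> with derivation \<open>\<delta>\<close> and structure map
  \<open>\<iota>\<close>, which is injective as soon as \<open>R\<close> is not the zero ring.\<close>

definition differential_ring :: "'r ring \<Rightarrow> ('r \<Rightarrow> 'r) \<Rightarrow> bool"
  where "differential_ring R \<delta> \<longleftrightarrow> cring R \<and> \<delta> \<in> carrier R \<rightarrow> carrier R \<and>
    (\<forall>x\<in>carrier R. \<forall>y\<in>carrier R.
      \<delta> (x \<oplus>\<^bsub>R\<^esub> y) = \<delta> x \<oplus>\<^bsub>R\<^esub> \<delta> y \<and>
      \<delta> (x \<otimes>\<^bsub>R\<^esub> y) = \<delta> x \<otimes>\<^bsub>R\<^esub> y \<oplus>\<^bsub>R\<^esub> x \<otimes>\<^bsub>R\<^esub> \<delta> y)"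

definition differential_extension ::
  "('f::field \<Rightarrow> 'f) \<Rightarrow> 'r ring \<Rightarrow> ('r \<Rightarrow> 'r) \<Rightarrow> ('f \<Rightarrow> 'r) \<Rightarrow> bool"
  where "differential_extension D R \<delta> \<iota> \<longleftrightarrow> differential_ring R \<delta> \<and>
    \<iota> \<in> Ring.ring_hom class_ring R \<and> (\<forall>x. \<iota> (D x) = \<delta> (\<iota> x))"

definition simple_differential_ring :: "'r ring \<Rightarrow> ('r \<Rightarrow> 'r) \<Rightarrow> bool"
  where "simple_differential_ring R \<delta> \<longleftrightarrow> \<one>\<^bsub>R\<^esub> \<noteq> \<zero>\<^bsub>R\<^esub> \<and>
    (\<forall>I. ideal I R \<and> \<delta> ` I \<subseteq> I \<longrightarrow> I = {\<zero>\<^bsub>R\<^esub>} \<or> I = carrier R)"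

text \<open>Solutions of \<open>y\<^sup>(\<^sup>n\<^sup>) = \<Sum>\<^sub>i\<^sub><\<^sub>n a\<^sub>i y\<^sup>(\<^sup>i\<^sup>)\<close>.\<close>

definition lde_solution ::
  "'r ring \<Rightarrow> ('r \<Rightarrow> 'r) \<Rightarrow> ('f \<Rightarrow> 'r) \<Rightarrow> nat \<Rightarrow> (nat \<Rightarrow> 'f) \<Rightarrow> 'r \<Rightarrow> bool"
  where "lde_solution R \<delta> \<iota> n a y \<longleftrightarrow> y \<in> carrier R \<and>
    (\<delta> ^^ n) y = (\<Oplus>\<^bsub>R\<^esub>i\<in>{0..<n}. \<iota> (a i) \<otimes>\<^bsub>R\<^esub> (\<delta> ^^ i) y)"

text \<open>Leibniz formula; the library determinants are confined to ring types.\<close>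

definition ring_det :: "'r ring \<Rightarrow> nat \<Rightarrow> (nat \<Rightarrow> nat \<Rightarrow> 'r) \<Rightarrow> 'r"
  where "ring_det R n M = (\<Oplus>\<^bsub>R\<^esub>p\<in>{p. p permutes {0..<n}}.
    (if evenperm p then \<Otimes>\<^bsub>R\<^esub>i\<in>{0..<n}. M i (p i)
     else \<ominus>\<^bsub>R\<^esub> (\<Otimes>\<^bsub>R\<^esub>i\<in>{0..<n}. M i (p i))))"

definition wronskian :: "'r ring \<Rightarrow> ('r \<Rightarrow> 'r) \<Rightarrow> nat \<Rightarrow> (nat \<Rightarrow> 'r) \<Rightarrow> 'r"
  where "wronskian R \<delta> n y = ring_det R n (\<lambda>i j. (\<delta> ^^ i) (y j))"

definition fundamental_solutions ::
  "'r ring \<Rightarrow> ('r \<Rightarrow> 'r) \<Rightarrow> ('f \<Rightarrow> 'r) \<Rightarrow> nat \<Rightarrow> (nat \<Rightarrow> 'f) \<Rightarrow> (nat \<Rightarrow> 'r) \<Rightarrow> bool"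
  where "fundamental_solutions R \<delta> \<iota> n a y \<longleftrightarrow>
    (\<forall>j<n. lde_solution R \<delta> \<iota> n a (y j)) \<and> wronskian R \<delta> n y \<in> Units R"

definition picard_vessiot_ring ::
  "('f::field \<Rightarrow> 'f) \<Rightarrow> nat \<Rightarrow> (nat \<Rightarrow> 'f) \<Rightarrow> 'r ring \<Rightarrow> ('r \<Rightarrow> 'r) \<Rightarrow> ('f \<Rightarrow> 'r) \<Rightarrow> bool"
  where "picard_vessiot_ring D n a R \<delta> \<iota> \<longleftrightarrow>
    differential_extension D R \<delta> \<iota> \<and> simple_differential_ring R \<delta> \<and>
    (\<exists>y. fundamental_solutions R \<delta> \<iota> n a y \<and>
      carrier R = generate_ring R
        (range \<iota> \<union> {(\<delta> ^^ i) (y j) |i j. i < n \<and> j < n} \<union> {inv\<^bsub>R\<^esub> (wronskian R \<delta> n y)}))"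

definition differential_galois_group ::
  "'r ring \<Rightarrow> ('r \<Rightarrow> 'r) \<Rightarrow> ('f \<Rightarrow> 'r) \<Rightarrow> ('r \<Rightarrow> 'r) monoid"
  where "differential_galois_group R \<delta> \<iota> = BijGroup (carrier R)
    \<lparr>carrier := {\<sigma> \<in> Bij (carrier R). \<sigma> \<in> Ring.ring_hom R R \<and>
      (\<forall>x\<in>carrier R. \<sigma> (\<delta> x) = \<delta> (\<sigma> x)) \<and> (\<forall>c. \<sigma> (\<iota> c) = \<iota> c)}\<rparr>"

text \<open>The matrix \<open>M\<close> over the constants with \<open>\<sigma>(y\<^sub>j) = \<Sum>\<^sub>i y\<^sub>i M\<^sub>i\<^sub>j\<close>, where \<open>\<kappa>\<close> embeds
  the constants into \<open>R\<close>. It exists and is unique if \<open>y\<close> is a fundamental system of solutions in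
  a Picard-Vessiot ring without new constants.\<close>

definition galois_matrix ::
  "'r ring \<Rightarrow> ('c \<Rightarrow> 'r) \<Rightarrow> nat \<Rightarrow> (nat \<Rightarrow> 'r) \<Rightarrow> ('r \<Rightarrow> 'r) \<Rightarrow> 'c mat"
  where "galois_matrix R \<kappa> n y \<sigma> = (THE M. M \<in> carrier_mat n n \<and>
    (\<forall>j<n. \<sigma> (y j) = (\<Oplus>\<^bsub>R\<^esub>i\<in>{0..<n}. y i \<otimes>\<^bsub>R\<^esub> \<kappa> (M $$ (i, j)))))"

text \<open>The differential Galois group is a linear algebraic group through the faithful
  representation \<^const>\<open>galois_matrix\<close>; another fundamental system of solutions gives a conjugate
  representation, hence the same structure. So \<open>G\<close> is the differential Galois group if there is an
  isomorphism \<open>\<psi>\<close> of groups that becomes one of linear algebraic groups in these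
  coordinates. The embedding of the constants \<open>C\<close> into the base field is \<open>\<gamma>\<close>.

  The elements of \<open>R\<close> are sets of polynomials over the base field \<open>F\<close> because a Picard-Vessiot
  ring is, up to isomorphism, a ring of cosets in \<open>F[x\<^sub>i\<^sub>j, 1 / det]\<close>, a quotient of a
  polynomial ring in finitely many variables. So this choice of type loses no
  Picard-Vessiot ring.\<close>

definition has_differential_galois_group ::
  "('f::field \<Rightarrow> 'f) \<Rightarrow> ('c::field \<Rightarrow> 'f) \<Rightarrow> nat \<Rightarrow> (nat \<Rightarrow> 'f) \<Rightarrow> nat \<Rightarrow> 'c mat set \<Rightarrow> bool"
  where "has_differential_galois_group D \<gamma> n a m G \<longleftrightarrow>
    (\<exists>(R :: (nat, 'f) polys set ring) \<delta> \<iota> y \<psi>.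
      picard_vessiot_ring D n a R \<delta> \<iota> \<and> fundamental_solutions R \<delta> \<iota> n a y \<and>
      \<psi> \<in> iso (GL_subgroup m G) (differential_galois_group R \<delta> \<iota>) \<and>
      algebraic_group_iso m G n
        (galois_matrix R (\<iota> \<circ> \<gamma>) n y ` carrier (differential_galois_group R \<delta> \<iota>))
        (galois_matrix R (\<iota> \<circ> \<gamma>) n y \<circ> \<psi>))"

end

theory Submission
  imports Defs
begin

text \<open>Let \<open>F = C\<langle>t\<^sub>1\<rangle>\<close> and let \<open>D\<^sub>k\<close> be a basis of the right-invariant vector fields on
  \<open>G\<close>. The linear system given by \<open>\<Sum>\<^sub>k t\<^sub>1^(k+1) D\<^sub>k\<close> has Galois group \<open>G\<close>, because the
  derivation \<open>\<delta>\<close> that extends it and the derivation of \<open>F\<close> makes \<open>F \<otimes> C[G]\<close> a simple differential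
  ring. Indeed, the reduced basis of a finite-dimensional \<open>\<delta>\<close>-stable \<open>F\<close>-subspace has coefficients
  that solve an autonomous system of Riccati type over \<open>C[t\<^sub>1]\<close>. Differentiation raises the order in
  \<open>t\<^sub>1\<close>, so these coefficients are constants. Comparing powers of \<open>t\<^sub>1\<close>, the subspace comes from a
  subspace of \<open>C[G]\<close> that is stable under every \<open>D\<^sub>k\<close>. As \<open>G\<close> is connected and the characteristic
  is \<open>0\<close>, a function all of whose derivatives vanish at \<open>1\<close> is zero. Hence the subspace is stable
  under translation by \<open>G\<close>, and an ideal containing it contains \<open>1\<close>. A cyclic vector whose
  coordinates are derivatives of \<open>t\<^sub>1\<close> of widely spaced orders turns the system into a scalar
  equation.\<close>

section \<open>Polynomials in finitely many variables\<close>

text \<open>The tensor product is modelled by the \<open>F\<close>-valued functions on the points of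
  \<open>G\<close> that are polynomials in the matrix entries and \<open>1 / det\<close>.
  Finite-dimensional spaces of them are handled by interpolation: finitely many points of
  \<open>G\<close> at which the values determine a function take the place of coordinates.
  Right-invariant fields commute with right translation, so \<open>G\<close> acts on this ring by
  differential automorphisms over \<open>F\<close>. Conversely, an automorphism multiplies the
  generic matrix on the right by a matrix with zero derivative, which has entries in
  \<open>C\<close> by the same order argument that gives simplicity. The obstacle is the passage
  from the Lie algebra to the group, where there is no exponential map. A function whose derivatives
  all vanish at \<open>1\<close> lies in every power of the maximal ideal there, because an Euler
  field recovers the degree, which is invertible in characteristic \<open>0\<close>; Krull's theorem
  then makes the function zero near \<open>1\<close>. Its flat points therefore form an open and
  closed set, and connectedness finishes the argument.\<close>

definition polys_in :: "'v set \<Rightarrow> ('v, 'a::zero) polys set"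
  where "polys_in V = {p. \<forall>e\<in>Poly_Mapping.keys p. Poly_Mapping.keys e \<subseteq> V}"

lemma polys_in_UNIV [simp]: "p \<in> polys_in UNIV"
  by (simp add: polys_in_def)

lemma polys_in_0 [simp]: "0 \<in> polys_in V"
  by (simp add: polys_in_def)

lemma polys_in_const [simp]: "Poly_Mapping.single 0 c \<in> polys_in V"
  by (simp add: polys_in_def)

lemma polys_in_single: "Poly_Mapping.keys e \<subseteq> V \<Longrightarrow> Poly_Mapping.single e c \<in> polys_in V"
  by (simp add: polys_in_def)

lemma polys_in_var: "v \<in> V \<Longrightarrow> Poly_Mapping.single (Poly_Mapping.single v 1) c \<in> polys_in V"
  by (simp add: polys_in_def)

lemma polys_in_add: "p \<in> polys_in V \<Longrightarrow> q \<in> polys_in V \<Longrightarrow> p + q \<in> polys_in V"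
  using Poly_Mapping.keys_add[of p q] by (auto simp: polys_in_def)

lemma polys_in_mult:
  fixes p q :: "('v, 'a::comm_semiring_1) polys"
  assumes "p \<in> polys_in V" "q \<in> polys_in V"
  shows "p * q \<in> polys_in V"
  unfolding polys_in_def
proof (safe)
  fix e x assume "e \<in> Poly_Mapping.keys (p * q)" and x: "x \<in> Poly_Mapping.keys e"
  then obtain a b where "e = a + b" "a \<in> Poly_Mapping.keys p" "b \<in> Poly_Mapping.keys q"
    using keys_mult[of p q] by blast
  then show "x \<in> V"
    using assms x Poly_Mapping.keys_add[of a b] unfolding polys_in_def by blast
qed

lemma polys_in_sum: "(\<And>i. i \<in> I \<Longrightarrow> f i \<in> polys_in V) \<Longrightarrow> sum f I \<in> polys_in V"
  for f :: "'i \<Rightarrow> ('v, 'a::comm_semiring_1) polys"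
  by (induction I rule: infinite_finite_induct) (auto intro: polys_in_add)

lemma polys_in_induct [consumes 1, case_names const var add mult]:
  fixes p :: "('v, 'a::comm_semiring_1) polys"
  assumes p: "p \<in> polys_in V"
    and const: "\<And>c. P (Poly_Mapping.single 0 c)"
    and var: "\<And>v. v \<in> V \<Longrightarrow> P (Poly_Mapping.single (Poly_Mapping.single v 1) 1)"
    and add: "\<And>p q. P p \<Longrightarrow> P q \<Longrightarrow> P (p + q)"
    and mult: "\<And>p q. P p \<Longrightarrow> P q \<Longrightarrow> P (p * q)"
  shows "P p"
proof -
  have pow: "P (Poly_Mapping.single (Poly_Mapping.single v n) 1)" if "v \<in> V" for v n
  proof (induction n)
    case 0
    then show ?case using const[of 1] by simp
  next
    case (Suc n)
    have "Poly_Mapping.single (Poly_Mapping.single v (Suc n)) (1::'a) =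
        Poly_Mapping.single (Poly_Mapping.single v 1) 1 * Poly_Mapping.single (Poly_Mapping.single v n) 1"
      by (simp add: mult_single flip: single_add)
    then show ?case using mult[OF var[OF that] Suc] by simp
  qed
  have mon: "P (Poly_Mapping.single (\<Sum>v\<in>S. Poly_Mapping.single v (n v)) 1)"
    if "finite S" "S \<subseteq> V" for S and n :: "'v \<Rightarrow> nat"
    using that
  proof (induction S rule: finite_induct)
    case empty
    then show ?case using const[of 1] by simp
  next
    case (insert v S)
    have "Poly_Mapping.single (\<Sum>v\<in>insert v S. Poly_Mapping.single v (n v)) (1::'a) =
        Poly_Mapping.single (Poly_Mapping.single v (n v)) 1 *
        Poly_Mapping.single (\<Sum>v\<in>S. Poly_Mapping.single v (n v)) 1"
      using insert by (simp add: mult_single)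
    then show ?case using mult[OF pow] insert by simp
  qed
  have sing: "P (Poly_Mapping.single e c)" if "Poly_Mapping.keys e \<subseteq> V" for e c
  proof -
    have "Poly_Mapping.single e c = Poly_Mapping.single 0 c *
        Poly_Mapping.single (\<Sum>v\<in>Poly_Mapping.keys e. Poly_Mapping.single v (Poly_Mapping.lookup e v)) 1"
      by (simp add: mult_single flip: poly_mapping_sum_single)
    then show ?thesis using mult[OF const mon] that by simp
  qed
  have "P (\<Sum>e\<in>S. Poly_Mapping.single e (Poly_Mapping.lookup p e))"
    if "finite S" "S \<subseteq> Poly_Mapping.keys p" for S
    using that
  proof (induction S rule: finite_induct)
    case empty
    then show ?case using const[of 0] by simp
  next
    case (insert e S)
    then show ?case using p by (auto intro!: add sing simp: polys_in_def)
  qed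
  from this[OF finite_keys order_refl] show ?thesis
    by (simp only: flip: poly_mapping_sum_single)
qed

lemmas polys_induct = polys_in_induct[OF polys_in_UNIV, case_names const var add mult]

text \<open>The order on exponent vectors is the lexicographic order of
  \<^theory>\<open>HOL-Library.Poly_Mapping\<close>, a monomial order.\<close>

lemma lookup_mult_max:
  fixes p q :: "('v::linorder, 'a::comm_ring_1) polys"
  assumes p: "\<And>e. e \<in> Poly_Mapping.keys p \<Longrightarrow> e \<le> \<mu>"
    and q: "\<And>e. e \<in> Poly_Mapping.keys q \<Longrightarrow> e \<le> \<nu>"
  shows "Poly_Mapping.lookup (p * q) (\<mu> + \<nu>) = Poly_Mapping.lookup p \<mu> * Poly_Mapping.lookup q \<nu>"
proof -
  let ?a = "Poly_Mapping.single \<mu> (Poly_Mapping.lookup p \<mu>)"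
  let ?b = "Poly_Mapping.single \<nu> (Poly_Mapping.lookup q \<nu>)"
  have kp: "e < \<mu>" if "e \<in> Poly_Mapping.keys (p - ?a)" for e
  proof -
    have "e \<noteq> \<mu>" "Poly_Mapping.lookup p e \<noteq> 0"
      using that by (auto simp: in_keys_iff lookup_minus lookup_single when_def split: if_splits)
    then show ?thesis using p[of e] by (simp add: in_keys_iff)
  qed
  have kq: "e < \<nu>" if "e \<in> Poly_Mapping.keys (q - ?b)" for e
  proof -
    have "e \<noteq> \<nu>" "Poly_Mapping.lookup q e \<noteq> 0"
      using that by (auto simp: in_keys_iff lookup_minus lookup_single when_def split: if_splits)
    then show ?thesis using q[of e] by (simp add: in_keys_iff)
  qed
  have 1: "Poly_Mapping.lookup ((p - ?a) * q) (\<mu> + \<nu>) = 0"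
  proof -
    have "\<mu> + \<nu> \<notin> Poly_Mapping.keys ((p - ?a) * q)"
    proof
      assume "\<mu> + \<nu> \<in> Poly_Mapping.keys ((p - ?a) * q)"
      then obtain a b where "\<mu> + \<nu> = a + b" "a \<in> Poly_Mapping.keys (p - ?a)" "b \<in> Poly_Mapping.keys q"
        using keys_mult by blast
      then show False using add_less_le_mono[OF kp q, of a b] by simp
    qed
    then show ?thesis by (simp add: in_keys_iff)
  qed
  have 2: "Poly_Mapping.lookup (?a * (q - ?b)) (\<mu> + \<nu>) = 0"
  proof -
    have "\<mu> + \<nu> \<notin> Poly_Mapping.keys (?a * (q - ?b))"
    proof
      assume "\<mu> + \<nu> \<in> Poly_Mapping.keys (?a * (q - ?b))"
      then obtain a b where "\<mu> + \<nu> = a + b" "a \<in> Poly_Mapping.keys ?a" "b \<in> Poly_Mapping.keys (q - ?b)"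
        using keys_mult by blast
      then show False using kq[of b] by (auto split: if_splits)
    qed
    then show ?thesis by (simp add: in_keys_iff)
  qed
  \<comment> \<open>In each of the first two products one factor lies strictly below its bound, so
    the product stays strictly below \<open>\<mu> + \<nu>\<close>. The bounds need not be attained,
    which later allows factors whose coefficient there is zero.\<close>
  have "p * q = (p - ?a) * q + ?a * (q - ?b) + ?a * ?b"
    by (simp add: algebra_simps)
  then show ?thesis
    by (simp add: lookup_add 1 2 mult_single)
qed

section \<open>Dickson's lemma and well-founded monomial orders\<close>

text \<open>A sequence of natural numbers has a monotone subsequence, and a decreasing one is
  constant from the place where it takes its least value.\<close>

lemma nat_seq_mono_subseq:
  fixes s :: "nat \<Rightarrow> nat"
  shows "\<exists>f :: nat \<Rightarrow> nat. strict_mono f \<and> mono (\<lambda>n. s (f n))"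
proof -
  obtain f :: "nat \<Rightarrow> nat" where f: "strict_mono f" "monoseq (\<lambda>n. s (f n))"
    using seq_monosub by blast
  show ?thesis
  proof (cases "incseq (\<lambda>n. s (f n))")
    case True
    then show ?thesis using f by blast
  next
    case False
    then have dec: "decseq (\<lambda>n. s (f n))"
      using f(2) by (simp add: monoseq_iff)
    obtain N where N: "\<And>n. s (f N) \<le> s (f n)"
      using ex_has_least_nat[of "\<lambda>_. True" 0 "\<lambda>n. s (f n)"] by blast
    have "s (f (n + N)) = s (f N)" for n
      using N[of "n + N"] dec by (simp add: decseq_def le_antisym)
    moreover have "strict_mono (\<lambda>n. f (n + N))"
      using f(1) by (simp add: strict_mono_def)
    ultimately show ?thesis
      by (intro exI[of _ "\<lambda>n. f (n + N)"]) (simp add: mono_def)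
  qed
qed

lemma nat_seqs_mono_subseq:
  fixes s :: "nat \<Rightarrow> nat \<Rightarrow> nat"
  shows "\<exists>f :: nat \<Rightarrow> nat. strict_mono f \<and> (\<forall>k<K. mono (\<lambda>n. s (f n) k))"
proof (induction K)
  case 0
  show ?case by (intro exI[of _ id]) (simp add: strict_mono_def)
next
  case (Suc K)
  then obtain f :: "nat \<Rightarrow> nat" where f: "strict_mono f" "\<And>k. k < K \<Longrightarrow> mono (\<lambda>n. s (f n) k)"
    by blast
  obtain g :: "nat \<Rightarrow> nat" where g: "strict_mono g" "mono (\<lambda>n. s (f (g n)) K)"
    using nat_seq_mono_subseq[of "\<lambda>n. s (f n) K"] by blast
  show ?case
  proof (intro exI[of _ "\<lambda>n. f (g n)"] conjI allI impI)
    show "strict_mono (\<lambda>n. f (g n))"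
      using f(1) g(1) by (simp add: strict_mono_def)
  next
    fix k assume "k < Suc K"
    then consider "k < K" | "k = K" by linarith
    then show "mono (\<lambda>n. s (f (g n)) k)"
    proof cases
      case 1
      have "mono g" using g(1) by (rule strict_mono_mono)
      then show ?thesis using f(2)[OF 1] by (simp add: mono_def)
    qed (use g in simp)
  qed
qed

text \<open>Along a subsequence on which the exponents of the first \<open>K\<close> variables all
  increase, each monomial divides the later ones; the first two members already give
  \<open>i\<close>, \<open>j\<close> and \<open>d\<close>.\<close>

lemma dickson:
  fixes e :: "nat \<Rightarrow> nat \<Rightarrow>\<^sub>0 nat"
  assumes "\<And>n. Poly_Mapping.keys (e n) \<subseteq> {..<K}"
  obtains i j d where "i < j" "e j = e i + d" "Poly_Mapping.keys d \<subseteq> {..<K}"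
proof -
  obtain f :: "nat \<Rightarrow> nat" where f: "strict_mono f" "\<And>k. k < K \<Longrightarrow> mono (\<lambda>n. Poly_Mapping.lookup (e (f n)) k)"
    using nat_seqs_mono_subseq[of K "\<lambda>n k. Poly_Mapping.lookup (e n) k"] by blast
  have le: "Poly_Mapping.lookup (e (f 0)) k \<le> Poly_Mapping.lookup (e (f 1)) k" for k
  proof (cases "k < K")
    case True
    then show ?thesis using f(2)[OF True] by (simp add: mono_def)
  next
    case False
    then have "k \<notin> Poly_Mapping.keys (e (f 0))"
      using assms by fastforce
    then show ?thesis by (simp add: in_keys_iff)
  qed
  show thesis
  proof
    show "f 0 < f 1" using f(1) by (simp add: strict_mono_def)
    show "e (f 1) = e (f 0) + (e (f 1) - e (f 0))"
      by (rule poly_mapping_eqI) (use le in \<open>simp add: lookup_add lookup_minus\<close>)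
    show "Poly_Mapping.keys (e (f 1) - e (f 0)) \<subseteq> {..<K}"
    proof
      fix k assume "k \<in> Poly_Mapping.keys (e (f 1) - e (f 0))"
      then have "k \<in> Poly_Mapping.keys (e (f 1))"
        by (auto simp: in_keys_iff lookup_minus)
      then show "k \<in> {..<K}" using assms by blast
    qed
  qed
qed

lemma le_add_exponent: "e \<le> e + d" for e d :: "nat \<Rightarrow>\<^sub>0 nat"
proof -
  have "0 \<le> d"
  proof (rule ccontr)
    assume "\<not> 0 \<le> d"
    then have "d < 0" by simp
    then show False by (simp add: less_poly_mapping.rep_eq less_fun_def)
  qed
  then show ?thesis using add_left_mono[of 0 d e] by simp
qed

text \<open>In an infinite descent, Dickson's lemma would find a multiple of an earlier monomial,
  and a multiple is never smaller. With infinitely many variables this fails: in this lexicographic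
  order the variables themselves form a descending chain.\<close>

lemma wf_exponents:
  "wf {(d, e :: nat \<Rightarrow>\<^sub>0 nat). d < e \<and> Poly_Mapping.keys d \<subseteq> {..<K} \<and> Poly_Mapping.keys e \<subseteq> {..<K}}"
  unfolding wf_iff_no_infinite_down_chain
proof
  assume "\<exists>f. \<forall>i. (f (Suc i), f i) \<in>
    {(d, e :: nat \<Rightarrow>\<^sub>0 nat). d < e \<and> Poly_Mapping.keys d \<subseteq> {..<K} \<and> Poly_Mapping.keys e \<subseteq> {..<K}}"
  then obtain f :: "nat \<Rightarrow> nat \<Rightarrow>\<^sub>0 nat"
    where f: "\<And>i. f (Suc i) < f i" "\<And>i. Poly_Mapping.keys (f i) \<subseteq> {..<K}"
    by blast
  obtain i j d where "i < j" "f j = f i + d"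
    by (rule dickson[of f K]) (use f(2) in blast)+
  moreover have "f j < f i" if "i < j" for i j
    using that by (induction j) (use f(1) in \<open>auto simp: less_Suc_eq intro: less_trans\<close>)
  ultimately show False
    using le_add_exponent[of "f i" d] by (metis leD)
qed

section \<open>Leading exponents and Hilbert's basis theorem\<close>

definition lead :: "('v::linorder, 'a::zero) polys \<Rightarrow> 'v \<Rightarrow>\<^sub>0 nat"
  where "lead p = Max (Poly_Mapping.keys p)"

lemma lead_in_keys: "p \<noteq> 0 \<Longrightarrow> lead p \<in> Poly_Mapping.keys p"
  unfolding lead_def by (rule Max_in) (auto simp: poly_mapping_eq_iff fun_eq_iff in_keys_iff)

lemma le_lead: "e \<in> Poly_Mapping.keys p \<Longrightarrow> e \<le> lead p"
  unfolding lead_def by simp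

lemma lead_eqI:
  "\<mu> \<in> Poly_Mapping.keys p \<Longrightarrow> (\<And>e. e \<in> Poly_Mapping.keys p \<Longrightarrow> e \<le> \<mu>) \<Longrightarrow> lead p = \<mu>"
  unfolding lead_def by (rule Max_eqI) auto

text \<open>If no \<open>p n\<close> lay in the ideal \<open>gen n\<close> of its predecessors,
  every step would add an element whose leading exponent is new. By Dickson's lemma one of these
  exponents is a multiple of an earlier one, hence not new. The form with a sequence is the one that
  Krull's theorem needs: one member is a combination of those before it.\<close>

theorem hilbert_basis:
  fixes p :: "nat \<Rightarrow> (nat, 'a::field) polys"
  assumes p: "\<And>n. p n \<in> polys_in {..<K}"
  obtains n q where "\<And>i. q i \<in> polys_in {..<K}" "p n = (\<Sum>i<n. q i * p i)"
proof -
  define gen where "gen n = {f. \<exists>q. (\<forall>i. q i \<in> polys_in {..<K}) \<and> f = (\<Sum>i<n. q i * p i)}" for n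
  have gen_0: "0 \<in> gen n" for n
    unfolding gen_def by (auto intro!: exI[of _ "\<lambda>_. 0"])
  have gen_add: "f + g \<in> gen n" if fg: "f \<in> gen n" "g \<in> gen n" for f g n
  proof -
    obtain q where "\<forall>i. q i \<in> polys_in {..<K}" "f = (\<Sum>i<n. q i * p i)"
      using fg unfolding gen_def by blast
    moreover obtain r where "\<forall>i. r i \<in> polys_in {..<K}" "g = (\<Sum>i<n. r i * p i)"
      using fg unfolding gen_def by blast
    ultimately show ?thesis unfolding gen_def
      by (auto intro!: exI[of _ "\<lambda>i. q i + r i"] polys_in_add simp: distrib_right sum.distrib)
  qed
  have gen_mult: "a * f \<in> gen n" if fg: "f \<in> gen n" "a \<in> polys_in {..<K}" for a f n
  proof -
    obtain q where "\<forall>i. q i \<in> polys_in {..<K}" "f = (\<Sum>i<n. q i * p i)"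
      using fg unfolding gen_def by blast
    then show ?thesis unfolding gen_def using fg(2)
      by (auto intro!: exI[of _ "\<lambda>i. a * q i"] polys_in_mult simp: sum_distrib_left mult.assoc)
  qed
  have gen_Suc: "gen n \<subseteq> gen (Suc n)" for n
  proof
    fix f assume "f \<in> gen n"
    then obtain q where "\<forall>i. q i \<in> polys_in {..<K}" "f = (\<Sum>i<n. q i * p i)"
      unfolding gen_def by blast
    then show "f \<in> gen (Suc n)" unfolding gen_def
      by (auto intro!: exI[of _ "q(n := 0)"])
  qed
  have gen_mono: "gen i \<subseteq> gen j" if "i \<le> j" for i j
    using that gen_Suc by (rule lift_Suc_mono_le[rotated])
  have gen_p: "p n \<in> gen (Suc n)" for n
    unfolding gen_def
    by (auto intro!: exI[of _ "\<lambda>i. if i = n then 1 else 0"] simp: polys_in_def if_distrib[of "\<lambda>x. x * _"] split: if_splits cong: if_cong)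
  have gen_in: "gen n \<subseteq> polys_in {..<K}" for n
    unfolding gen_def using p by (auto intro!: polys_in_sum polys_in_mult)
  have "\<exists>n. p n \<in> gen n"
  proof (rule ccontr)
    assume "\<not> (\<exists>n. p n \<in> gen n)"
    then have notin: "\<And>n. p n \<notin> gen n" by blast
    \<comment> \<open>An element of \<open>gen (Suc n) - gen n\<close> with least leading exponent
      will do: were this exponent attained in \<open>gen n\<close>, cancelling the leading terms
      would leave an element of the same difference with a smaller one.\<close>
    have "\<exists>f. f \<in> gen (Suc n) \<and> f \<noteq> 0 \<and> (\<forall>g\<in>gen n. g \<noteq> 0 \<longrightarrow> lead g \<noteq> lead f)" for n
    proof -
      define S where "S = lead ` (gen (Suc n) - gen n)"
      have lead_K: "Poly_Mapping.keys (lead f) \<subseteq> {..<K}" if "f \<in> gen (Suc n) - gen n" for f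
      proof -
        have "f \<noteq> 0" using that gen_0 by auto
        then show ?thesis using lead_in_keys[of f] that gen_in unfolding polys_in_def by blast
      qed
      have "lead (p n) \<in> S" unfolding S_def using notin gen_p by blast
      then obtain \<mu> where \<mu>: "\<mu> \<in> S" and
        min: "\<And>e. (e, \<mu>) \<in> {(d, e). d < e \<and> Poly_Mapping.keys d \<subseteq> {..<K} \<and> Poly_Mapping.keys e \<subseteq> {..<K}}
          \<Longrightarrow> e \<notin> S"
        using wfE_min[OF wf_exponents] by (metis (no_types, lifting))
      obtain f where f: "f \<in> gen (Suc n)" "f \<notin> gen n" "\<mu> = lead f"
        using \<mu> unfolding S_def by blast
      have f0: "f \<noteq> 0" using f gen_0 by auto
      have "lead g \<noteq> lead f" if g: "g \<in> gen n" "g \<noteq> 0" for g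
      proof
        assume eq: "lead g = lead f"
        define c where "c = Poly_Mapping.lookup f \<mu> / Poly_Mapping.lookup g \<mu>"
        define h where "h = f + Poly_Mapping.single 0 (- c) * g"
        have lg: "Poly_Mapping.lookup g \<mu> \<noteq> 0"
          using lead_in_keys[OF g(2)] eq f(3) by (simp add: in_keys_iff)
        have lh: "Poly_Mapping.lookup h e = Poly_Mapping.lookup f e - c * Poly_Mapping.lookup g e" for e
        proof -
          have "Poly_Mapping.lookup (Poly_Mapping.single 0 c * g) e = c * Poly_Mapping.lookup g e" for c
            by (subst poly_mapping_sum_single[of g])
              (simp add: sum_distrib_left mult_single lookup_sum lookup_single when_def in_keys_iff)
          then show ?thesis by (simp add: h_def lookup_add)
        qed
        have h_in: "h \<in> gen (Suc n)"
          unfolding h_def using f g gen_Suc by (intro gen_add gen_mult) auto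
        have h_notin: "h \<notin> gen n"
        proof
          assume "h \<in> gen n"
          then have "h + Poly_Mapping.single 0 c * g \<in> gen n"
            using g by (intro gen_add gen_mult) auto
          moreover have "h + Poly_Mapping.single 0 c * g = f"
            by (simp add: h_def single_uminus)
          ultimately show False using f by simp
        qed
        have h0: "h \<noteq> 0" using h_notin gen_0 by auto
        have "lead h < \<mu>"
        proof -
          have k: "Poly_Mapping.lookup f (lead h) \<noteq> 0 \<or> Poly_Mapping.lookup g (lead h) \<noteq> 0"
            using lead_in_keys[OF h0] by (auto simp: in_keys_iff lh)
          then have "lead h \<le> \<mu>"
            using le_lead[of "lead h" f] le_lead[of "lead h" g] f(3) eq by (auto simp: in_keys_iff)
          moreover have "lead h \<noteq> \<mu>"
            using lead_in_keys[OF h0] lg by (auto simp: in_keys_iff lh c_def)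
          ultimately show ?thesis by simp
        qed
        moreover have "lead h \<in> S" unfolding S_def using h_in h_notin by blast
        ultimately show False
          using min[of "lead h"] lead_K[of h] lead_K[of f] h_in h_notin f by auto
      qed
      then show ?thesis using f f0 by blast
    qed
    then obtain f where f: "\<And>n. f n \<in> gen (Suc n)" "\<And>n. f n \<noteq> 0"
      "\<And>n g. g \<in> gen n \<Longrightarrow> g \<noteq> 0 \<Longrightarrow> lead g \<noteq> lead (f n)"
      by metis
    have "Poly_Mapping.keys (lead (f n)) \<subseteq> {..<K}" for n
      using lead_in_keys[OF f(2)[of n]] f(1)[of n] gen_in unfolding polys_in_def by blast
    then obtain i j d where ij: "i < j" and d: "lead (f j) = lead (f i) + d" "Poly_Mapping.keys d \<subseteq> {..<K}"
      using dickson[of "\<lambda>n. lead (f n)" K] by blast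
    \<comment> \<open>Multiplied by the monomial \<open>d\<close>, \<open>f i\<close> acquires the
      leading exponent of \<open>f j\<close> without leaving the earlier ideal.\<close>
    let ?g = "Poly_Mapping.single d 1 * f i"
    have "?g \<in> gen (Suc i)"
      using f(1) d by (intro gen_mult polys_in_single)
    then have "?g \<in> gen j"
      using gen_mono[of "Suc i" j] ij by auto
    moreover have g0: "?g \<noteq> 0"
      using f(2) by (metis lookup_single_eq lookup_zero mult_eq_0_iff zero_neq_one)
    moreover have "lead ?g = lead (f j)"
    proof (rule lead_eqI)
      have "Poly_Mapping.lookup ?g (d + lead (f i)) = 1 * Poly_Mapping.lookup (f i) (lead (f i))"
        using lookup_mult_max[of "Poly_Mapping.single d 1" d "f i" "lead (f i)"] le_lead
        by (auto split: if_splits)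
      then show "lead (f j) \<in> Poly_Mapping.keys ?g"
        using lead_in_keys[OF f(2)] d by (simp add: in_keys_iff add.commute)
    next
      fix e assume "e \<in> Poly_Mapping.keys ?g"
      then obtain a b where "e = a + b" "a \<in> Poly_Mapping.keys (Poly_Mapping.single d (1::'a))"
        "b \<in> Poly_Mapping.keys (f i)"
        using keys_mult by blast
      then show "e \<le> lead (f j)"
        using le_lead[of b "f i"] d add_left_mono[of b "lead (f i)" d]
          by (auto simp: add.commute split: if_splits)
    qed
    ultimately show False using f(3) by blast
  qed
  then show thesis using that unfolding gen_def by blast
qed

section \<open>Derivations of the fraction field\<close>

definition derivation :: "('a::comm_ring_1 \<Rightarrow> 'a) \<Rightarrow> bool"
  where "derivation d \<longleftrightarrow>
    (\<forall>x y. d (x + y) = d x + d y) \<and> (\<forall>x y. d (x * y) = d x * y + x * d y)"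

lemma derivation_add: "derivation d \<Longrightarrow> d (x + y) = d x + d y"
  and derivation_mult: "derivation d \<Longrightarrow> d (x * y) = d x * y + x * d y"
  by (simp_all add: derivation_def)

lemma derivation_0: "derivation d \<Longrightarrow> d 0 = 0"
  using derivation_add[of d 0 0] by simp

lemma derivation_1: "derivation d \<Longrightarrow> d 1 = 0"
  using derivation_mult[of d 1 1] by (metis add_left_cancel add.right_neutral mult_1 mult_1_right)

lemma derivation_sum: "derivation d \<Longrightarrow> d (sum f A) = (\<Sum>a\<in>A. d (f a))"
  by (induction A rule: infinite_finite_induct) (simp_all add: derivation_0 derivation_add)

lemma derivation_diff: "derivation d \<Longrightarrow> d (x - y) = d x - d y"
  using derivation_add[of d "x - y" y] by (simp add: algebra_simps)

text \<open>Serves to carry the Euler derivations over to the fraction field.\<close>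

definition fract_deriv :: "('a::idom \<Rightarrow> 'a) \<Rightarrow> 'a fract \<Rightarrow> 'a fract"
  where "fract_deriv d x = (THE z. \<exists>p q. q \<noteq> 0 \<and> x = Fract p q \<and>
    z = Fract (d p * q - p * d q) (q * q))"

lemma fract_deriv_Fract:
  assumes d: "derivation d" and "q \<noteq> 0"
  shows "fract_deriv d (Fract p q) = Fract (d p * q - p * d q) (q * q)"
proof -
  have wd: "Fract (d a * b - a * d b) (b * b) = Fract (d a' * b' - a' * d b') (b' * b')"
    if "b \<noteq> 0" "b' \<noteq> 0" "Fract a b = Fract a' b'" for a b a' b'
  proof -
    have eq: "a * b' = a' * b"
      using that by (simp add: eq_fract)
    have "d a * b' + a * d b' = d a' * b + a' * d b"
      using arg_cong[OF eq, of d] by (simp add: derivation_mult[OF d])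
    from eq this have "(d a * b - a * d b) * (b' * b') = (d a' * b' - a' * d b') * (b * b)"
      by (rule quotient_rule_wd)
    then show ?thesis
      using that by (simp add: eq_fract)
  qed
  show ?thesis
    unfolding fract_deriv_def
  proof (rule the_equality)
    show "\<exists>p' q'. q' \<noteq> 0 \<and> Fract p q = Fract p' q' \<and>
        Fract (d p * q - p * d q) (q * q) = Fract (d p' * q' - p' * d q') (q' * q')"
      by (intro exI[of _ p] exI[of _ q] conjI assms refl)
  next
    fix z
    assume "\<exists>p' q'. q' \<noteq> 0 \<and> Fract p q = Fract p' q' \<and>
      z = Fract (d p' * q' - p' * d q') (q' * q')"
    then obtain p' q' where "q' \<noteq> 0" "Fract p q = Fract p' q'"
      and z: "z = Fract (d p' * q' - p' * d q') (q' * q')"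
      by (elim exE conjE)
    then show "z = Fract (d p * q - p * d q) (q * q)"
      unfolding z by (intro wd assms) (simp_all only: not_False_eq_True)
  qed
qed

lemma derivation_fract_deriv:
  assumes d: "derivation d"
  shows "derivation (fract_deriv d)"
proof -
  have "fract_deriv d (x + y) = fract_deriv d x + fract_deriv d y \<and>
    fract_deriv d (x * y) = fract_deriv d x * y + x * fract_deriv d y" for x y
  proof (cases x, cases y)
    fix a b a' b'
    assume x: "x = Fract a b" "b \<noteq> 0" and y: "y = Fract a' b'" "b' \<noteq> 0"
    have "fract_deriv d (x + y) = fract_deriv d x + fract_deriv d y"
      unfolding x(1) y(1)
      by (simp only: x(2) y(2) add_fract fract_deriv_Fract[OF d] no_zero_divisors not_False_eq_True
          eq_fract derivation_add[OF d] derivation_mult[OF d] quotient_rule_add)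
    moreover have "fract_deriv d (x * y) = fract_deriv d x * y + x * fract_deriv d y"
      unfolding x(1) y(1)
      by (simp only: x(2) y(2) add_fract mult_fract fract_deriv_Fract[OF d] no_zero_divisors
          not_False_eq_True eq_fract derivation_mult[OF d] quotient_rule_mult)
    ultimately show ?thesis by blast
  qed
  then show ?thesis by (simp add: derivation_def)
qed

lemma derivation_diff_poly_deriv: "derivation diff_poly_deriv"
  by (simp add: derivation_def diff_poly_deriv_add diff_poly_deriv_mult)

lemma derivation_diff_rat_deriv: "derivation diff_rat_deriv"
  by (simp add: derivation_def diff_rat_deriv_add diff_rat_deriv_mult)

definition frc :: "'a::idom \<Rightarrow> 'a fract"
  where "frc p = Fract p 1"

lemma frc_add: "frc (p + q) = frc p + frc q"
  and frc_mult: "frc (p * q) = frc p * frc q"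
  and frc_0: "frc 0 = 0"
  and frc_1: "frc 1 = 1"
  and frc_eq_0: "frc p = 0 \<longleftrightarrow> p = 0"
  by (simp_all add: frc_def eq_fract Zero_fract_def One_fract_def)

lemma frc_sum: "frc (sum f A) = (\<Sum>a\<in>A. frc (f a))"
  by (induction A rule: infinite_finite_induct) (simp_all add: frc_0 frc_add)

lemma fract_deriv_frc: "derivation d \<Longrightarrow> fract_deriv d (frc p) = frc (d p)"
  by (simp add: frc_def fract_deriv_Fract derivation_1)

lemma diff_rat_deriv_frc: "diff_rat_deriv (frc p) = frc (diff_poly_deriv p)"
  by (simp add: frc_def diff_rat_deriv_Fract derivation_1[OF derivation_diff_poly_deriv])

text \<open>For \<open>x = a / b\<close>, apply \<open>d\<close> to
  \<open>frc b * x = frc a\<close>. Identities between derivations of the field thus reduce to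
  polynomials.\<close>

lemma derivation_eq_0_if_frc:
  assumes d: "derivation d" and 0: "\<And>p. d (frc p) = 0"
  shows "d x = 0"
proof (cases x)
  fix a b assume x: "x = Fract a b" "b \<noteq> 0"
  then have "frc b * x = frc a"
    by (simp add: frc_def eq_fract)
  then have "frc b * d x = 0"
    using derivation_mult[OF d, of "frc b" x] 0 by simp
  then show ?thesis using x by (simp add: frc_eq_0)
qed

lemma diff_rat_const_frc: "diff_rat_const c = frc (Poly_Mapping.single 0 c)"
  by (simp add: diff_rat_const_def frc_def)

lemma diff_rat_const_add: "diff_rat_const (a + b) = diff_rat_const a + diff_rat_const b"
  and diff_rat_const_mult: "diff_rat_const (a * b) = diff_rat_const a * diff_rat_const b"
  and diff_rat_const_0: "diff_rat_const 0 = 0"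
  and diff_rat_const_1: "diff_rat_const 1 = 1"
  by (simp_all add: diff_rat_const_frc frc_0 frc_1 mult_single single_add flip: frc_add frc_mult)

lemma diff_rat_const_eq_0: "diff_rat_const c = 0 \<longleftrightarrow> c = 0"
  by (metis diff_rat_const_frc frc_eq_0 lookup_single_eq lookup_zero single_zero)

section \<open>Euler derivations\<close>

text \<open>The derivation \<open>t\<^sub>k \<partial>/\<partial>t\<^sub>k\<close>, which has a simpler formula than \<open>\<partial>/\<partial>t\<^sub>k\<close> and the same
  constants.\<close>

definition euler_poly :: "nat \<Rightarrow> 'c::comm_ring_1 diff_poly \<Rightarrow> 'c diff_poly"
  where "euler_poly k p = Poly_Mapping.mapp (\<lambda>e c. of_nat (Poly_Mapping.lookup e k) * c) p"

lemma lookup_euler_poly: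
  "Poly_Mapping.lookup (euler_poly k p) e = of_nat (Poly_Mapping.lookup e k) * Poly_Mapping.lookup p e"
  by (simp add: euler_poly_def mapp.rep_eq when_def in_keys_iff)

lemma keys_euler_poly: "Poly_Mapping.keys (euler_poly k p) \<subseteq> Poly_Mapping.keys p"
  by (auto simp: in_keys_iff lookup_euler_poly)

lemma euler_poly_add: "euler_poly k (p + q) = euler_poly k p + euler_poly k q"
  by (rule poly_mapping_eqI) (simp add: lookup_euler_poly lookup_add distrib_left)

lemma euler_poly_0: "euler_poly k 0 = 0"
  by (rule poly_mapping_eqI) (simp add: lookup_euler_poly)

lemma euler_poly_sum: "euler_poly k (sum f A) = (\<Sum>a\<in>A. euler_poly k (f a))"
  by (induction A rule: infinite_finite_induct) (simp_all add: euler_poly_add euler_poly_0)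

lemma euler_poly_single:
  "euler_poly k (Poly_Mapping.single e c) = Poly_Mapping.single e (of_nat (Poly_Mapping.lookup e k) * c)"
  by (rule poly_mapping_eqI) (simp add: lookup_euler_poly lookup_single when_def)

lemma derivation_euler_poly: "derivation (euler_poly k)"
proof -
  have "euler_poly k (p * q) = euler_poly k p * q + p * euler_poly k q" for p q :: "'a diff_poly"
  proof -
    let ?s = "\<lambda>p e. Poly_Mapping.single e (Poly_Mapping.lookup p e)"
    let ?p = "\<Sum>e\<in>Poly_Mapping.keys p. ?s p e" and ?q = "\<Sum>e\<in>Poly_Mapping.keys q. ?s q e"
    have 1: "Poly_Mapping.single (e + f) (of_nat (Poly_Mapping.lookup (e + f) k) * (c * d)) =
        Poly_Mapping.single (e + f) (of_nat (Poly_Mapping.lookup e k) * c * d) +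
        Poly_Mapping.single (e + f) (c * (of_nat (Poly_Mapping.lookup f k) * d))"
      for e f :: "nat \<Rightarrow>\<^sub>0 nat" and c d :: 'a
      by (simp add: lookup_add algebra_simps flip: single_add)
    have "euler_poly k (?p * ?q) = euler_poly k ?p * ?q + ?p * euler_poly k ?q"
      by (simp add: euler_poly_sum sum_product mult_single euler_poly_single 1 sum.distrib)
    then show ?thesis
      by (simp only: poly_mapping_sum_single[symmetric])
  qed
  then show ?thesis
    by (simp add: derivation_def euler_poly_add)
qed

definition euler :: "nat \<Rightarrow> 'c::field diff_rat \<Rightarrow> 'c diff_rat"
  where "euler k = fract_deriv (euler_poly k)"

definition tvar :: "nat \<Rightarrow> 'c::field diff_poly"
  where "tvar k = Poly_Mapping.single (Poly_Mapping.single k 1) 1"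

lemma derivation_euler: "derivation (euler k)"
  unfolding euler_def by (intro derivation_fract_deriv derivation_euler_poly)

lemma euler_frc: "euler k (frc p) = frc (euler_poly k p)"
  unfolding euler_def by (intro fract_deriv_frc derivation_euler_poly)

lemma euler_poly_tvar: "euler_poly k (tvar i) = (if i = k then tvar i else 0)"
  by (simp add: tvar_def euler_poly_single lookup_single when_def)

lemma euler_tvar: "euler k (frc (tvar i)) = (if i = k then frc (tvar i) else 0)"
  by (simp add: euler_frc euler_poly_tvar frc_0)

lemma deriv_tvar: "diff_rat_deriv (frc (tvar i)) = frc (tvar (Suc i))"
  by (simp only: diff_rat_deriv_frc tvar_def diff_poly_deriv_var)

lemma euler_const: "euler k (diff_rat_const c) = 0"
  by (simp add: diff_rat_const_frc euler_frc euler_poly_single frc_0)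

lemma tvar_neq_0: "frc (tvar i) \<noteq> 0"
  by (metis frc_eq_0 lookup_single_eq lookup_zero tvar_def zero_neq_one)

text \<open>The commutator of \<open>\<partial>/\<partial>t\<^sub>N\<^sub>+\<^sub>1\<close> with the
  derivation is \<open>\<partial>/\<partial>t\<^sub>N\<close>; this is that identity in terms of
  Euler derivations, multiplied by \<open>t\<^sub>N t\<^sub>N\<^sub>+\<^sub>1\<close> to clear
  denominators. The difference of the two sides is a derivation in \<open>x\<close>, so it is tested
  on constants and variables.\<close>

lemma euler_commutator:
  "frc (tvar N) * frc (tvar (Suc N)) *
     (euler (Suc N) (diff_rat_deriv x) - diff_rat_deriv (euler (Suc N) x)) =
   frc (tvar (Suc N)) * frc (tvar (Suc N)) * euler N x
     - frc (tvar N) * frc (tvar (Suc (Suc N))) * euler (Suc N) x"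
proof -
  let ?a = "frc (tvar N)" and ?b = "frc (tvar (Suc N))" and ?c = "frc (tvar (Suc (Suc N)))"
  define d where "d x = ?a * ?b * (euler (Suc N) (diff_rat_deriv x) - diff_rat_deriv (euler (Suc N) x))
    - (?b * ?b * euler N x - ?a * ?c * euler (Suc N) x)" for x :: "'a diff_rat"
  note add = derivation_add[OF derivation_euler] derivation_add[OF derivation_diff_rat_deriv]
  note mult = derivation_mult[OF derivation_euler] derivation_mult[OF derivation_diff_rat_deriv]
  have d: "derivation d"
    unfolding derivation_def d_def by (auto simp: add mult algebra_simps)
  have "d (frc p) = 0" for p
  proof (induction p rule: polys_induct)
    case (const c)
    show ?case
      by (simp add: d_def euler_const derivation_0[OF derivation_euler]
          derivation_0[OF derivation_diff_rat_deriv] flip: diff_rat_const_frc)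
  next
    case (var v)
    show ?case
      unfolding tvar_def[symmetric]
      by (simp add: d_def euler_tvar deriv_tvar derivation_0[OF derivation_euler]
          derivation_0[OF derivation_diff_rat_deriv])
  next
    case (add p q)
    then show ?case by (simp add: frc_add derivation_add[OF d])
  next
    case (mult p q)
    then show ?case by (simp add: frc_mult derivation_mult[OF d])
  qed
  then have "d x = 0"
    by (rule derivation_eq_0_if_frc[OF d])
  then show ?thesis by (simp add: d_def)
qed

text \<open>For \<open>x = p / q\<close>, subtract the constant that removes from the numerator the
  coefficient at the leading exponent \<open>\<nu>\<close> of \<open>q\<close>. The remainder
  \<open>r / q\<close> is still killed by all Euler derivations. If \<open>r\<close> were not zero,
  the top coefficients of \<open>euler_poly k r * q = r * euler_poly k q\<close> would force
  \<open>r\<close> to have leading exponent \<open>\<nu>\<close>, where its coefficient is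
  zero.\<close>

lemma const_if_euler_0:
  fixes x :: "'c::{field, ring_char_0} diff_rat"
  assumes "\<And>k. euler k x = 0"
  obtains c where "x = diff_rat_const c"
proof (cases x)
  fix p q assume x: "x = Fract p q" "q \<noteq> 0"
  have pq: "euler_poly k p * q = p * euler_poly k q" for k
    using assms[of k] x
    by (simp add: euler_def fract_deriv_Fract[OF derivation_euler_poly] Zero_fract_def eq_fract)
  define \<nu> where "\<nu> = lead q"
  have \<nu>: "Poly_Mapping.lookup q \<nu> \<noteq> 0"
    using lead_in_keys[OF x(2)] by (simp add: in_keys_iff \<nu>_def)
  define c where "c = Poly_Mapping.lookup p \<nu> / Poly_Mapping.lookup q \<nu>"
  define s where "s = (Poly_Mapping.single 0 c :: 'c diff_poly)"
  define r where "r = p - s * q"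
  have s0: "euler_poly k s = 0" for k
    by (simp add: s_def euler_poly_single)
  have r: "euler_poly k r * q = r * euler_poly k q" for k
    using pq[of k] unfolding r_def
    by (simp add: derivation_diff[OF derivation_euler_poly] derivation_mult[OF derivation_euler_poly]
        s0 algebra_simps)
  have "Poly_Mapping.lookup (s * q) (0 + \<nu>) = Poly_Mapping.lookup s 0 * Poly_Mapping.lookup q \<nu>"
    by (rule lookup_mult_max) (auto simp: s_def \<nu>_def le_lead split: if_splits)
  then have lr: "Poly_Mapping.lookup r \<nu> = 0"
    using \<nu> by (simp add: r_def lookup_minus s_def c_def)
  have "r = 0"
  proof (rule ccontr)
    assume "r \<noteq> 0"
    define \<mu> where "\<mu> = lead r"
    have \<mu>: "Poly_Mapping.lookup r \<mu> \<noteq> 0"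
      using lead_in_keys[OF \<open>r \<noteq> 0\<close>] by (simp add: in_keys_iff \<mu>_def)
    have "Poly_Mapping.lookup \<mu> k = Poly_Mapping.lookup \<nu> k" for k
    proof -
      have "Poly_Mapping.lookup (euler_poly k r * q) (\<mu> + \<nu>) =
          Poly_Mapping.lookup (euler_poly k r) \<mu> * Poly_Mapping.lookup q \<nu>"
        by (rule lookup_mult_max) (use keys_euler_poly[of k r] le_lead in \<open>auto simp: \<mu>_def \<nu>_def\<close>)
      moreover have "Poly_Mapping.lookup (r * euler_poly k q) (\<mu> + \<nu>) =
          Poly_Mapping.lookup r \<mu> * Poly_Mapping.lookup (euler_poly k q) \<nu>"
        by (rule lookup_mult_max) (use keys_euler_poly[of k q] le_lead in \<open>auto simp: \<mu>_def \<nu>_def\<close>)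
      ultimately show ?thesis
        using r[of k] \<mu> \<nu> by (simp add: lookup_euler_poly)
    qed
    then have "\<mu> = \<nu>" by (rule poly_mapping_eqI)
    then show False using lr \<mu> by simp
  qed
  then have "x = diff_rat_const c"
    using x by (simp add: r_def s_def diff_rat_const_def eq_fract)
  then show thesis by (rule that)
qed

text \<open>The field \<open>C(t\<^sub>0, \<dots>, t\<^sub>N\<^sub>-\<^sub>1)\<close>.\<close>

definition order_less :: "nat \<Rightarrow> 'c::field diff_rat set"
  where "order_less N = {x. \<forall>k\<ge>N. euler k x = 0}"

lemma order_less_diff: "x \<in> order_less N \<Longrightarrow> y \<in> order_less N \<Longrightarrow> x - y \<in> order_less N"
  by (simp add: order_less_def derivation_diff[OF derivation_euler])

lemma order_less_mult: "x \<in> order_less N \<Longrightarrow> y \<in> order_less N \<Longrightarrow> x * y \<in> order_less N"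
  by (simp add: order_less_def derivation_mult[OF derivation_euler])

lemma order_less_const: "diff_rat_const c \<in> order_less N"
  by (simp add: order_less_def euler_const)

lemma order_less_sum: "(\<And>a. a \<in> A \<Longrightarrow> f a \<in> order_less N) \<Longrightarrow> sum f A \<in> order_less N"
  by (induction A rule: infinite_finite_induct)
    (auto simp: order_less_def derivation_0[OF derivation_euler] derivation_add[OF derivation_euler])

lemma order_less_mono: "M \<le> N \<Longrightarrow> order_less M \<subseteq> order_less N"
  by (auto simp: order_less_def)

lemma ex_order_less: "\<exists>N. x \<in> order_less N"
proof (cases x)
  fix p q assume x: "x = Fract p q" "q \<noteq> 0"
  define V where "V = (\<Union>e\<in>Poly_Mapping.keys p \<union> Poly_Mapping.keys q. Poly_Mapping.keys e)"
  have "finite V" unfolding V_def by simp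
  then obtain N where N: "V \<subseteq> {..<N}"
    using finite_nat_iff_bounded by blast
  have zero: "euler_poly k r = 0" if "k \<ge> N" "r = p \<or> r = q" for k r
  proof (rule poly_mapping_eqI)
    fix e
    have "Poly_Mapping.lookup e k = 0" if "e \<in> Poly_Mapping.keys r"
    proof -
      have "k \<notin> Poly_Mapping.keys e"
        using that \<open>r = p \<or> r = q\<close> \<open>k \<ge> N\<close> N unfolding V_def by fastforce
      then show ?thesis by (simp add: in_keys_iff)
    qed
    then show "Poly_Mapping.lookup (euler_poly k r) e = Poly_Mapping.lookup 0 e"
      by (auto simp: lookup_euler_poly in_keys_iff)
  qed
  show ?thesis
    using x zero by (intro exI[of _ N])
      (simp add: order_less_def euler_def fract_deriv_Fract[OF derivation_euler_poly] fract_collapse)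
qed

text \<open>If \<open>x\<close> has order exactly \<open>N\<close>, then \<open>x'\<close> has order exactly \<open>N + 1\<close>. So a finite system
  \<open>x\<^sub>i' = Q\<^sub>i(t\<^sub>1, x)\<close> with constant coefficients has only constant solutions.\<close>

lemma autonomous_system_const:
  fixes S :: "'c::{field, ring_char_0} diff_rat set"
  assumes "finite S"
    and S: "\<And>N x. S \<subseteq> order_less (Suc N) \<Longrightarrow> x \<in> S \<Longrightarrow> diff_rat_deriv x \<in> order_less (Suc N)"
    and "x \<in> S"
  obtains c where "x = diff_rat_const c"
proof -
  obtain M :: "'c diff_rat \<Rightarrow> nat" where M: "\<And>x. x \<in> order_less (M x)"
    using ex_order_less by metis
  have "S \<subseteq> order_less (Max (M ` S))"
  proof
    fix y assume "y \<in> S"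
    then have "M y \<le> Max (M ` S)"
      using \<open>finite S\<close> by simp
    then show "y \<in> order_less (Max (M ` S))"
      using M[of y] order_less_mono by blast
  qed
  moreover have "S \<subseteq> order_less 0" if "S \<subseteq> order_less N" for N
    using that
  proof (induction N)
    case (Suc N)
    have "euler k y = 0" if "y \<in> S" "k \<ge> N" for y k
    proof (cases "k = N")
      case True
      \<comment> \<open>Neither \<open>y\<close> nor its derivative involves the variable of index
        \<open>N + 1\<close>, so in the commutator formula only the term with
        \<open>euler N y\<close> is left.\<close>
      have "euler (Suc N) y = 0" "euler (Suc N) (diff_rat_deriv y) = 0"
        using Suc.prems S[OF Suc.prems \<open>y \<in> S\<close>] \<open>y \<in> S\<close> by (auto simp: order_less_def)
      then show ?thesis
        using euler_commutator[of N y] True by (simp add: derivation_0[OF derivation_diff_rat_deriv] tvar_neq_0)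
    qed (use that Suc.prems in \<open>auto simp: order_less_def\<close>)
    then show ?case
      by (intro Suc.IH) (auto simp: order_less_def)
  qed
  ultimately have "S \<subseteq> order_less 0"
    by blast
  then have "euler k x = 0" for k
    using \<open>x \<in> S\<close> by (auto simp: order_less_def)
  then show thesis
    using const_if_euler_0 that by blast
qed

section \<open>Powers of the indeterminate\<close>

definition tpow :: "nat \<Rightarrow> 'c::field diff_rat"
  where "tpow b = frc (Poly_Mapping.single (Poly_Mapping.single 0 (Suc b)) 1)"

lemma tpow_mult_const:
  "tpow b * diff_rat_const c = frc (Poly_Mapping.single (Poly_Mapping.single 0 (Suc b)) c)"
  by (simp add: tpow_def diff_rat_const_frc mult_single flip: frc_mult)

lemma tpow_order_less: "tpow b \<in> order_less (Suc N)"
  by (simp add: order_less_def tpow_def euler_frc euler_poly_single lookup_single when_def frc_0)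

text \<open>Distinct powers of \<open>t\<^sub>1\<close> are distinct monomials. By this an identity
  for the combined field splits into one for each invariant field.\<close>

lemma tpow_independent:
  assumes "finite B" "(\<Sum>b\<in>B. tpow b * diff_rat_const (z b)) = 0" "b \<in> B"
  shows "z b = 0"
proof -
  let ?p = "\<Sum>b\<in>B. Poly_Mapping.single (Poly_Mapping.single (0::nat) (Suc b)) (z b)"
  have "?p = 0"
    using assms(2) by (simp add: tpow_mult_const frc_eq_0 flip: frc_sum)
  moreover have "Poly_Mapping.lookup ?p (Poly_Mapping.single 0 (Suc b)) = z b"
  proof -
    have "Poly_Mapping.lookup ?p (Poly_Mapping.single 0 (Suc b)) = (\<Sum>b'\<in>B. if b' = b then z b' else 0)"
      unfolding lookup_sum
    proof (rule sum.cong)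
      fix b'
      have "Poly_Mapping.single (0::nat) (Suc b') = Poly_Mapping.single 0 (Suc b) \<longleftrightarrow> b' = b"
        by (metis lookup_single_eq nat.inject)
      then show "Poly_Mapping.lookup (Poly_Mapping.single (Poly_Mapping.single (0::nat) (Suc b')) (z b'))
          (Poly_Mapping.single 0 (Suc b)) = (if b' = b then z b' else 0)"
        by (simp add: lookup_single when_def)
    qed simp
    then show ?thesis using assms by simp
  qed
  ultimately show ?thesis by simp
qed

section \<open>Polynomial functions\<close>

text \<open>Only the values on \<open>X\<close> matter, by the rule \<open>polyfun_cong\<close>. The
  same notion serves for the coordinate ring of \<open>G\<close>, for its extension to
  \<open>F\<close> and for the Rees algebra in Krull's theorem.\<close>

inductive_set polyfun :: "'x set \<Rightarrow> nat \<Rightarrow> (nat \<Rightarrow> 'x \<Rightarrow> 'a::comm_ring_1) \<Rightarrow> ('x \<Rightarrow> 'a) set"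
  for X K c where
  polyfun_const: "(\<lambda>_. a) \<in> polyfun X K c"
| polyfun_coord: "k < K \<Longrightarrow> c k \<in> polyfun X K c"
| polyfun_add: "f \<in> polyfun X K c \<Longrightarrow> g \<in> polyfun X K c \<Longrightarrow> (\<lambda>x. f x + g x) \<in> polyfun X K c"
| polyfun_mult: "f \<in> polyfun X K c \<Longrightarrow> g \<in> polyfun X K c \<Longrightarrow> (\<lambda>x. f x * g x) \<in> polyfun X K c"
| polyfun_cong: "f \<in> polyfun X K c \<Longrightarrow> (\<And>x. x \<in> X \<Longrightarrow> g x = f x) \<Longrightarrow> g \<in> polyfun X K c"

lemma polyfun_sum:
  "(\<And>i. i \<in> I \<Longrightarrow> f i \<in> polyfun X K c) \<Longrightarrow> (\<lambda>x. \<Sum>i\<in>I. f i x) \<in> polyfun X K c"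
  by (induction I rule: infinite_finite_induct) (auto intro: polyfun_const polyfun_add)

lemma polyfun_prod:
  "(\<And>i. i \<in> I \<Longrightarrow> f i \<in> polyfun X K c) \<Longrightarrow> (\<lambda>x. \<Prod>i\<in>I. f i x) \<in> polyfun X K c"
  by (induction I rule: infinite_finite_induct) (auto intro: polyfun_const polyfun_mult)

lemma polyfun_scale: "f \<in> polyfun X K c \<Longrightarrow> (\<lambda>x. a * f x) \<in> polyfun X K c"
  by (rule polyfun_mult[OF polyfun_const])

lemma polyfun_uminus: "f \<in> polyfun X K c \<Longrightarrow> (\<lambda>x. - f x) \<in> polyfun X K c"
  using polyfun_scale[of f X K c "- 1"] by simp

lemma polyfun_diff:
  "f \<in> polyfun X K c \<Longrightarrow> g \<in> polyfun X K c \<Longrightarrow> (\<lambda>x. f x - g x) \<in> polyfun X K c"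
  using polyfun_add[OF _ polyfun_uminus, of f X K c g] by simp

lemma polyfun_subst:
  assumes "f \<in> polyfun X K c" "\<And>y. y \<in> Y \<Longrightarrow> h y \<in> X"
    and "\<And>k. k < K \<Longrightarrow> (\<lambda>y. c k (h y)) \<in> polyfun Y L d"
  shows "(\<lambda>y. f (h y)) \<in> polyfun Y L d"
  using assms(1)
proof induction
  case (polyfun_cong f g)
  show ?case by (rule polyfun.polyfun_cong[OF polyfun_cong.IH]) (use polyfun_cong assms(2) in auto)
qed (auto intro: polyfun.intros assms)

lemma poly_eval_const [simp]: "poly_eval x (Poly_Mapping.single 0 c) = c"
  by (simp add: poly_eval_single mon_eval_def)

lemma poly_eval_var: "poly_eval x (Poly_Mapping.single (Poly_Mapping.single v 1) 1) = x v"
  by (simp add: poly_eval_single mon_eval_def)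

declare poly_eval_var [unfolded One_nat_def, simp]

lemma polyfun_imp_poly_eval:
  fixes f :: "'x \<Rightarrow> 'a::comm_ring_1"
  assumes "f \<in> polyfun X K c"
  shows "\<exists>p\<in>polys_in {..<K}. \<forall>x\<in>X. f x = poly_eval (\<lambda>k. c k x) p"
  using assms
proof induction
  case (polyfun_const a)
  show ?case by (rule bexI[of _ "Poly_Mapping.single 0 a"]) auto
next
  case (polyfun_coord k)
  show ?case
    by (rule bexI[of _ "Poly_Mapping.single (Poly_Mapping.single k 1) 1"])
      (use polyfun_coord polys_in_var[of k "{..<K}" "1::'a"] in auto)
next
  case (polyfun_add f g)
  then obtain p q where "p \<in> polys_in {..<K}" "\<forall>x\<in>X. f x = poly_eval (\<lambda>k. c k x) p"
    "q \<in> polys_in {..<K}" "\<forall>x\<in>X. g x = poly_eval (\<lambda>k. c k x) q" by blast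
  then show ?case by (intro bexI[of _ "p + q"]) (auto simp: poly_eval_add polys_in_add)
next
  case (polyfun_mult f g)
  then obtain p q where "p \<in> polys_in {..<K}" "\<forall>x\<in>X. f x = poly_eval (\<lambda>k. c k x) p"
    "q \<in> polys_in {..<K}" "\<forall>x\<in>X. g x = poly_eval (\<lambda>k. c k x) q" by blast
  then show ?case by (intro bexI[of _ "p * q"]) (auto simp: poly_eval_mult polys_in_mult)
qed auto

lemma poly_eval_polyfun:
  assumes "p \<in> polys_in {..<K}"
  shows "(\<lambda>x. poly_eval (\<lambda>k. c k x) p) \<in> polyfun X K c"
  using assms
proof (induction p rule: polys_in_induct)
  case (const a)
  show ?case by (simp add: polyfun_const)
next
  case (var v)
  then show ?case using polyfun_coord[of v K c X] by (simp only: poly_eval_var lessThan_iff)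
next
  case (add p q)
  then show ?case by (simp add: poly_eval_add polyfun_add)
next
  case (mult p q)
  then show ?case by (simp add: poly_eval_mult polyfun_mult)
qed

lemma polyfun_hilbert_basis:
  fixes f :: "nat \<Rightarrow> 'x \<Rightarrow> 'a::field"
  assumes "\<And>n. f n \<in> polyfun X K c"
  obtains n q where "\<And>i. q i \<in> polyfun X K c" "\<And>x. x \<in> X \<Longrightarrow> f n x = (\<Sum>i<n. q i x * f i x)"
proof -
  have "\<forall>n. \<exists>p. p \<in> polys_in {..<K} \<and> (\<forall>x\<in>X. f n x = poly_eval (\<lambda>k. c k x) p)"
    using polyfun_imp_poly_eval[OF assms] by blast
  from choice[OF this] obtain p where
    p: "\<And>n. p n \<in> polys_in {..<K}" "\<And>n x. x \<in> X \<Longrightarrow> f n x = poly_eval (\<lambda>k. c k x) (p n)"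
    by blast
  obtain n q where "\<And>i. q i \<in> polys_in {..<K}" "p n = (\<Sum>i<n. q i * p i)"
    by (rule hilbert_basis[of p K, OF p(1)], rule that)
  then show thesis
    by (intro that[of "\<lambda>i x. poly_eval (\<lambda>k. c k x) (q i)" n])
      (auto simp: poly_eval_polyfun p poly_eval_sum poly_eval_mult)
qed

section \<open>Interpolation in finite-dimensional spaces of functions\<close>

text \<open>Unlike \<open>polyfun\<close>, the span is not closed under changes outside a set
  \<open>X\<close>; hence later statements provide an element of the span that agrees with a given
  function on \<open>G\<close>.\<close>

inductive_set fspan :: "('x \<Rightarrow> 'a::comm_ring_1) set \<Rightarrow> ('x \<Rightarrow> 'a) set"
  for U where
  fspan_0: "(\<lambda>_. 0) \<in> fspan U"
| fspan_step: "f \<in> fspan U \<Longrightarrow> u \<in> U \<Longrightarrow> (\<lambda>x. a * u x + f x) \<in> fspan U"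

lemma fspan_incl: "u \<in> U \<Longrightarrow> u \<in> fspan U"
  using fspan_step[OF fspan_0, of u U 1] by simp

lemma fspan_add: "f \<in> fspan U \<Longrightarrow> g \<in> fspan U \<Longrightarrow> (\<lambda>x. f x + g x) \<in> fspan U"
proof (induction rule: fspan.induct)
  case (fspan_step f u a)
  then have "(\<lambda>x. a * u x + (f x + g x)) \<in> fspan U" by (intro fspan.fspan_step) auto
  then show ?case by (simp add: add.assoc)
qed simp

lemma fspan_scale: "f \<in> fspan U \<Longrightarrow> (\<lambda>x. b * f x) \<in> fspan U"
proof (induction rule: fspan.induct)
  case (fspan_step f u a)
  then have "(\<lambda>x. (b * a) * u x + b * f x) \<in> fspan U" by (intro fspan.fspan_step) auto
  then show ?case by (simp add: algebra_simps)
qed (use fspan_0 in simp)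

lemma fspan_sum:
  "(\<And>i. i \<in> I \<Longrightarrow> f i \<in> fspan U) \<Longrightarrow> (\<lambda>x. \<Sum>i\<in>I. f i x) \<in> fspan U"
  by (induction I rule: infinite_finite_induct) (auto intro: fspan_0 fspan_add)

lemma fspan_diff: "f \<in> fspan U \<Longrightarrow> g \<in> fspan U \<Longrightarrow> (\<lambda>x. f x - g x) \<in> fspan U"
  using fspan_add[OF _ fspan_scale, of f U g "- 1"] by simp

lemma fspan_mono: "U \<subseteq> V \<Longrightarrow> fspan U \<subseteq> fspan V"
proof
  fix f assume "U \<subseteq> V" and "f \<in> fspan U"
  from this(2) show "f \<in> fspan V"
    by (induction rule: fspan.induct) (use \<open>U \<subseteq> V\<close> in \<open>auto intro: fspan.intros\<close>)
qed

text \<open>The points \<open>P\<close> and functions \<open>b p\<close> play the role of a basis with its dual basis: a function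
  is recovered from its values on \<open>P\<close>.\<close>

definition interpolates ::
  "'x set \<Rightarrow> ('x \<Rightarrow> 'a::comm_ring_1) set \<Rightarrow> 'x set \<Rightarrow> ('x \<Rightarrow> 'x \<Rightarrow> 'a) \<Rightarrow> bool"
  where "interpolates X W P b \<longleftrightarrow> finite P \<and> P \<subseteq> X \<and>
    (\<forall>p\<in>P. \<forall>q\<in>P. b p q = (if p = q then 1 else 0)) \<and>
    (\<forall>w\<in>W. \<forall>x\<in>X. w x = (\<Sum>p\<in>P. w p * b p x))"

lemma sum_dual_family:
  fixes b :: "'x \<Rightarrow> 'x \<Rightarrow> 'a::comm_ring_1"
  assumes "finite P" "\<forall>p\<in>P. \<forall>q\<in>P. b p q = (if p = q then 1 else 0)" "h \<in> P"
  shows "(\<Sum>p\<in>P. f p * b p h) = f h"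
proof -
  have "(\<Sum>p\<in>P. f p * b p h) = (\<Sum>p\<in>P. if p = h then f h else 0)"
    by (rule sum.cong) (simp_all add: assms)
  then show ?thesis using assms by simp
qed

text \<open>Evaluation at a point \<open>p\<close> of \<open>P\<close> identifies the coefficient
  \<open>c p\<close> as the value \<open>f p\<close>.\<close>

lemma interpolates_combination:
  fixes b :: "'x \<Rightarrow> 'x \<Rightarrow> 'a::comm_ring_1"
  assumes "finite P" "\<forall>p\<in>P. \<forall>q\<in>P. b p q = (if p = q then 1 else 0)" "P \<subseteq> X"
    and "\<And>x. x \<in> X \<Longrightarrow> f x = (\<Sum>p\<in>P. c p * b p x)" "x \<in> X"
  shows "f x = (\<Sum>p\<in>P. f p * b p x)"
proof -
  have "f p = c p" if "p \<in> P" for p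
    using assms(3,4) sum_dual_family[OF assms(1,2) that, of c] that by auto
  then show ?thesis using assms(4,5) by simp
qed

text \<open>One elimination step. As \<open>w\<close> vanishes on \<open>P\<close> but not at
  \<open>h\<close>, its normalisation is the dual function of \<open>h\<close>, and subtracting
  multiples of it makes the old dual functions vanish at \<open>h\<close>. The last conclusion says
  that interpolation changes by a correction for the error at \<open>h\<close>.\<close>

lemma dual_family_extend:
  fixes b :: "'x \<Rightarrow> 'x \<Rightarrow> 'a::field"
  assumes P: "finite P" "\<forall>p\<in>P. \<forall>q\<in>P. b p q = (if p = q then 1 else 0)"
    and w: "w h \<noteq> 0" "\<forall>p\<in>P. w p = 0"
    and b': "b' = (\<lambda>p x. if p = h then w x / w h else b p x - b p h * (w x / w h))"
  shows "h \<notin> P"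
    and "\<And>p q. p \<in> insert h P \<Longrightarrow> q \<in> insert h P \<Longrightarrow> b' p q = (if p = q then 1 else 0)"
    and "\<And>f x. (\<Sum>p\<in>insert h P. f p * b' p x) =
      (\<Sum>p\<in>P. f p * b p x) + (f h - (\<Sum>p\<in>P. f p * b p h)) * (w x / w h)"
proof -
  show h: "h \<notin> P" using w by auto
  show "b' p q = (if p = q then 1 else 0)" if "p \<in> insert h P" "q \<in> insert h P" for p q
    using that P w h unfolding b' by auto
  show "(\<Sum>p\<in>insert h P. f p * b' p x) =
      (\<Sum>p\<in>P. f p * b p x) + (f h - (\<Sum>p\<in>P. f p * b p h)) * (w x / w h)" for f x
  proof -
    have "(\<Sum>p\<in>P. f p * b' p x) = (\<Sum>p\<in>P. f p * (b p x - b p h * (w x / w h)))"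
      using h by (intro sum.cong) (auto simp: b')
    also have "\<dots> = (\<Sum>p\<in>P. f p * b p x) - (\<Sum>p\<in>P. f p * b p h) * (w x / w h)"
      by (simp add: algebra_simps sum_subtractf sum_distrib_left sum_distrib_right sum_divide_distrib)
    finally show ?thesis
      using P(1) h by (simp add: b' algebra_simps)
  qed
qed

text \<open>The functions are added one at a time. If the error \<open>w\<close> of interpolating
  the new function is not zero on \<open>X\<close>, a point where it differs from zero joins
  \<open>P\<close>.\<close>

lemma ex_interpolates:
  fixes U :: "('x \<Rightarrow> 'a::field) set"
  assumes "finite U"
  obtains P b where "interpolates X (fspan U) P b" "\<And>p. p \<in> P \<Longrightarrow> b p \<in> fspan U"
proof -
  have "\<exists>P b. interpolates X U P b \<and> (\<forall>p\<in>P. b p \<in> fspan U)"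
    using assms
  proof induction
    case empty
    show ?case by (rule exI[of _ "{}"]) (auto simp: interpolates_def)
  next
    case (insert u U)
    then obtain P b where Pb: "interpolates X U P b" and "\<forall>p\<in>P. b p \<in> fspan U"
      by blast
    then have b: "b p \<in> fspan U" if "p \<in> P" for p
      using that by simp
    from Pb have P: "finite P" "P \<subseteq> X"
      "\<forall>p\<in>P. \<forall>q\<in>P. b p q = (if p = q then 1 else 0)"
      and rep: "\<And>w x. w \<in> U \<Longrightarrow> x \<in> X \<Longrightarrow> w x = (\<Sum>p\<in>P. w p * b p x)"
      by (simp_all add: interpolates_def)
    have b2: "b p \<in> fspan (insert u U)" if "p \<in> P" for p
      using b[OF that] fspan_mono[of U "insert u U"] by blast
    define w where "w x = u x - (\<Sum>p\<in>P. u p * b p x)" for x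
    have w: "w \<in> fspan (insert u U)"
      unfolding w_def by (intro fspan_diff fspan_incl fspan_sum fspan_scale b2) auto
    show ?case
    proof (cases "\<forall>x\<in>X. w x = 0")
      case True
      then show ?thesis using P rep b2
        by (intro exI[of _ P] exI[of _ b]) (auto simp: interpolates_def w_def)
    next
      case False
      then obtain h where h: "h \<in> X" "w h \<noteq> 0" by blast
      have wP: "\<forall>p\<in>P. w p = 0"
        using sum_dual_family[OF P(1) P(3), of _ u] by (simp add: w_def)
      define b' where "b' = (\<lambda>p x. if p = h then w x / w h else b p x - b p h * (w x / w h))"
      note ext = dual_family_extend[OF P(1) P(3) h(2) wP b'_def]
      have "interpolates X (insert u U) (insert h P) b'"
        unfolding interpolates_def
      proof (intro conjI ballI)
        fix f x assume f: "f \<in> insert u U" and x: "x \<in> X"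
        show "f x = (\<Sum>p\<in>insert h P. f p * b' p x)"
        proof (cases "f \<in> U")
          case True
          then show ?thesis unfolding ext(3) using rep[OF True x] rep[OF True h(1)] by simp
        next
          case False
          then have "f = u" using f by simp
          then show ?thesis unfolding ext(3) using h(2) by (simp add: w_def)
        qed
      qed (use P h ext(2) in auto)
      moreover have "b' p \<in> fspan (insert u U)" if "p \<in> insert h P" for p
      proof -
        have e: "(\<lambda>x. w x / w h) \<in> fspan (insert u U)"
          using fspan_scale[OF w, of "1 / w h"] by simp
        show ?thesis
        proof (cases "p = h")
          case True
          then show ?thesis using e by (simp add: b'_def)
        next
          case False
          then show ?thesis
            using fspan_diff[OF b2 fspan_scale[OF e], of p "b p h"] that by (simp add: b'_def)
        qed
      qed
      ultimately show ?thesis by blast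
    qed
  qed
  then obtain P b where P: "interpolates X U P b" "\<forall>p\<in>P. b p \<in> fspan U"
    by blast
  have "w x = (\<Sum>p\<in>P. w p * b p x)" if "w \<in> fspan U" "x \<in> X" for w x
    using that(1)
  proof induction
    case (fspan_step f u a)
    then have "u x = (\<Sum>p\<in>P. u p * b p x)"
      using P \<open>x \<in> X\<close> by (auto simp: interpolates_def)
    then show ?case
      using fspan_step.IH by (simp add: distrib_right sum.distrib sum_distrib_left mult.assoc)
  qed simp
  then have "interpolates X (fspan U) P b"
    using P by (simp add: interpolates_def)
  then show thesis
    by (rule that) (use P in blast)
qed

text \<open>Here no generators of the space are known, so the points of \<open>H\<close> are added
  one at a time instead, a point being kept if some function of \<open>W\<close> is not yet
  interpolated there. The resulting functions \<open>b\<close> are the reduced basis of the subspace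
  and \<open>P\<close> is its set of pivots.\<close>

lemma ex_interpolates_determined:
  fixes W :: "('x \<Rightarrow> 'a::field) set"
  assumes "finite H" "H \<subseteq> X"
    and W: "(\<lambda>_. 0) \<in> W" "\<And>f g. f \<in> W \<Longrightarrow> g \<in> W \<Longrightarrow> (\<lambda>x. f x + g x) \<in> W"
      "\<And>a f. f \<in> W \<Longrightarrow> (\<lambda>x. a * f x) \<in> W"
    and det: "\<And>w x. w \<in> W \<Longrightarrow> \<forall>h\<in>H. w h = 0 \<Longrightarrow> x \<in> X \<Longrightarrow> w x = 0"
  obtains P b where "interpolates X W P b" "\<And>p. p \<in> P \<Longrightarrow> b p \<in> W"
proof -
  have W_diff: "(\<lambda>x. f x - g x) \<in> W" if "f \<in> W" "g \<in> W" for f g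
    using W(2)[OF that(1) W(3)[OF that(2), of "- 1"]] by simp
  have W_sum: "(\<lambda>x. \<Sum>i\<in>I. f i x) \<in> W" if "\<And>i. i \<in> I \<Longrightarrow> f i \<in> W" for I :: "'x set" and f
    using that by (induction I rule: infinite_finite_induct) (auto intro: W)
  have "\<exists>P b. finite P \<and> P \<subseteq> H \<and> (\<forall>p\<in>P. \<forall>q\<in>P. b p q = (if p = q then 1 else 0)) \<and>
      (\<forall>w\<in>W. \<forall>x\<in>H. w x = (\<Sum>p\<in>P. w p * b p x)) \<and> (\<forall>p\<in>P. b p \<in> W)"
    using assms(1)
  proof induction
    case empty
    show ?case by (rule exI[of _ "{}"]) auto
  next
    case (insert h H)
    then obtain P b where Pb: "finite P \<and> P \<subseteq> H \<and> (\<forall>p\<in>P. \<forall>q\<in>P. b p q = (if p = q then 1 else 0)) \<and>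
      (\<forall>w\<in>W. \<forall>x\<in>H. w x = (\<Sum>p\<in>P. w p * b p x)) \<and> (\<forall>p\<in>P. b p \<in> W)"
      by (elim exE)
    then have P: "finite P" "P \<subseteq> H"
      "\<forall>p\<in>P. \<forall>q\<in>P. b p q = (if p = q then 1 else 0)"
      and rep: "\<And>w x. w \<in> W \<Longrightarrow> x \<in> H \<Longrightarrow> w x = (\<Sum>p\<in>P. w p * b p x)"
      and b: "\<And>p. p \<in> P \<Longrightarrow> b p \<in> W"
      by simp_all
    show ?case
    proof (cases "\<forall>w\<in>W. w h = (\<Sum>p\<in>P. w p * b p h)")
      case True
      then show ?thesis using P rep b
        by (intro exI[of _ P] exI[of _ b]) auto
    next
      case False
      then obtain u where u: "u \<in> W" "u h \<noteq> (\<Sum>p\<in>P. u p * b p h)" by blast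
      define w where "w x = u x - (\<Sum>p\<in>P. u p * b p x)" for x
      have w: "w \<in> W"
        unfolding w_def by (intro W_diff u W_sum W(3) b) auto
      have wh: "w h \<noteq> 0" using u by (simp add: w_def)
      have wH: "w x = 0" if "x \<in> H" for x
        using rep[OF u(1) that] by (simp add: w_def)
      have wP: "\<forall>p\<in>P. w p = 0"
        using P wH by blast
      define b' where "b' = (\<lambda>p x. if p = h then w x / w h else b p x - b p h * (w x / w h))"
      note ext = dual_family_extend[OF P(1) P(3) wh wP b'_def]
      have "f x = (\<Sum>p\<in>insert h P. f p * b' p x)" if f: "f \<in> W" and x: "x \<in> insert h H" for f x
      proof (cases "x = h")
        case True
        then show ?thesis unfolding ext(3) using wh by simp
      next
        case False
        then have "x \<in> H" using x by simp
        then show ?thesis unfolding ext(3) using rep[OF f] wH by simp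
      qed
      moreover have "b' p \<in> W" if "p \<in> insert h P" for p
      proof -
        have e: "(\<lambda>x. w x / w h) \<in> W"
          using W(3)[OF w, of "1 / w h"] by simp
        show ?thesis
        proof (cases "p = h")
          case True
          then show ?thesis using e by (simp add: b'_def)
        next
          case False
          then show ?thesis
            using W_diff[OF b W(3)[OF e], of p "b p h"] that by (simp add: b'_def)
        qed
      qed
      ultimately show ?thesis
        using P ext(2) by (intro exI[of _ "insert h P"] exI[of _ b']) auto
    qed
  qed
  then obtain P b where Pb: "finite P \<and> P \<subseteq> H \<and> (\<forall>p\<in>P. \<forall>q\<in>P. b p q = (if p = q then 1 else 0)) \<and>
      (\<forall>w\<in>W. \<forall>x\<in>H. w x = (\<Sum>p\<in>P. w p * b p x)) \<and> (\<forall>p\<in>P. b p \<in> W)"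
    by (elim exE)
  then have P: "finite P" "P \<subseteq> H" "\<forall>p\<in>P. \<forall>q\<in>P. b p q = (if p = q then 1 else 0)"
    and rep: "\<And>w x. w \<in> W \<Longrightarrow> x \<in> H \<Longrightarrow> w x = (\<Sum>p\<in>P. w p * b p x)"
    and b: "\<And>p. p \<in> P \<Longrightarrow> b p \<in> W"
    by simp_all
  have "w x = (\<Sum>p\<in>P. w p * b p x)" if "w \<in> W" "x \<in> X" for w x
  proof -
    have "(\<lambda>x. w x - (\<Sum>p\<in>P. w p * b p x)) \<in> W"
      by (intro W_diff that W_sum W(3) b) auto
    from det[OF this _ \<open>x \<in> X\<close>] show ?thesis
      using rep[OF that(1)] by simp
  qed
  then have "interpolates X W P b"
    using P assms(2) by (simp add: interpolates_def subset_trans[of P H X])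
  then show thesis using that b by blast
qed

section \<open>Functions of two variables as tensors\<close>

definition tensors ::
  "'x set \<Rightarrow> 'y set \<Rightarrow> ('x \<Rightarrow> 'a::comm_ring_1) set \<Rightarrow> ('y \<Rightarrow> 'a) set \<Rightarrow> ('x \<Rightarrow> 'y \<Rightarrow> 'a) set"
  where "tensors X Y U V = {h. \<exists>l. set l \<subseteq> U \<times> V \<and>
    (\<forall>x\<in>X. \<forall>y\<in>Y. h x y = (\<Sum>(u, v)\<leftarrow>l. u x * v y))}"

lemma tensorsI:
  "u \<in> U \<Longrightarrow> v \<in> V \<Longrightarrow> (\<And>x y. x \<in> X \<Longrightarrow> y \<in> Y \<Longrightarrow> h x y = u x * v y) \<Longrightarrow> h \<in> tensors X Y U V"
  unfolding tensors_def by (auto intro!: exI[of _ "[(u, v)]"])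

lemma tensors_cong:
  "h \<in> tensors X Y U V \<Longrightarrow> (\<And>x y. x \<in> X \<Longrightarrow> y \<in> Y \<Longrightarrow> h' x y = h x y) \<Longrightarrow> h' \<in> tensors X Y U V"
  unfolding tensors_def by auto

lemma tensors_add:
  assumes "h \<in> tensors X Y U V" "h' \<in> tensors X Y U V"
  shows "(\<lambda>x y. h x y + h' x y) \<in> tensors X Y U V"
proof -
  obtain l where "set l \<subseteq> U \<times> V" "\<forall>x\<in>X. \<forall>y\<in>Y. h x y = (\<Sum>(u, v)\<leftarrow>l. u x * v y)"
    using assms unfolding tensors_def by blast
  moreover obtain l' where "set l' \<subseteq> U \<times> V" "\<forall>x\<in>X. \<forall>y\<in>Y. h' x y = (\<Sum>(u, v)\<leftarrow>l'. u x * v y)"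
    using assms unfolding tensors_def by blast
  ultimately show ?thesis
    unfolding tensors_def by (auto intro!: exI[of _ "l @ l'"])
qed

lemma tensors_0: "(\<lambda>_ _. 0) \<in> tensors X Y U V"
  unfolding tensors_def by (auto intro!: exI[of _ "[]"])

lemma tensors_sum:
  "(\<And>i. i \<in> I \<Longrightarrow> h i \<in> tensors X Y U V) \<Longrightarrow> (\<lambda>x y. \<Sum>i\<in>I. h i x y) \<in> tensors X Y U V"
  by (induction I rule: infinite_finite_induct) (auto intro: tensors_0 tensors_add)

lemma tensors_mult:
  assumes U: "\<And>f g. f \<in> U \<Longrightarrow> g \<in> U \<Longrightarrow> (\<lambda>x. f x * g x) \<in> U"
    and V: "\<And>f g. f \<in> V \<Longrightarrow> g \<in> V \<Longrightarrow> (\<lambda>x. f x * g x) \<in> V"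
    and "h \<in> tensors X Y U V" "h' \<in> tensors X Y U V"
  shows "(\<lambda>x y. h x y * h' x y) \<in> tensors X Y U V"
proof -
  obtain l where l: "set l \<subseteq> U \<times> V" "\<forall>x\<in>X. \<forall>y\<in>Y. h x y = (\<Sum>(u, v)\<leftarrow>l. u x * v y)"
    using assms(3) unfolding tensors_def by blast
  obtain l' where l': "set l' \<subseteq> U \<times> V" "\<forall>x\<in>X. \<forall>y\<in>Y. h' x y = (\<Sum>(u, v)\<leftarrow>l'. u x * v y)"
    using assms(4) unfolding tensors_def by blast
  have one: "(\<lambda>x y. u x * v y * (\<Sum>(u, v)\<leftarrow>m. u x * v y)) \<in> tensors X Y U V"
    if "u \<in> U" "v \<in> V" "set m \<subseteq> U \<times> V" for u v m
    using that(3)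
  proof (induction m)
    case (Cons w m)
    obtain u' v' where w: "w = (u', v')" by (cases w)
    have "(\<lambda>x y. (u x * u' x) * (v y * v' y)) \<in> tensors X Y U V"
      by (rule tensorsI[OF U V]) (use that Cons w in auto)
    from tensors_add[OF this Cons.IH] show ?case
      by (rule tensors_cong) (use Cons w in \<open>auto simp: algebra_simps\<close>)
  qed (simp add: tensors_0)
  have "(\<lambda>x y. (\<Sum>(u, v)\<leftarrow>m. u x * v y) * (\<Sum>(u, v)\<leftarrow>l'. u x * v y)) \<in> tensors X Y U V"
    if "set m \<subseteq> U \<times> V" for m
    using that
  proof (induction m)
    case (Cons w m)
    obtain u v where w: "w = (u, v)" by (cases w)
    have "(\<lambda>x y. u x * v y * (\<Sum>(u, v)\<leftarrow>l'. u x * v y)) \<in> tensors X Y U V"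
      by (rule one) (use Cons w l' in auto)
    from tensors_add[OF this Cons.IH] show ?case
      by (rule tensors_cong) (use Cons w in \<open>auto simp: algebra_simps\<close>)
  qed (simp add: tensors_0)
  from this[OF l(1)] show ?thesis
    by (rule tensors_cong) (use l l' in auto)
qed

text \<open>For fixed \<open>y\<close>, such a function lies in the span of the finitely many left
  factors, so it is recovered from its values at finitely many points \<open>x\<close>, the same for
  all \<open>y\<close>.\<close>

lemma tensors_interpolate:
  fixes h :: "'x \<Rightarrow> 'y \<Rightarrow> 'a::field"
  assumes "h \<in> tensors X Y U V"
  obtains P b where "finite P" "P \<subseteq> X" "\<And>p. p \<in> P \<Longrightarrow> b p \<in> fspan U"
    "\<And>x y. x \<in> X \<Longrightarrow> y \<in> Y \<Longrightarrow> h x y = (\<Sum>p\<in>P. h p y * b p x)"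
proof -
  obtain l where l: "set l \<subseteq> U \<times> V" "\<And>x y. x \<in> X \<Longrightarrow> y \<in> Y \<Longrightarrow> h x y = (\<Sum>(u, v)\<leftarrow>l. u x * v y)"
    using assms unfolding tensors_def by blast
  obtain P b where P: "interpolates X (fspan (fst ` set l)) P b"
    and b: "\<And>p. p \<in> P \<Longrightarrow> b p \<in> fspan (fst ` set l)"
    using ex_interpolates[of "fst ` set l" X] by blast
  have 1: "(\<Sum>(u, v)\<leftarrow>m. u x * v y) = (\<Sum>p\<in>P. (\<Sum>(u, v)\<leftarrow>m. u p * v y) * b p x)"
    if "set m \<subseteq> set l" "x \<in> X" for m x y
    using that(1)
  proof (induction m)
    case (Cons w m)
    obtain u v where w: "w = (u, v)" by (cases w)
    have "u \<in> fspan (fst ` set l)"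
      by (rule fspan_incl) (use Cons w in force)
    then have "u x = (\<Sum>p\<in>P. u p * b p x)"
      using P \<open>x \<in> X\<close> by (auto simp: interpolates_def)
    then have "u x * v y = (\<Sum>p\<in>P. u p * v y * b p x)"
      by (simp add: sum_distrib_left sum_distrib_right mult.commute mult.left_commute)
    then show ?case
      using Cons w by (simp add: distrib_right sum.distrib)
  qed simp
  show thesis
  proof (rule that[of P b])
    show "b p \<in> fspan U" if "p \<in> P" for p
      using b[OF that] fspan_mono[of "fst ` set l" U] l(1) by force
    show "h x y = (\<Sum>p\<in>P. h p y * b p x)" if "x \<in> X" "y \<in> Y" for x y
      using that l(2) 1[OF order_refl that(1)] P by (auto simp: interpolates_def subset_iff)
  qed (use P in \<open>auto simp: interpolates_def\<close>)
qed

section \<open>Linear algebraic groups\<close>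

text \<open>Cramer's rule makes it visible that the entries of the inverse are regular
  functions.\<close>

definition invm :: "nat \<Rightarrow> 'a::field mat \<Rightarrow> 'a mat"
  where "invm m x = (1 / det x) \<cdot>\<^sub>m adj_mat x"

lemma invm:
  assumes "x \<in> carrier_mat m m" "det x \<noteq> 0"
  shows "invm m x \<in> carrier_mat m m" "x * invm m x = 1\<^sub>m m" "invm m x * x = 1\<^sub>m m"
proof -
  note adj = adj_mat[OF assms(1)]
  show "invm m x \<in> carrier_mat m m"
    using adj(1) by (simp add: invm_def)
  show "x * invm m x = 1\<^sub>m m"
    using assms adj by (auto simp: invm_def mult_smult_distrib[OF assms(1) adj(1)] intro!: eq_matI)
  show "invm m x * x = 1\<^sub>m m"
    using assms adj by (auto simp: invm_def mult_smult_assoc_mat[OF adj(1) assms(1)] intro!: eq_matI)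
qed

lemma det_invm:
  assumes "x \<in> carrier_mat m m" "det x \<noteq> 0"
  shows "det (invm m x) = 1 / det x"
proof -
  have "det x * det (invm m x) = 1"
    using det_mult[OF assms(1) invm(1)[OF assms]] invm(2)[OF assms] by simp
  then show ?thesis using assms(2) by (simp add: field_simps)
qed

lemma group_GL: "group (GL_subgroup m (GL m :: 'a::field mat set))"
proof (rule groupI)
  fix x :: "'a mat" assume "x \<in> carrier (GL_subgroup m (GL m))"
  then have x: "x \<in> carrier_mat m m" "det x \<noteq> 0"
    by (auto simp: GL_subgroup_def GL_def)
  then show "\<exists>y\<in>carrier (GL_subgroup m (GL m)).
      y \<otimes>\<^bsub>GL_subgroup m (GL m)\<^esub> x = \<one>\<^bsub>GL_subgroup m (GL m)\<^esub>"
    using invm[OF x] det_invm[OF x]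
    by (intro bexI[of _ "invm m x"]) (auto simp: GL_subgroup_def GL_def)
qed (auto simp: GL_subgroup_def GL_def det_mult)

lemma det_eq_mat_poly: "\<exists>p. \<forall>x\<in>carrier_mat m m. det x = mat_poly m p (x :: 'a::field mat)"
proof -
  let ?M = "carrier_mat m m :: 'a mat set"
  have sum: "\<exists>p. \<forall>x\<in>?M. (\<Sum>i\<in>I. h i x) = mat_poly m p x"
    if "\<And>i. i \<in> I \<Longrightarrow> \<exists>p. \<forall>x\<in>?M. h i x = mat_poly m p x"
    for I :: "(nat \<Rightarrow> nat) set" and h
    using that
  proof (induction I rule: infinite_finite_induct)
    case (insert i I)
    then obtain p q where "\<forall>x\<in>?M. h i x = mat_poly m p x" "\<forall>x\<in>?M. (\<Sum>i\<in>I. h i x) = mat_poly m q x"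
      by blast
    then show ?case
      using insert by (intro exI[of _ "p + q"]) (simp add: mat_poly_def poly_eval_add)
  qed (auto simp: mat_poly_def intro: exI[of _ 0])
  have prod: "\<exists>p. \<forall>x\<in>?M. (\<Prod>i\<in>I. h i x) = mat_poly m p x"
    if "\<And>i. i \<in> I \<Longrightarrow> \<exists>p. \<forall>x\<in>?M. h i x = mat_poly m p x"
    for I :: "nat set" and h
    using that
  proof (induction I rule: infinite_finite_induct)
    case (insert i I)
    then obtain p q where "\<forall>x\<in>?M. h i x = mat_poly m p x" "\<forall>x\<in>?M. (\<Prod>i\<in>I. h i x) = mat_poly m q x"
      by blast
    then show ?case
      using insert by (intro exI[of _ "p * q"]) (simp add: mat_poly_mult)
  qed (auto simp: mat_poly_def intro: exI[of _ 1])
  have entry: "\<exists>p. \<forall>x\<in>?M. x $$ (i, j) = mat_poly m p x" if "i < m" "j < m" for i j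
    using that by (intro exI[of _ "Poly_Mapping.single (Poly_Mapping.single (i, j) 1) 1"])
      (simp add: mat_poly_def)
  have const: "\<exists>p. \<forall>x\<in>?M. a = mat_poly m p (x :: 'a mat)" for a
    by (rule exI[of _ "Poly_Mapping.single 0 a"]) (simp add: mat_poly_def)
  have mult: "\<exists>p. \<forall>x\<in>?M. f x * g x = mat_poly m p x"
    if fg: "\<exists>p. \<forall>x\<in>?M. f x = mat_poly m p x" "\<exists>p. \<forall>x\<in>?M. g x = mat_poly m p x" for f g
  proof -
    obtain p q where "\<forall>x\<in>?M. f x = mat_poly m p x" "\<forall>x\<in>?M. g x = mat_poly m q x"
      using fg by blast
    then show ?thesis by (intro exI[of _ "p * q"]) (simp add: mat_poly_mult)
  qed
  have "\<exists>p. \<forall>x\<in>?M. (\<Sum>p\<in>{p. p permutes {0..<m}}. signof p * (\<Prod>i = 0..<m. x $$ (i, p i))) = mat_poly m p x"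
  proof (intro sum mult const prod entry)
    fix p i assume "p \<in> {p. p permutes {0..<m}}" "i \<in> {0..<m}"
    then show "i < m" "p i < m"
      using permutes_in_image[of p "{0..<m}" i] by auto
  qed
  then show ?thesis
    by (simp add: det_def'[of _ m])
qed

locale matrix_group =
  fixes m :: nat and G :: "'c::field mat set"
  assumes alg_group: "linear_algebraic_group m G"
begin

abbreviation "unit \<equiv> (1\<^sub>m m :: 'c mat)"

lemma G_subgroup: "subgroup G (GL_subgroup m (GL m))"
  using alg_group by (simp add: linear_algebraic_group_def)

lemma G_GL: "x \<in> G \<Longrightarrow> x \<in> GL m"
  using subgroup.subset[OF G_subgroup] by (auto simp: GL_subgroup_def)

lemma G_carrier [simp]: "x \<in> G \<Longrightarrow> x \<in> carrier_mat m m"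
  and G_det [simp]: "x \<in> G \<Longrightarrow> det x \<noteq> 0"
  using G_GL by (auto simp: GL_def)

lemma G_dim [simp]: "x \<in> G \<Longrightarrow> dim_row x = m" "x \<in> G \<Longrightarrow> dim_col x = m"
  using G_carrier by blast+

lemma unit_in_G [simp]: "unit \<in> G"
  using subgroup.one_closed[OF G_subgroup] by (simp add: GL_subgroup_def)

lemma mult_in_G [simp]: "x \<in> G \<Longrightarrow> y \<in> G \<Longrightarrow> x * y \<in> G"
  using subgroup.m_closed[OF G_subgroup] by (simp add: GL_subgroup_def)

lemma invm_in_G [simp]:
  assumes "x \<in> G"
  shows "invm m x \<in> G"
proof -
  note x = G_carrier[OF assms] G_det[OF assms]
  have "inv\<^bsub>GL_subgroup m (GL m)\<^esub> x = invm m x"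
    by (rule group.inv_equality[OF group_GL])
      (use x G_GL[OF assms] invm[OF x] det_invm[OF x] in \<open>auto simp: GL_subgroup_def GL_def\<close>)
  then show ?thesis
    using subgroup.m_inv_closed[OF G_subgroup assms] by simp
qed

lemma invm_mult: "x \<in> G \<Longrightarrow> x * invm m x = unit" "x \<in> G \<Longrightarrow> invm m x * x = unit"
  using invm(2,3)[OF G_carrier G_det] by auto

lemma G_assoc: "x \<in> G \<Longrightarrow> y \<in> G \<Longrightarrow> z \<in> G \<Longrightarrow> x * y * z = x * (y * z)"
  by (rule assoc_mult_mat[of _ m m _ m _ m]) (simp_all add: G_carrier)

lemma unit_mult: "x \<in> G \<Longrightarrow> unit * x = x" "x \<in> G \<Longrightarrow> x * unit = x"
  by simp_all

section \<open>Regular functions and translations\<close>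

text \<open>The entries are numbered row by row, and the last index \<open>m * m\<close> stands for
  \<open>1 / det\<close>. Numbers as indices fit the form of Hilbert's basis theorem and the
  variables of the polynomials that make up the Picard-Vessiot ring.\<close>

definition crd :: "nat \<Rightarrow> 'c mat \<Rightarrow> 'c"
  where "crd k x = (if k < m * m then x $$ (k div m, k mod m) else 1 / det x)"

abbreviation "K \<equiv> Suc (m * m)"

abbreviation "\<A> \<equiv> polyfun G K crd"

lemma entry_regular:
  assumes "i < m" "j < m"
  shows "(\<lambda>x. x $$ (i, j)) \<in> \<A>"
proof -
  have lt: "i * m + j < m * m"
  proof -
    have "i * m + j < i * m + m" using assms by simp
    also have "\<dots> = Suc i * m" by simp
    also have "\<dots> \<le> m * m" using assms by (intro mult_le_mono1) simp
    finally show ?thesis .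
  qed
  have "crd (i * m + j) \<in> \<A>"
    by (rule polyfun_coord) (use lt in simp)
  moreover have "crd (i * m + j) = (\<lambda>x. x $$ (i, j))"
    using assms lt by (auto simp: crd_def fun_eq_iff)
  ultimately show ?thesis by simp
qed

lemma inverse_det_regular: "(\<lambda>x. 1 / det x) \<in> \<A>"
proof -
  have "crd (m * m) \<in> \<A>"
    by (rule polyfun_coord) simp
  moreover have "crd (m * m) = (\<lambda>x. 1 / det x)"
    by (auto simp: crd_def fun_eq_iff)
  ultimately show ?thesis by simp
qed

lemma det_regular:
  assumes "\<And>x. x \<in> G \<Longrightarrow> M x \<in> carrier_mat n n"
    and "\<And>i j. i < n \<Longrightarrow> j < n \<Longrightarrow> (\<lambda>x. M x $$ (i, j)) \<in> \<A>"
  shows "(\<lambda>x. det (M x)) \<in> \<A>"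
proof (rule polyfun_cong)
  show "(\<lambda>x. \<Sum>p\<in>{p. p permutes {0..<n}}. signof p * (\<Prod>i = 0..<n. M x $$ (i, p i))) \<in> \<A>"
  proof (intro polyfun_sum polyfun_scale polyfun_prod assms(2))
    fix p i assume "p \<in> {p. p permutes {0..<n}}" "i \<in> {0..<n}"
    then show "i < n" "p i < n"
      using permutes_in_image[of p "{0..<n}" i] by auto
  qed
qed (use assms(1) det_def' in blast)

lemma invm_entry_regular:
  assumes "i < m" "j < m"
  shows "(\<lambda>x. invm m x $$ (i, j)) \<in> \<A>"
proof (rule polyfun_cong)
  show "(\<lambda>x. 1 / det x * ((- 1) ^ (j + i) * det (mat_delete x j i))) \<in> \<A>"
  proof (intro polyfun_mult[OF inverse_det_regular] polyfun_scale det_regular)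
    show "mat_delete x j i \<in> carrier_mat (m - 1) (m - 1)" if "x \<in> G" for x
      by (rule mat_delete_carrier[OF G_carrier[OF that]])
    fix k l assume kl: "k < m - 1" "l < m - 1"
    show "(\<lambda>x. mat_delete x j i $$ (k, l)) \<in> \<A>"
    proof (rule polyfun_cong)
      show "(\<lambda>x. x $$ (if k < j then k else Suc k, if l < i then l else Suc l)) \<in> \<A>"
        by (rule entry_regular) (use kl in auto)
    qed (use kl in \<open>simp add: mat_delete_def\<close>)
  qed
qed (use assms in \<open>simp add: invm_def adj_mat_def cofactor_def\<close>)

lemma row_col [simp]:
  "x \<in> G \<Longrightarrow> y \<in> G \<Longrightarrow> i < m \<Longrightarrow> j < m \<Longrightarrow>
    row x i \<bullet> col y j = (\<Sum>l<m. x $$ (i, l) * y $$ (l, j))"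
  by (auto simp: scalar_prod_def lessThan_atLeast0)

lemma entry_mult:
  "x \<in> G \<Longrightarrow> y \<in> G \<Longrightarrow> i < m \<Longrightarrow> j < m \<Longrightarrow>
    (x * y) $$ (i, j) = (\<Sum>l<m. x $$ (i, l) * y $$ (l, j))"
  by simp

lemma crd_cases:
  assumes "k < K"
  obtains i j where "i < m" "j < m" "crd k = (\<lambda>x. x $$ (i, j))"
  | "crd k = (\<lambda>x. 1 / det x)"
proof (cases "k < m * m")
  case True
  then have "m > 0" by (cases m) auto
  then show ?thesis
    using True by (intro that(1)[of "k div m" "k mod m"])
      (auto simp: crd_def fun_eq_iff less_mult_imp_div_less)
next
  case False
  then show ?thesis by (intro that(2)) (auto simp: crd_def fun_eq_iff)
qed

lemma translate_left_regular:
  assumes "f \<in> \<A>" "y \<in> G"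
  shows "(\<lambda>x. f (y * x)) \<in> \<A>"
proof (rule polyfun_subst[OF assms(1)])
  fix k assume "k < K"
  then show "(\<lambda>x. crd k (y * x)) \<in> \<A>"
  proof (cases rule: crd_cases)
    case (1 i j)
    have "(\<lambda>x. \<Sum>l<m. y $$ (i, l) * x $$ (l, j)) \<in> \<A>"
      by (intro polyfun_sum polyfun_scale entry_regular) (use 1 in auto)
    then show ?thesis
      by (rule polyfun_cong) (use 1 assms in simp)
  next
    case 2
    show ?thesis
      by (rule polyfun_cong[OF polyfun_scale[OF inverse_det_regular, of "1 / det y"]])
        (use 2 assms in \<open>simp add: det_mult[of _ m]\<close>)
  qed
qed (use assms mult_in_G in auto)

lemma translate_right_regular:
  assumes "f \<in> \<A>" "y \<in> G"
  shows "(\<lambda>x. f (x * y)) \<in> \<A>"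
proof (rule polyfun_subst[OF assms(1)])
  fix k assume "k < K"
  then show "(\<lambda>x. crd k (x * y)) \<in> \<A>"
  proof (cases rule: crd_cases)
    case (1 i j)
    have "(\<lambda>x. \<Sum>l<m. y $$ (l, j) * x $$ (i, l)) \<in> \<A>"
      by (intro polyfun_sum polyfun_scale entry_regular) (use 1 in auto)
    then show ?thesis
      by (rule polyfun_cong) (use 1 assms in \<open>simp add: mult.commute\<close>)
  next
    case 2
    show ?thesis
      by (rule polyfun_cong[OF polyfun_scale[OF inverse_det_regular, of "1 / det y"]])
        (use 2 assms in \<open>simp add: det_mult[of _ m]\<close>)
  qed
qed (use assms mult_in_G in auto)

lemma invm_regular:
  assumes "f \<in> \<A>"
  shows "(\<lambda>x. f (invm m x)) \<in> \<A>"
proof (rule polyfun_subst[OF assms(1)])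
  fix k assume "k < K"
  then show "(\<lambda>x. crd k (invm m x)) \<in> \<A>"
  proof (cases rule: crd_cases)
    case (1 i j)
    then show ?thesis using invm_entry_regular by simp
  next
    case 2
    have "(\<lambda>x. det x) \<in> \<A>"
      by (rule det_regular[of _ m]) (auto intro: G_carrier entry_regular)
    then show ?thesis
      by (rule polyfun_cong) (use 2 in \<open>simp add: det_invm[of _ m]\<close>)
  qed
qed (use invm_in_G in auto)

text \<open>This is the comultiplication of the coordinate ring: an entry of a product of matrices
  is a sum of products of entries, and \<open>1 / det\<close> is multiplicative.\<close>

lemma mult_tensor:
  assumes "f \<in> \<A>"
  shows "(\<lambda>x y. f (x * y)) \<in> tensors G G \<A> \<A>"
  using assms
proof induction
  case (polyfun_const a)
  show ?case
    by (rule tensorsI[of "\<lambda>_. a" _ "\<lambda>_. 1"]) (auto intro: polyfun.polyfun_const)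
next
  case (polyfun_coord k)
  then show ?case
  proof (cases rule: crd_cases)
    case (1 i j)
    have "(\<lambda>x y. \<Sum>l<m. x $$ (i, l) * y $$ (l, j)) \<in> tensors G G \<A> \<A>"
      by (intro tensors_sum tensorsI[OF entry_regular entry_regular]) (use 1 in auto)
    then show ?thesis
      by (rule tensors_cong) (use 1 in simp)
  next
    case 2
    show ?thesis
      by (rule tensorsI[OF inverse_det_regular inverse_det_regular])
        (use 2 in \<open>simp add: det_mult[of _ m]\<close>)
  qed
next
  case (polyfun_add f g)
  then show ?case by (intro tensors_add)
next
  case (polyfun_mult f g)
  show ?case by (rule tensors_mult) (use polyfun_mult polyfun.polyfun_mult in auto)
next
  case (polyfun_cong f g)
  show ?case by (rule tensors_cong[OF polyfun_cong.IH]) (use polyfun_cong mult_in_G in auto)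
qed

lemma fspan_regular: "fspan \<A> = \<A>"
proof
  show "fspan \<A> \<subseteq> \<A>"
  proof
    fix f assume "f \<in> fspan \<A>"
    then show "f \<in> \<A>"
      by induction (auto intro: polyfun_const polyfun_add polyfun_scale)
  qed
qed (auto intro: fspan_incl)

text \<open>Local finiteness of translation: all functions \<open>y \<mapsto> f (x * y)\<close> are
  combinations of finitely many of them, with coefficients that are regular in
  \<open>x\<close>.\<close>

lemma mult_interpolate:
  assumes "f \<in> \<A>"
  obtains P b where "finite P" "P \<subseteq> G" "\<And>p. p \<in> P \<Longrightarrow> b p \<in> \<A>"
    "\<And>x y. x \<in> G \<Longrightarrow> y \<in> G \<Longrightarrow> f (x * y) = (\<Sum>p\<in>P. f (p * y) * b p x)"
  using tensors_interpolate[OF mult_tensor[OF assms], of thesis] by (auto simp: fspan_regular)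

text \<open>Closed sets are given by polynomials in the entries alone, so a power of the determinant
  has to clear the denominators.\<close>

lemma regular_eq_mat_poly:
  assumes "f \<in> \<A>"
  shows "\<exists>p k. \<forall>x\<in>G. f x * det x ^ k = mat_poly m p x"
proof -
  obtain dp where "\<forall>x\<in>carrier_mat m m. det x = mat_poly m dp (x :: 'c mat)"
    using det_eq_mat_poly by blast
  then have dp: "det x = mat_poly m dp x" if "x \<in> G" for x
    using that by simp
  have pow: "mat_poly m (p ^ k) x = mat_poly m p x ^ k" for p k and x :: "'c mat"
    by (induction k) (simp_all add: mat_poly_mult, simp add: mat_poly_def)
  show ?thesis
    using assms
  proof induction
    case (polyfun_const a)
    show ?case by (intro exI[of _ 0] exI[of _ "Poly_Mapping.single 0 a"]) (auto simp: mat_poly_def)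
  next
    case (polyfun_coord k)
    then show ?case
    proof (cases rule: crd_cases)
      case (1 i j)
      then show ?thesis
        by (intro exI[of _ "Poly_Mapping.single (Poly_Mapping.single (i, j) 1) 1"] exI[of _ 0])
          (simp add: mat_poly_def)
    next
      case 2
      then show ?thesis
        using G_det by (intro exI[of _ 1] exI[of _ 1]) (simp add: mat_poly_def)
    qed
  next
    case (polyfun_add f g)
    then obtain p k q l where p: "\<And>x. x \<in> G \<Longrightarrow> f x * det x ^ k = mat_poly m p x"
      and q: "\<And>x. x \<in> G \<Longrightarrow> g x * det x ^ l = mat_poly m q x" by blast
    have "(f x + g x) * det x ^ (k + l) = mat_poly m (p * dp ^ l + q * dp ^ k) x" if "x \<in> G" for x
    proof -
      have "mat_poly m (p * dp ^ l + q * dp ^ k) x = f x * det x ^ k * det x ^ l + g x * det x ^ l * det x ^ k"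
        using that p q by (simp add: mat_poly_mult mat_poly_def[of m "_ + _"] poly_eval_add pow dp
            flip: mat_poly_def)
      then show ?thesis by (simp add: power_add algebra_simps)
    qed
    then show ?case by blast
  next
    case (polyfun_mult f g)
    then obtain p k q l where p: "\<And>x. x \<in> G \<Longrightarrow> f x * det x ^ k = mat_poly m p x"
      and q: "\<And>x. x \<in> G \<Longrightarrow> g x * det x ^ l = mat_poly m q x" by blast
    have "(f x * g x) * det x ^ (k + l) = mat_poly m (p * q) x" if "x \<in> G" for x
      unfolding mat_poly_mult p[OF that, symmetric] q[OF that, symmetric] by (simp add: power_add)
    then show ?case by blast
  next
    case (polyfun_cong f g)
    then show ?case by auto
  qed
qed

lemma closedin_zeros:
  assumes "W \<subseteq> \<A>"
  shows "closedin (zariski m) {x \<in> G. \<forall>w\<in>W. w x = 0}"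
proof -
  obtain P0 where P0: "G = GL_zeros m P0"
    using alg_group by (auto simp: linear_algebraic_group_def closedin_zariski)
  define p where "p w = (SOME p. \<exists>k. \<forall>x\<in>G. w x * det x ^ k = mat_poly m p x)" for w
  have p: "\<exists>k. \<forall>x\<in>G. w x * det x ^ k = mat_poly m (p w) x" if "w \<in> W" for w
    unfolding p_def by (rule someI_ex) (use that assms regular_eq_mat_poly in auto)
  have "w x = 0 \<longleftrightarrow> mat_poly m (p w) x = 0" if w: "w \<in> W" and x: "x \<in> G" for w x
  proof -
    obtain k where "\<forall>x\<in>G. w x * det x ^ k = mat_poly m (p w) x"
      using p[OF w] by (rule exE)
    then have "mat_poly m (p w) x = w x * det x ^ k" using x by simp
    then show ?thesis using G_det[OF x] by simp
  qed
  then have "{x \<in> G. \<forall>w\<in>W. w x = 0} = GL_zeros m (P0 \<union> p ` W)"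
    unfolding P0 GL_zeros_def by auto
  then show ?thesis by (auto simp: closedin_zariski)
qed

section \<open>Powers of the maximal ideal at the unit\<close>

inductive mpow :: "nat \<Rightarrow> ('c mat \<Rightarrow> 'c) \<Rightarrow> bool" where
  mpow_0: "f \<in> \<A> \<Longrightarrow> mpow 0 f"
| mpow_Suc: "mpow n f \<Longrightarrow> h \<in> \<A> \<Longrightarrow> h unit = 0 \<Longrightarrow> mpow (Suc n) (\<lambda>x. h x * f x)"
| mpow_add: "mpow n f \<Longrightarrow> mpow n g \<Longrightarrow> mpow n (\<lambda>x. f x + g x)"
| mpow_cong: "mpow n f \<Longrightarrow> (\<And>x. x \<in> G \<Longrightarrow> g x = f x) \<Longrightarrow> mpow n g"

lemma mpow_regular: "mpow n f \<Longrightarrow> f \<in> \<A>"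
  by (induction rule: mpow.induct) (auto intro: polyfun_add polyfun_mult polyfun_cong)

lemma mpow_times: "mpow n f \<Longrightarrow> a \<in> \<A> \<Longrightarrow> mpow n (\<lambda>x. a x * f x)"
proof (induction rule: mpow.induct)
  case (mpow_0 f)
  then show ?case by (intro mpow.mpow_0 polyfun_mult)
next
  case (mpow_Suc n f h)
  then have "mpow (Suc n) (\<lambda>x. h x * (a x * f x))" by (intro mpow.mpow_Suc)
  then show ?case by (simp add: mult.left_commute)
next
  case (mpow_add n f g)
  then have "mpow n (\<lambda>x. a x * f x + a x * g x)" by (intro mpow.mpow_add)
  then show ?case by (simp add: distrib_left)
next
  case (mpow_cong n f g)
  then have "mpow n (\<lambda>x. a x * f x)" by simp
  then show ?case by (rule mpow.mpow_cong) (use mpow_cong in simp)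
qed

lemma mpow_scale: "mpow n f \<Longrightarrow> mpow n (\<lambda>x. a * f x)"
  by (rule mpow_times) (auto intro: polyfun_const)

lemma mpow_diff: "mpow n f \<Longrightarrow> mpow n g \<Longrightarrow> mpow n (\<lambda>x. f x - g x)"
  using mpow_add[OF _ mpow_scale, of n f g "- 1"] by simp

lemma mpow_zero: "mpow n (\<lambda>_. 0)"
proof (induction n)
  case 0
  show ?case by (intro mpow_0 polyfun_const)
next
  case (Suc n)
  show ?case using mpow_Suc[OF Suc polyfun_const, of 0] by simp
qed

lemma mpow_sum: "(\<And>i. i \<in> I \<Longrightarrow> mpow n (f i)) \<Longrightarrow> mpow n (\<lambda>x. \<Sum>i\<in>I. f i x)"
  by (induction I rule: infinite_finite_induct) (auto intro: mpow_zero mpow_add)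

lemma mpow_mult: "mpow a f \<Longrightarrow> mpow b g \<Longrightarrow> mpow (a + b) (\<lambda>x. f x * g x)"
proof (induction rule: mpow.induct)
  case (mpow_0 f)
  then show ?case by (simp add: mpow_times)
next
  case (mpow_Suc n f h)
  then have "mpow (Suc (n + b)) (\<lambda>x. h x * (f x * g x))" by (intro mpow.mpow_Suc) auto
  then show ?case by (simp add: mult.assoc)
next
  case (mpow_add n f h)
  then have "mpow (n + b) (\<lambda>x. f x * g x + h x * g x)" by (intro mpow.mpow_add) auto
  then show ?case by (simp add: distrib_right)
next
  case (mpow_cong n f h)
  then have "mpow (n + b) (\<lambda>x. f x * g x)" by simp
  then show ?case by (rule mpow.mpow_cong) (use mpow_cong in simp)
qed

lemma mpow_1: "f \<in> \<A> \<Longrightarrow> f unit = 0 \<Longrightarrow> mpow 1 f"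
  using mpow_Suc[OF mpow_0[OF polyfun_const], of f 1] by simp

lemma mpow_2: "f \<in> \<A> \<Longrightarrow> f unit = 0 \<Longrightarrow> g \<in> \<A> \<Longrightarrow> g unit = 0 \<Longrightarrow> mpow 2 (\<lambda>x. f x * g x)"
  using mpow_Suc[OF mpow_1, of g f] by (simp add: numeral_2_eq_2)

section \<open>The cotangent space at the unit\<close>

definition yc :: "nat \<Rightarrow> 'c mat \<Rightarrow> 'c"
  where "yc k x = crd k x - crd k unit"

lemma yc_regular: "k < K \<Longrightarrow> yc k \<in> \<A>"
  unfolding yc_def by (intro polyfun_diff polyfun_coord polyfun_const)

lemma yc_unit [simp]: "yc k unit = 0"
  by (simp add: yc_def)

text \<open>With \<open>\<mm>\<close> the maximal ideal at the unit, the classes of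
  \<open>yc k\<close> for \<open>k\<close> in \<open>S\<close> span
  \<open>\<mm> / \<mm>\<^sup>2\<close>; equivalently, every regular function has a first-order
  Taylor expansion in these coordinates.\<close>

definition cotangent_spanning :: "nat set \<Rightarrow> bool"
  where "cotangent_spanning S \<longleftrightarrow> S \<subseteq> {..<K} \<and>
    (\<forall>f\<in>\<A>. \<exists>\<alpha>. mpow 2 (\<lambda>x. f x - f unit - (\<Sum>k\<in>S. \<alpha> k * yc k x)))"

text \<open>Functions with a first-order expansion are closed under products, because the error of
  the product rule is \<open>(f x - f unit) * (g x - g unit)\<close>, which lies in the square of
  the maximal ideal.\<close>

lemma cotangent_spanning_all: "cotangent_spanning {..<K}"
  unfolding cotangent_spanning_def
proof (intro conjI ballI)
  fix f assume "f \<in> \<A>"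
  then show "\<exists>\<alpha>. mpow 2 (\<lambda>x. f x - f unit - (\<Sum>k<K. \<alpha> k * yc k x))"
  proof induction
    case (polyfun_const a)
    show ?case by (rule exI[of _ "\<lambda>_. 0"]) (simp add: mpow_zero)
  next
    case (polyfun_coord j)
    have "(\<Sum>k<K. (if k = j then 1 else 0) * yc k x) = yc j x" for x
      using polyfun_coord by (simp add: if_distrib[of "\<lambda>a. a * _"] cong: if_cong)
    then show ?case
      by (intro exI[of _ "\<lambda>k. if k = j then 1 else 0"]) (simp add: mpow_zero yc_def)
  next
    case (polyfun_add f g)
    then obtain \<alpha> \<beta> where "mpow 2 (\<lambda>x. f x - f unit - (\<Sum>k<K. \<alpha> k * yc k x))"
      and "mpow 2 (\<lambda>x. g x - g unit - (\<Sum>k<K. \<beta> k * yc k x))" by blast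
    from mpow_add[OF this] show ?case
      by (intro exI[of _ "\<lambda>k. \<alpha> k + \<beta> k"]) (simp add: algebra_simps sum.distrib)
  next
    case (polyfun_mult f g)
    then obtain \<alpha> \<beta> where a: "mpow 2 (\<lambda>x. f x - f unit - (\<Sum>k<K. \<alpha> k * yc k x))"
      and b: "mpow 2 (\<lambda>x. g x - g unit - (\<Sum>k<K. \<beta> k * yc k x))" by blast
    have "mpow 2 (\<lambda>x. (f x - f unit) * (g x - g unit))"
      using polyfun_mult by (intro mpow_2 polyfun_diff polyfun_const) auto
    from mpow_add[OF this mpow_add[OF mpow_scale[OF a, of "g unit"] mpow_scale[OF b, of "f unit"]]]
    show ?case
      by (intro exI[of _ "\<lambda>k. g unit * \<alpha> k + f unit * \<beta> k"])
        (simp add: algebra_simps sum.distrib sum_distrib_left)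
  next
    case (polyfun_cong f g)
    then obtain \<alpha> where "mpow 2 (\<lambda>x. f x - f unit - (\<Sum>k<K. \<alpha> k * yc k x))" by blast
    then have "mpow 2 (\<lambda>x. g x - g unit - (\<Sum>k<K. \<alpha> k * yc k x))"
      by (rule mpow_cong) (use polyfun_cong in simp)
    then show ?case by (rule exI[of _ \<alpha>])
  qed
qed simp

text \<open>Coordinates whose classes form a basis of the cotangent space at the unit.\<close>

definition B :: "nat set"
  where "B = (SOME S. cotangent_spanning S \<and> (\<forall>T. cotangent_spanning T \<longrightarrow> card S \<le> card T))"

lemma B: "cotangent_spanning B" "cotangent_spanning T \<Longrightarrow> card B \<le> card T"
proof -
  have "\<exists>S. cotangent_spanning S \<and> (\<forall>T. cotangent_spanning T \<longrightarrow> card S \<le> card T)"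
    using ex_has_least_nat[of cotangent_spanning, OF cotangent_spanning_all] by blast
  from someI_ex[OF this] show "cotangent_spanning B" "cotangent_spanning T \<Longrightarrow> card B \<le> card T"
    unfolding B_def by blast+
qed

lemma B_subset: "B \<subseteq> {..<K}"
  using B(1) by (simp add: cotangent_spanning_def)

lemma finite_B [simp]: "finite B"
  using B_subset finite_subset by blast

lemma yc_B_regular: "k \<in> B \<Longrightarrow> yc k \<in> \<A>"
  using B_subset yc_regular by auto

text \<open>A relation with a nonzero coefficient at \<open>j\<close> would express
  \<open>yc j\<close> by the others modulo second order, against the minimal cardinality of
  \<open>B\<close>.\<close>

lemma B_independent:
  assumes "mpow 2 (\<lambda>x. \<Sum>k\<in>B. \<alpha> k * yc k x)" "j \<in> B"
  shows "\<alpha> j = 0"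
proof (rule ccontr)
  assume j: "\<alpha> j \<noteq> 0"
  have "cotangent_spanning (B - {j})"
    unfolding cotangent_spanning_def
  proof (intro conjI ballI)
    fix f assume "f \<in> \<A>"
    then obtain \<beta> where b: "mpow 2 (\<lambda>x. f x - f unit - (\<Sum>k\<in>B. \<beta> k * yc k x))"
      using B(1) by (auto simp: cotangent_spanning_def)
    have "mpow 2 (\<lambda>x. f x - f unit - (\<Sum>k\<in>B. \<beta> k * yc k x) +
        \<beta> j / \<alpha> j * (\<Sum>k\<in>B. \<alpha> k * yc k x))" (is "mpow 2 ?g")
      by (intro mpow_add b mpow_scale assms)
    moreover have "?g = (\<lambda>x. f x - f unit - (\<Sum>k\<in>B - {j}. (\<beta> k - \<beta> j / \<alpha> j * \<alpha> k) * yc k x))"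
    proof
      fix x
      have "(\<Sum>k\<in>B. \<beta> k * yc k x) - \<beta> j / \<alpha> j * (\<Sum>k\<in>B. \<alpha> k * yc k x) =
          (\<Sum>k\<in>B. (\<beta> k - \<beta> j / \<alpha> j * \<alpha> k) * yc k x)"
        by (simp add: algebra_simps sum_subtractf sum_distrib_left)
      also have "\<dots> = (\<Sum>k\<in>B - {j}. (\<beta> k - \<beta> j / \<alpha> j * \<alpha> k) * yc k x)"
        using assms(2) j by (simp add: sum.remove)
      finally show "?g x = f x - f unit - (\<Sum>k\<in>B - {j}. (\<beta> k - \<beta> j / \<alpha> j * \<alpha> k) * yc k x)"
        by (simp add: algebra_simps)
    qed
    ultimately have "mpow 2 (\<lambda>x. f x - f unit - (\<Sum>k\<in>B - {j}. (\<beta> k - \<beta> j / \<alpha> j * \<alpha> k) * yc k x))"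
      by simp
    then show "\<exists>\<alpha>. mpow 2 (\<lambda>x. f x - f unit - (\<Sum>k\<in>B - {j}. \<alpha> k * yc k x))"
      by (rule exI[of _ "\<lambda>k. \<beta> k - \<beta> j / \<alpha> j * \<alpha> k"])
  qed (use B_subset in auto)
  from B(2)[OF this] show False
    using assms(2) by (metis card_Diff1_less finite_B leD)
qed

section \<open>Invariant derivations\<close>

text \<open>The \<open>k\<close>-th vector of the basis of the tangent space at the unit dual to \<open>B\<close>.\<close>

definition dpt :: "nat \<Rightarrow> ('c mat \<Rightarrow> 'c) \<Rightarrow> 'c"
  where "dpt k f = (SOME \<alpha>. mpow 2 (\<lambda>x. f x - f unit - (\<Sum>k\<in>B. \<alpha> k * yc k x))) k"

lemma dpt:
  assumes "f \<in> \<A>"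
  shows "mpow 2 (\<lambda>x. f x - f unit - (\<Sum>k\<in>B. dpt k f * yc k x))"
proof -
  have "\<exists>\<alpha>. mpow 2 (\<lambda>x. f x - f unit - (\<Sum>k\<in>B. \<alpha> k * yc k x))"
    using B(1) assms by (auto simp: cotangent_spanning_def)
  from someI_ex[OF this] show ?thesis
    unfolding dpt_def by simp
qed

lemma dpt_eqI:
  assumes "f \<in> \<A>" "mpow 2 (\<lambda>x. f x - f unit - (\<Sum>k\<in>B. \<alpha> k * yc k x))" "k \<in> B"
  shows "dpt k f = \<alpha> k"
proof -
  have "mpow 2 (\<lambda>x. \<Sum>k\<in>B. (\<alpha> k - dpt k f) * yc k x)"
    using mpow_diff[OF dpt[OF assms(1)] assms(2)] by (simp add: algebra_simps sum_subtractf)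
  from B_independent[OF this assms(3)] show ?thesis by simp
qed

lemma dpt_cong:
  assumes "f \<in> \<A>" "\<And>x. x \<in> G \<Longrightarrow> f x = g x" "k \<in> B"
  shows "dpt k f = dpt k g"
proof (rule dpt_eqI[OF assms(1) _ assms(3)])
  have "g \<in> \<A>" by (rule polyfun_cong[OF assms(1)]) (simp add: assms(2))
  from dpt[OF this] show "mpow 2 (\<lambda>x. f x - f unit - (\<Sum>k\<in>B. dpt k g * yc k x))"
    by (rule mpow_cong) (simp add: assms(2) unit_in_G)
qed

lemma dpt_const: "k \<in> B \<Longrightarrow> dpt k (\<lambda>_. a) = 0"
  by (rule dpt_eqI[OF polyfun_const, of _ "\<lambda>_. 0"]) (simp_all add: mpow_zero)

lemma dpt_add:
  assumes "f \<in> \<A>" "g \<in> \<A>" "k \<in> B"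
  shows "dpt k (\<lambda>x. f x + g x) = dpt k f + dpt k g"
proof (rule dpt_eqI[OF polyfun_add _ assms(3)])
  show "mpow 2 (\<lambda>x. f x + g x - (f unit + g unit) - (\<Sum>k\<in>B. (dpt k f + dpt k g) * yc k x))"
    using mpow_add[OF dpt[OF assms(1)] dpt[OF assms(2)]] by (simp add: algebra_simps sum.distrib)
qed (use assms in auto)

lemma dpt_mult:
  assumes "f \<in> \<A>" "g \<in> \<A>" "k \<in> B"
  shows "dpt k (\<lambda>x. f x * g x) = f unit * dpt k g + g unit * dpt k f"
proof (rule dpt_eqI[OF polyfun_mult _ assms(3)])
  have "mpow 2 (\<lambda>x. (f x - f unit) * (g x - g unit))"
    using assms by (intro mpow_2 polyfun_diff polyfun_const) auto
  from mpow_add[OF this mpow_add[OF mpow_scale[OF dpt[OF assms(1)], of "g unit"]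
        mpow_scale[OF dpt[OF assms(2)], of "f unit"]]]
  show "mpow 2 (\<lambda>x. f x * g x - f unit * g unit -
      (\<Sum>k\<in>B. (f unit * dpt k g + g unit * dpt k f) * yc k x))"
    by (simp add: algebra_simps sum.distrib sum_distrib_left)
qed (use assms in auto)

lemma dpt_scale: "f \<in> \<A> \<Longrightarrow> k \<in> B \<Longrightarrow> dpt k (\<lambda>x. a * f x) = a * dpt k f"
  using dpt_mult[OF polyfun_const, of f k a] by (simp add: dpt_const)

lemma dpt_sum:
  "(\<And>i. i \<in> I \<Longrightarrow> f i \<in> \<A>) \<Longrightarrow> k \<in> B \<Longrightarrow> dpt k (\<lambda>x. \<Sum>i\<in>I. f i x) = (\<Sum>i\<in>I. dpt k (f i))"
  by (induction I rule: infinite_finite_induct) (auto simp: dpt_const dpt_add polyfun_sum)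

text \<open>The right-invariant vector field with value \<open>dpt k\<close> at the unit.\<close>

definition dinv :: "nat \<Rightarrow> ('c mat \<Rightarrow> 'c) \<Rightarrow> 'c mat \<Rightarrow> 'c"
  where "dinv k f y = dpt k (\<lambda>x. f (x * y))"

lemma dinv_cong:
  assumes "f \<in> \<A>" "\<And>x. x \<in> G \<Longrightarrow> f x = g x" "k \<in> B" "y \<in> G"
  shows "dinv k f y = dinv k g y"
  unfolding dinv_def by (rule dpt_cong[OF translate_right_regular]) (use assms in auto)

lemma dinv_interpolate:
  assumes "finite P" "P \<subseteq> G" "\<And>p. p \<in> P \<Longrightarrow> b p \<in> \<A>"
    and "\<And>x y. x \<in> G \<Longrightarrow> y \<in> G \<Longrightarrow> f (x * y) = (\<Sum>p\<in>P. f (p * y) * b p x)"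
    and "k \<in> B" "y \<in> G"
  shows "dinv k f y = (\<Sum>p\<in>P. dpt k (b p) * f (p * y))"
proof -
  have "dinv k f y = dpt k (\<lambda>x. \<Sum>p\<in>P. f (p * y) * b p x)"
    unfolding dinv_def
    by (rule dpt_cong[symmetric], intro polyfun_sum polyfun_scale) (use assms in auto)
  also have "\<dots> = (\<Sum>p\<in>P. dpt k (\<lambda>x. f (p * y) * b p x))"
    by (rule dpt_sum) (use assms in \<open>auto intro: polyfun_scale\<close>)
  also have "\<dots> = (\<Sum>p\<in>P. dpt k (b p) * f (p * y))"
    using assms by (simp add: dpt_scale) (simp add: mult.commute)
  finally show ?thesis .
qed

text \<open>By local finiteness the derivative is a combination, with constant coefficients
  \<open>dpt k (b p)\<close>, of finitely many left translates of \<open>f\<close>.\<close>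

lemma dinv_regular:
  assumes "f \<in> \<A>" "k \<in> B"
  shows "dinv k f \<in> \<A>"
proof -
  obtain P b where P: "finite P" "P \<subseteq> G" "\<And>p. p \<in> P \<Longrightarrow> b p \<in> \<A>"
    "\<And>x y. x \<in> G \<Longrightarrow> y \<in> G \<Longrightarrow> f (x * y) = (\<Sum>p\<in>P. f (p * y) * b p x)"
    by (rule mult_interpolate[OF assms(1)], rule that)
  have "(\<lambda>y. \<Sum>p\<in>P. dpt k (b p) * f (p * y)) \<in> \<A>"
    by (intro polyfun_sum polyfun_scale translate_left_regular) (use P assms in auto)
  then show ?thesis
    by (rule polyfun_cong) (rule dinv_interpolate[OF P assms(2)])
qed

lemma dinv_add:
  "f \<in> \<A> \<Longrightarrow> g \<in> \<A> \<Longrightarrow> k \<in> B \<Longrightarrow> y \<in> G \<Longrightarrow> dinv k (\<lambda>x. f x + g x) y = dinv k f y + dinv k g y"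
  unfolding dinv_def by (intro dpt_add translate_right_regular)

lemma dinv_scale:
  "f \<in> \<A> \<Longrightarrow> k \<in> B \<Longrightarrow> y \<in> G \<Longrightarrow> dinv k (\<lambda>x. a * f x) y = a * dinv k f y"
  unfolding dinv_def by (intro dpt_scale translate_right_regular)

lemma dinv_const: "k \<in> B \<Longrightarrow> dinv k (\<lambda>_. a) y = 0"
  unfolding dinv_def by (rule dpt_const)

lemma dinv_diff:
  assumes "f \<in> \<A>" "g \<in> \<A>" "k \<in> B" "y \<in> G"
  shows "dinv k (\<lambda>x. f x - g x) y = dinv k f y - dinv k g y"
  using dinv_add[OF assms(1) polyfun_scale[OF assms(2), of "- 1"] assms(3,4)]
    dinv_scale[OF assms(2-4), of "- 1"] by simp

lemma dinv_sum:
  "(\<And>i. i \<in> I \<Longrightarrow> f i \<in> \<A>) \<Longrightarrow> k \<in> B \<Longrightarrow> y \<in> G \<Longrightarrow>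
    dinv k (\<lambda>x. \<Sum>i\<in>I. f i x) y = (\<Sum>i\<in>I. dinv k (f i) y)"
  unfolding dinv_def by (intro dpt_sum translate_right_regular)

lemma dinv_mult:
  assumes "f \<in> \<A>" "g \<in> \<A>" "k \<in> B" "y \<in> G"
  shows "dinv k (\<lambda>x. f x * g x) y = f y * dinv k g y + g y * dinv k f y"
  unfolding dinv_def using assms
  by (subst dpt_mult) (auto intro: translate_right_regular simp: unit_mult)

text \<open>Right invariance is associativity of the product. It is what turns right translations
  into automorphisms that commute with the derivation.\<close>

lemma dinv_translate:
  assumes "f \<in> \<A>" "k \<in> B" "y \<in> G" "z \<in> G"
  shows "dinv k (\<lambda>x. f (x * z)) y = dinv k f (y * z)"
  unfolding dinv_def
  by (rule dpt_cong) (use assms in \<open>auto intro: translate_right_regular simp: G_assoc\<close>)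

lemma dinv_unit:
  assumes "f \<in> \<A>" "k \<in> B"
  shows "dinv k f unit = dpt k f"
  unfolding dinv_def
  by (rule dpt_cong[symmetric]) (use assms in \<open>auto simp: unit_mult\<close>)

text \<open>\<open>\<Sum>\<^sub>k y\<^sub>k D\<^sub>k\<close> acts on \<open>\<mm>\<^sup>n / \<mm>\<^sup>n\<^sup>+\<^sup>1\<close> as multiplication by \<open>n\<close>, as in Euler's formula.\<close>

definition euler_field :: "('c mat \<Rightarrow> 'c) \<Rightarrow> 'c mat \<Rightarrow> 'c"
  where "euler_field f x = (\<Sum>k\<in>B. yc k x * dinv k f x)"

text \<open>Replacing each \<open>dinv k f\<close> by its value at the unit costs a term of second
  order, and what remains is the first-order expansion of \<open>f\<close>.\<close>

lemma euler_field_linear: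
  assumes "f \<in> \<A>" "f unit = 0"
  shows "mpow 2 (\<lambda>x. euler_field f x - f x)"
proof -
  have "mpow 2 (\<lambda>x. \<Sum>k\<in>B. yc k x * (dinv k f x - dpt k f))"
    by (intro mpow_sum mpow_2 polyfun_diff polyfun_const dinv_regular)
      (use assms in \<open>auto simp: yc_B_regular dinv_unit\<close>)
  from mpow_diff[OF this dpt[OF assms(1)]] show ?thesis
    unfolding euler_field_def using assms(2) by (simp add: algebra_simps sum_subtractf)
qed

text \<open>By the product rule, a further factor \<open>h\<close> vanishing at the unit contributes
  \<open>euler_field h * f\<close>, which is \<open>h * f\<close> up to a term of higher order; so
  the eigenvalue grows by one with each factor.\<close>

lemma euler_field_mpow: "mpow n f \<Longrightarrow> mpow (Suc n) (\<lambda>x. euler_field f x - of_nat n * f x)"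
proof (induction rule: mpow.induct)
  case (mpow_0 f)
  show ?case
    unfolding euler_field_def
    by (simp, intro mpow_sum mpow_Suc mpow.mpow_0 dinv_regular)
      (use mpow_0 in \<open>auto simp: yc_B_regular\<close>)
next
  case (mpow_Suc n f h)
  note f = mpow_regular[OF mpow_Suc.hyps(1)] and h = mpow_Suc.hyps(2)
  have "mpow (Suc (Suc n)) (\<lambda>x. h x * (euler_field f x - of_nat n * f x))"
    by (intro mpow.mpow_Suc mpow_Suc)
  moreover have "mpow (Suc (Suc n)) (\<lambda>x. (euler_field h x - h x) * f x)"
    using mpow_mult[OF euler_field_linear[OF mpow_Suc.hyps(2,3)] mpow_Suc.hyps(1)] by simp
  ultimately have "mpow (Suc (Suc n)) (\<lambda>x. h x * (euler_field f x - of_nat n * f x) +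
      (euler_field h x - h x) * f x)"
    by (rule mpow_add)
  then show ?case
  proof (rule mpow_cong)
    fix x assume x: "x \<in> G"
    have "euler_field (\<lambda>x. h x * f x) x = h x * euler_field f x + f x * euler_field h x"
      unfolding euler_field_def
      by (simp add: dinv_mult[OF h f _ x]) (simp add: algebra_simps sum.distrib sum_distrib_left)
    then show "euler_field (\<lambda>x. h x * f x) x - of_nat (Suc n) * (h x * f x) =
        h x * (euler_field f x - of_nat n * f x) + (euler_field h x - h x) * f x"
      by (simp add: algebra_simps)
  qed
next
  case (mpow_add n f g)
  from mpow.mpow_add[OF mpow_add.IH] show ?case
  proof (rule mpow_cong)
    fix x assume x: "x \<in> G"
    have "euler_field (\<lambda>x. f x + g x) x = euler_field f x + euler_field g x"
      unfolding euler_field_def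
      by (simp add: dinv_add[OF mpow_regular mpow_regular _ x, OF mpow_add.hyps] algebra_simps sum.distrib)
    then show "euler_field (\<lambda>x. f x + g x) x - of_nat n * (f x + g x) =
        euler_field f x - of_nat n * f x + (euler_field g x - of_nat n * g x)"
      by (simp add: algebra_simps)
  qed
next
  case (mpow_cong n f g)
  from mpow_cong.IH show ?case
  proof (rule mpow.mpow_cong)
    fix x assume x: "x \<in> G"
    have "euler_field g x = euler_field f x"
      unfolding euler_field_def
      by (intro sum.cong refl arg_cong2[of _ _ _ _ "(*)"] dinv_cong[symmetric])
        (use mpow_cong mpow_regular x in auto)
    then show "euler_field g x - of_nat n * g x = euler_field f x - of_nat n * f x"
      using mpow_cong x by simp
  qed
qed

end

locale matrix_group_char_0 = matrix_group m G
  for m :: nat and G :: "'c::field_char_0 mat set"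
begin

text \<open>If \<open>J\<close> lies in the power \<open>n\<close> of the maximal ideal, the Euler
  field maps \<open>J\<close> into the power \<open>n + 1\<close>, because it multiplies
  derivatives, again in \<open>J\<close>, by coordinates vanishing at the unit. Modulo that power it
  is multiplication by \<open>n\<close>, which can be divided out unless \<open>n = 0\<close>; there
  the vanishing at the unit gives the step.\<close>

lemma invariant_set_mpow:
  assumes "J \<subseteq> \<A>" "\<And>f. f \<in> J \<Longrightarrow> f unit = 0" "\<And>f k. f \<in> J \<Longrightarrow> k \<in> B \<Longrightarrow> dinv k f \<in> J"
  shows "f \<in> J \<Longrightarrow> mpow n f"
proof (induction n arbitrary: f)
  case 0
  then show ?case using assms(1) by (intro mpow_0) auto
next
  case (Suc n)
  have reg: "f \<in> \<A>" using Suc.prems assms(1) by blast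
  show ?case
  proof (cases "n = 0")
    case True
    then show ?thesis using mpow_1[OF reg assms(2)[OF Suc.prems]] by simp
  next
    case False
    have "mpow (Suc n) (euler_field f)"
      unfolding euler_field_def
      by (intro mpow_sum mpow_Suc Suc.IH assms(3) Suc.prems) (auto simp: yc_B_regular)
    from mpow_diff[OF this euler_field_mpow[OF Suc.IH[OF Suc.prems]]]
    have "mpow (Suc n) (\<lambda>x. of_nat n * f x)" by simp
    from mpow_scale[OF this, of "1 / of_nat n"]
    have "mpow (Suc n) (\<lambda>x. 1 / of_nat n * (of_nat n * f x))" .
    moreover have "(\<lambda>x. 1 / of_nat n * (of_nat n * f x)) = f"
      using False by (simp add: fun_eq_iff)
    ultimately show ?thesis by (simp only:)
  qed
qed

section \<open>Krull's intersection theorem and rigidity\<close>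

text \<open>Coordinates \<open>c\<^sub>k(x)\<close> and \<open>s (c\<^sub>k(x) - c\<^sub>k(1))\<close> on \<open>G \<times> C\<close>, generating the Rees algebra: the
  function \<open>s\<^sup>n f\<close> is a polynomial in them if \<open>f \<in> \<mm>\<^sup>n\<close>.\<close>

definition rees_crd :: "nat \<Rightarrow> 'c mat \<times> 'c \<Rightarrow> 'c"
  where "rees_crd k = (\<lambda>(x, s). if k < K then crd k x else s * yc (k - K) x)"

definition "rees_dim = 2 * K"

abbreviation "\<R> \<equiv> polyfun (G \<times> UNIV) rees_dim rees_crd"

lemma regular_rees:
  assumes "a \<in> \<A>"
  shows "(\<lambda>z. a (fst z)) \<in> \<R>"
proof (rule polyfun_subst[OF assms])
  fix k assume "k < K"
  then have "rees_crd k \<in> \<R>" "rees_crd k = (\<lambda>z. crd k (fst z))"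
    by (auto intro!: polyfun_coord simp: rees_dim_def, auto simp: rees_crd_def)
  then show "(\<lambda>z. crd k (fst z)) \<in> \<R>" by simp
qed auto

lemma diff_unit_rees: "a \<in> \<A> \<Longrightarrow> (\<lambda>z. snd z * (a (fst z) - a unit)) \<in> \<R>"
proof (induction rule: polyfun.induct)
  case (polyfun_const a)
  show ?case using polyfun.polyfun_const[of 0] by simp
next
  case (polyfun_coord k)
  then have "rees_crd (K + k) \<in> \<R>" "rees_crd (K + k) = (\<lambda>z. snd z * (crd k (fst z) - crd k unit))"
    by (auto intro!: polyfun.polyfun_coord simp: rees_dim_def, auto simp: rees_crd_def yc_def)
  then show ?case by simp
next
  case (polyfun_add f g)
  from polyfun.polyfun_add[OF polyfun_add.IH] show ?case by (simp add: algebra_simps)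
next
  case (polyfun_mult f g)
  have "(\<lambda>z. snd z * (f (fst z) - f unit) * g (fst z) + f unit * (snd z * (g (fst z) - g unit))) \<in> \<R>"
    by (intro polyfun.polyfun_add polyfun.polyfun_mult polyfun_scale polyfun_mult.IH regular_rees polyfun_mult.hyps)
  then show ?case by (rule polyfun_cong) (simp add: algebra_simps)
next
  case (polyfun_cong f g)
  show ?case by (rule polyfun.polyfun_cong[OF polyfun_cong.IH]) (use polyfun_cong in auto)
qed

lemma mpow_rees: "mpow n f \<Longrightarrow> (\<lambda>z. snd z ^ n * f (fst z)) \<in> \<R>"
proof (induction rule: mpow.induct)
  case (mpow_0 f)
  then show ?case by (simp add: regular_rees)
next
  case (mpow_Suc n f h)
  have "(\<lambda>z. snd z * (h (fst z) - h unit) * (snd z ^ n * f (fst z))) \<in> \<R>"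
    by (intro polyfun_mult diff_unit_rees mpow_Suc)
  then show ?case by (rule polyfun_cong) (simp add: algebra_simps mpow_Suc)
next
  case (mpow_add n f g)
  from polyfun_add[OF mpow_add.IH] show ?case by (simp add: algebra_simps)
next
  case (mpow_cong n f g)
  show ?case by (rule polyfun_cong[OF mpow_cong.IH]) (use mpow_cong in auto)
qed

text \<open>The coefficient of \<open>s ^ j\<close> in an element of the Rees algebra lies in the
  power \<open>j\<close> of the maximal ideal. Of this only the vanishing at the unit for
  \<open>j > 0\<close> is recorded.\<close>

lemma rees_poly:
  assumes "q \<in> \<R>"
  shows "\<exists>Q. (\<forall>x\<in>G. \<forall>s. q (x, s) = poly (Q x) s) \<and> (\<forall>j. (\<lambda>x. coeff (Q x) j) \<in> \<A>) \<and>
    (\<forall>j>0. coeff (Q unit) j = 0)"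
  using assms
proof induction
  case (polyfun_const a)
  show ?case
    by (rule exI[of _ "\<lambda>_. [:a:]"]) (auto simp: polyfun.polyfun_const coeff_pCons split: nat.splits)
next
  case (polyfun_coord k)
  show ?case
  proof (cases "k < K")
    case True
    then have "(\<lambda>x. coeff [:crd k x:] j) \<in> \<A>" for j
      by (cases j) (auto intro: polyfun.polyfun_coord polyfun.polyfun_const)
    then show ?thesis
      using True by (intro exI[of _ "\<lambda>x. [:crd k x:]"])
        (auto simp: rees_crd_def coeff_pCons split: nat.splits)
  next
    case False
    then have "k - K < K" using polyfun_coord by (simp add: rees_dim_def)
    then have "(\<lambda>x. if j = 1 then yc (k - K) x else 0) \<in> \<A>" for j :: nat
      by (cases "j = 1") (auto intro: yc_regular polyfun.polyfun_const)
    moreover have "coeff [:0, yc (k - K) x:] j = (if j = 1 then yc (k - K) x else 0)" for x j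
      by (auto simp: coeff_pCons split: nat.splits)
    ultimately have "(\<lambda>x. coeff [:0, yc (k - K) x:] j) \<in> \<A>" for j
      by simp
    then show ?thesis
      using False by (intro exI[of _ "\<lambda>x. [:0, yc (k - K) x:]"])
        (auto simp: rees_crd_def coeff_pCons split: nat.splits)
  qed
next
  case (polyfun_add f g)
  then obtain P Q where P: "\<forall>x\<in>G. \<forall>s. f (x, s) = poly (P x) s" "\<forall>j. (\<lambda>x. coeff (P x) j) \<in> \<A>"
      "\<forall>j>0. coeff (P unit) j = 0"
    and Q: "\<forall>x\<in>G. \<forall>s. g (x, s) = poly (Q x) s" "\<forall>j. (\<lambda>x. coeff (Q x) j) \<in> \<A>"
      "\<forall>j>0. coeff (Q unit) j = 0"
    by (elim exE conjE)
  then show ?case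
    by (intro exI[of _ "\<lambda>x. P x + Q x"]) (auto intro: polyfun.polyfun_add)
next
  case (polyfun_mult f g)
  then obtain P Q where P: "\<forall>x\<in>G. \<forall>s. f (x, s) = poly (P x) s" "\<forall>j. (\<lambda>x. coeff (P x) j) \<in> \<A>"
      "\<forall>j>0. coeff (P unit) j = 0"
    and Q: "\<forall>x\<in>G. \<forall>s. g (x, s) = poly (Q x) s" "\<forall>j. (\<lambda>x. coeff (Q x) j) \<in> \<A>"
      "\<forall>j>0. coeff (Q unit) j = 0"
    by (elim exE conjE)
  have "(\<lambda>x. coeff (P x * Q x) j) \<in> \<A>" for j
    unfolding coeff_mult by (intro polyfun_sum polyfun.polyfun_mult P(2)[rule_format] Q(2)[rule_format])
  moreover have "coeff (P unit * Q unit) j = 0" if "j > 0" for j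
    unfolding coeff_mult
  proof (rule sum.neutral, rule ballI)
    fix i assume "i \<in> {..j}"
    then have "i > 0 \<or> j - i > 0" using that by auto
    then show "coeff (P unit) i * coeff (Q unit) (j - i) = 0"
      using P(3) Q(3) by auto
  qed
  ultimately show ?case
    using P(1) Q(1) by (intro exI[of _ "\<lambda>x. P x * Q x"]) auto
next
  case (polyfun_cong f g)
  then show ?case by auto
qed

text \<open>All \<open>s ^ n * f\<close> lie in the Rees algebra, so by the basis theorem one of
  them is a combination of those with smaller exponent. Comparing coefficients of
  \<open>s ^ n\<close> gives \<open>f = a * f\<close> with \<open>a unit = 0\<close>, and
  \<open>h = 1 - a\<close>.\<close>

lemma krull_intersection:
  assumes f: "\<And>n. mpow n f"
  obtains h where "h \<in> \<A>" "h unit \<noteq> 0" "\<And>x. x \<in> G \<Longrightarrow> h x * f x = 0"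
proof -
  obtain n q where q: "\<And>i. q i \<in> \<R>" and eq: "\<And>z. z \<in> G \<times> UNIV \<Longrightarrow>
      snd z ^ n * f (fst z) = (\<Sum>i<n. q i z * (snd z ^ i * f (fst z)))"
    by (rule polyfun_hilbert_basis[of "\<lambda>n z. snd z ^ n * f (fst z)", OF mpow_rees[OF f]], rule that)
  define Q where "Q i = (SOME Q. (\<forall>x\<in>G. \<forall>s. q i (x, s) = poly (Q x) s) \<and>
    (\<forall>j. (\<lambda>x. coeff (Q x) j) \<in> \<A>) \<and> (\<forall>j>0. coeff (Q unit) j = 0))" for i
  have "(\<forall>x\<in>G. \<forall>s. q i (x, s) = poly (Q i x) s) \<and>
    (\<forall>j. (\<lambda>x. coeff (Q i x) j) \<in> \<A>) \<and> (\<forall>j>0. coeff (Q i unit) j = 0)" for i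
    unfolding Q_def using someI_ex[OF rees_poly[OF q[of i]]] .
  then have Q: "\<And>i x s. x \<in> G \<Longrightarrow> q i (x, s) = poly (Q i x) s"
    "\<And>i j. (\<lambda>x. coeff (Q i x) j) \<in> \<A>" "\<And>i j. j > 0 \<Longrightarrow> coeff (Q i unit) j = 0"
    by simp_all
  define a where "a x = (\<Sum>i<n. coeff (Q i x) (n - i))" for x
  have a: "a \<in> \<A>" unfolding a_def by (intro polyfun_sum Q(2))
  have "f x = a x * f x" if x: "x \<in> G" for x
  proof -
    \<comment> \<open>As the field is infinite, an identity for all values of \<open>s\<close> is an
      identity of polynomials in \<open>s\<close>.\<close>
    have "monom (f x) n = (\<Sum>i<n. Q i x * monom (f x) i)"
    proof (subst poly_eq_poly_eq_iff[symmetric], rule ext)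
      fix s
      show "poly (monom (f x) n) s = poly (\<Sum>i<n. Q i x * monom (f x) i) s"
        using eq[of "(x, s)"] x by (simp add: poly_monom poly_sum Q(1) mult.commute)
    qed
    then have "coeff (monom (f x) n) n = coeff (\<Sum>i<n. Q i x * monom (f x) i) n"
      by simp
    then have "f x = (\<Sum>i<n. coeff (Q i x * monom (f x) i) n)"
      by (simp add: coeff_sum)
    also have "\<dots> = (\<Sum>i<n. coeff (Q i x) (n - i) * f x)"
    proof (rule sum.cong)
      fix i assume "i \<in> {..<n}"
      moreover have "coeff (Q i x * monom (f x) i) n = coeff (monom (f x) i * Q i x) n"
        by (simp only: mult.commute)
      ultimately show "coeff (Q i x * monom (f x) i) n = coeff (Q i x) (n - i) * f x"
        by (simp add: coeff_monom_mult)
    qed simp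
    finally show ?thesis by (simp add: a_def sum_distrib_right)
  qed
  moreover have "a unit = 0" unfolding a_def by (simp add: Q(3))
  ultimately show thesis
    by (intro that[of "\<lambda>x. 1 - a x"] polyfun_diff polyfun_const a) (auto simp: algebra_simps)
qed

section \<open>Functions with vanishing iterated derivatives\<close>

inductive_set dclosure :: "('c mat \<Rightarrow> 'c) \<Rightarrow> ('c mat \<Rightarrow> 'c) set" for f where
  dclosure_base: "f \<in> dclosure f"
| dclosure_step: "w \<in> dclosure f \<Longrightarrow> k \<in> B \<Longrightarrow> dinv k w \<in> dclosure f"

lemma dclosure_regular: "w \<in> dclosure f \<Longrightarrow> f \<in> \<A> \<Longrightarrow> w \<in> \<A>"
  by (induction rule: dclosure.induct) (auto intro: dinv_regular)

text \<open>By right invariance, iterated derivatives of a translate are, on \<open>G\<close>,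
  translates of iterated derivatives. So a flat point \<open>y\<close> can be moved to the unit and
  back.\<close>

lemma dclosure_translate:
  assumes f: "f \<in> \<A>" and y: "y \<in> G"
  shows "w \<in> dclosure (\<lambda>x. f (x * y)) \<Longrightarrow> \<exists>v\<in>dclosure f. \<forall>x\<in>G. w x = v (x * y)"
    and "v \<in> dclosure f \<Longrightarrow> \<exists>w\<in>dclosure (\<lambda>x. f (x * y)). \<forall>x\<in>G. w x = v (x * y)"
proof -
  have step: "dinv k w x = dinv k v (x * y)"
    if "w \<in> \<A>" "v \<in> \<A>" "\<forall>x\<in>G. w x = v (x * y)" "k \<in> B" "x \<in> G" for w v k x
    using dinv_cong[OF that(1) _ that(4,5), of "\<lambda>x. v (x * y)"] dinv_translate[OF that(2,4,5) y] that(3)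
    by simp
  note reg = dclosure_regular[OF _ f] dclosure_regular[OF _ translate_right_regular[OF f y]]
  show "w \<in> dclosure (\<lambda>x. f (x * y)) \<Longrightarrow> \<exists>v\<in>dclosure f. \<forall>x\<in>G. w x = v (x * y)"
  proof (induction rule: dclosure.induct)
    case dclosure_base
    show ?case by (rule bexI[of _ f]) (auto intro: dclosure.intros)
  next
    case (dclosure_step w k)
    then obtain v where "v \<in> dclosure f" "\<forall>x\<in>G. w x = v (x * y)" by blast
    then show ?case using dclosure_step reg
      by (intro bexI[of _ "dinv k v"]) (auto intro: dclosure.intros step)
  qed
  show "v \<in> dclosure f \<Longrightarrow> \<exists>w\<in>dclosure (\<lambda>x. f (x * y)). \<forall>x\<in>G. w x = v (x * y)"
  proof (induction rule: dclosure.induct)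
    case dclosure_base
    show ?case by (rule bexI[of _ "\<lambda>x. f (x * y)"]) (auto intro: dclosure.intros)
  next
    case (dclosure_step v k)
    then obtain w where "w \<in> dclosure (\<lambda>x. f (x * y))" "\<forall>x\<in>G. w x = v (x * y)" by blast
    then show ?case using dclosure_step reg
      by (intro bexI[of _ "dinv k w"]) (auto intro: dclosure.intros step)
  qed
qed

text \<open>Krull's theorem gives \<open>h * f = 0\<close>. If \<open>g * w = 0\<close>,
  differentiating and multiplying by \<open>g\<close> gives \<open>g * g * dinv k w = 0\<close>. The
  annihilator depends on the derivative, but it is nonzero wherever \<open>h\<close> is, so one
  neighbourhood serves for all derivatives.\<close>

lemma flat_locally_zero:
  assumes f: "f \<in> \<A>" and flat: "\<forall>w\<in>dclosure f. w unit = 0"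
  shows "\<exists>h\<in>\<A>. h unit \<noteq> 0 \<and> (\<forall>w\<in>dclosure f. \<forall>x\<in>G. h x \<noteq> 0 \<longrightarrow> w x = 0)"
proof -
  have flat': "mpow n f" for n
    by (rule invariant_set_mpow[of "dclosure f"]) (use f flat dclosure_regular in \<open>auto intro: dclosure.intros\<close>)
  obtain h where h: "h \<in> \<A>" "h unit \<noteq> 0" and hf: "\<And>x. x \<in> G \<Longrightarrow> h x * f x = 0"
    by (rule krull_intersection[OF flat'], rule that)
  have "\<exists>g\<in>\<A>. (\<forall>x\<in>G. h x \<noteq> 0 \<longrightarrow> g x \<noteq> 0) \<and> (\<forall>x\<in>G. g x * w x = 0)" if "w \<in> dclosure f" for w
    using that
  proof induction
    case dclosure_base
    show ?case using h hf by (intro bexI[of _ h]) auto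
  next
    case (dclosure_step w k)
    then obtain g where g: "g \<in> \<A>" "\<forall>x\<in>G. h x \<noteq> 0 \<longrightarrow> g x \<noteq> 0" "\<forall>x\<in>G. g x * w x = 0"
      by blast
    have w: "w \<in> \<A>" using dclosure_step f dclosure_regular by blast
    have "g x * g x * dinv k w x = 0" if x: "x \<in> G" for x
    proof -
      have "dinv k (\<lambda>x. g x * w x) x = dinv k (\<lambda>_. 0) x"
        by (rule dinv_cong) (use g w x dclosure_step in \<open>auto intro: polyfun_mult\<close>)
      then have "g x * dinv k w x + w x * dinv k g x = 0"
        using dinv_mult[OF g(1) w dclosure_step.hyps(2) x] dclosure_step.hyps(2) by (simp add: dinv_const)
      then have "g x * (g x * dinv k w x + w x * dinv k g x) = 0" by simp
      moreover have "g x * (w x * dinv k g x) = 0" using g(3) x by auto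
      ultimately show ?thesis by (simp add: distrib_left mult.assoc)
    qed
    then show ?case using g by (intro bexI[of _ "\<lambda>x. g x * g x"]) (auto intro: polyfun_mult)
  qed
  then have "w x = 0" if "w \<in> dclosure f" "x \<in> G" "h x \<noteq> 0" for w x
    using that by (metis mult_eq_0_iff)
  then show ?thesis using h by blast
qed

end

locale connected_matrix_group = matrix_group_char_0 m G
  for m :: nat and G :: "'c::field_char_0 mat set" +
  assumes connected: "connectedin (zariski m) G"
begin

theorem flat_zero:
  assumes f: "f \<in> \<A>" and flat: "\<And>w. w \<in> dclosure f \<Longrightarrow> w unit = 0" and "x \<in> G"
  shows "f x = 0"
proof -
  define Y where "Y = {x \<in> G. \<forall>w\<in>dclosure f. w x = 0}"
  have "\<exists>h\<in>\<A>. h y \<noteq> 0 \<and> (\<forall>x\<in>G. h x \<noteq> 0 \<longrightarrow> x \<in> Y)" if y: "y \<in> Y" for y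
  proof -
    have yG: "y \<in> G" and y0: "\<And>w. w \<in> dclosure f \<Longrightarrow> w y = 0" using y by (auto simp: Y_def)
    let ?g = "\<lambda>x. f (x * y)"
    have "\<forall>w\<in>dclosure ?g. w unit = 0"
      using dclosure_translate(1)[OF f yG] y0 unit_in_G yG by (fastforce simp: unit_mult)
    then obtain h where h: "h \<in> \<A>" "h unit \<noteq> 0"
      and hz: "\<forall>w\<in>dclosure ?g. \<forall>x\<in>G. h x \<noteq> 0 \<longrightarrow> w x = 0"
      using flat_locally_zero[OF translate_right_regular[OF f yG]] by auto
    let ?y' = "invm m y"
    have y': "?y' \<in> G" using yG by simp
    have "x \<in> Y" if x: "x \<in> G" "h (x * ?y') \<noteq> 0" for x
    proof -
      have "v x = 0" if v: "v \<in> dclosure f" for v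
      proof -
        obtain w where w: "w \<in> dclosure ?g" "\<forall>x\<in>G. w x = v (x * y)"
          using dclosure_translate(2)[OF f yG v] by blast
        have "w (x * ?y') = 0" using hz w(1) mult_in_G[OF x(1) y'] x(2) by blast
        moreover have "x * ?y' * y = x"
          using x yG y' by (simp add: G_assoc invm_mult unit_mult)
        ultimately show ?thesis using w(2) mult_in_G[OF x(1) y'] by auto
      qed
      then show ?thesis using x by (simp add: Y_def)
    qed
    moreover have "h (y * ?y') \<noteq> 0" using h yG by (simp add: invm_mult)
    ultimately show ?thesis
      using translate_right_regular[OF h(1) y'] by (intro bexI[of _ "\<lambda>x. h (x * ?y')"]) auto
  qed
  \<comment> \<open>\<open>Y\<close> is open: its complement is the common zero set of the regular
    functions that are nonzero only at points of \<open>Y\<close>.\<close>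
  then have "G - Y = {x \<in> G. \<forall>h\<in>{h\<in>\<A>. \<forall>x\<in>G. h x \<noteq> 0 \<longrightarrow> x \<in> Y}. h x = 0}"
    by auto
  then have "closedin (zariski m) (G - Y)"
    using closedin_zeros[of "{h\<in>\<A>. \<forall>x\<in>G. h x \<noteq> 0 \<longrightarrow> x \<in> Y}"] by auto
  moreover have "closedin (zariski m) Y"
    unfolding Y_def by (rule closedin_zeros) (use dclosure_regular f in blast)
  moreover have "unit \<in> Y" using flat unit_in_G by (simp add: Y_def)
  moreover have "\<not> (closedin (zariski m) Y \<and> closedin (zariski m) (G - Y) \<and> G \<subseteq> Y \<union> (G - Y) \<and>
      Y \<inter> (G - Y) \<inter> G = {} \<and> Y \<inter> G \<noteq> {} \<and> (G - Y) \<inter> G \<noteq> {})"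
    using connected unfolding connectedin_closedin by blast
  ultimately have "G - Y = {}"
    using unit_in_G by blast
  then show ?thesis
    using \<open>x \<in> G\<close> dclosure_base[of f] by (auto simp: Y_def)
qed

end

section \<open>The derivation on \<open>F \<otimes> C[G]\<close>\<close>

context matrix_group_char_0
begin

abbreviation "\<kappa> \<equiv> (diff_rat_const :: 'c \<Rightarrow> 'c diff_rat)"

lemma const_sum: "\<kappa> (sum f I) = (\<Sum>i\<in>I. \<kappa> (f i))"
  by (induction I rule: infinite_finite_induct) (simp_all add: diff_rat_const_0 diff_rat_const_add)

abbreviation "\<F> \<equiv> polyfun G K (\<lambda>k x. \<kappa> (crd k x))"

lemma const_regular: "f \<in> \<A> \<Longrightarrow> (\<lambda>x. \<kappa> (f x)) \<in> \<F>"
proof (induction rule: polyfun.induct)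
  case (polyfun_coord k)
  then show ?case using polyfun.polyfun_coord[of k K "\<lambda>k x. \<kappa> (crd k x)" G] by simp
next
  case (polyfun_cong f g)
  show ?case by (rule polyfun.polyfun_cong[OF polyfun_cong.IH]) (use polyfun_cong in auto)
qed (auto simp: diff_rat_const_add diff_rat_const_mult intro: polyfun.intros)

definition const_fun :: "('c mat \<Rightarrow> 'c) \<Rightarrow> 'c mat \<Rightarrow> 'c diff_rat"
  where "const_fun a = (\<lambda>x. \<kappa> (a x))"

lemma fspan_const_fun_mult:
  assumes "f \<in> fspan (const_fun ` \<A>)" "g \<in> fspan (const_fun ` \<A>)"
  shows "(\<lambda>x. f x * g x) \<in> fspan (const_fun ` \<A>)"
proof -
  have 1: "(\<lambda>x. u x * g x) \<in> fspan (const_fun ` \<A>)" if u: "u \<in> const_fun ` \<A>" for u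
    using assms(2)
  proof induction
    case fspan_0
    show ?case using fspan.fspan_0 by simp
  next
    case (fspan_step f v a)
    obtain c d where "c \<in> \<A>" "u = const_fun c" "d \<in> \<A>" "v = const_fun d"
      using u fspan_step by blast
    then have "(\<lambda>x. u x * v x) \<in> const_fun ` \<A>"
      by (intro image_eqI[of _ _ "\<lambda>x. c x * d x"])
        (auto simp: const_fun_def diff_rat_const_mult intro: polyfun_mult)
    from fspan.fspan_step[OF fspan_step.IH this, of a] show ?case
      by (simp add: algebra_simps)
  qed
  show ?thesis
    using assms(1)
  proof induction
    case fspan_0
    show ?case using fspan.fspan_0 by simp
  next
    case (fspan_step f u a)
    from fspan_add[OF fspan_scale[OF 1[OF fspan_step.hyps(2)], of a] fspan_step.IH] show ?case
      by (simp add: algebra_simps)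
  qed
qed

lemma regular_fspan:
  assumes "f \<in> \<F>"
  shows "\<exists>g\<in>fspan (const_fun ` \<A>). \<forall>x\<in>G. f x = g x"
  using assms
proof induction
  case (polyfun_const z)
  have "const_fun (\<lambda>_. 1) \<in> fspan (const_fun ` \<A>)"
    by (intro fspan_incl imageI polyfun.polyfun_const)
  from fspan_scale[OF this, of z] show ?case
    by (intro bexI[of _ "\<lambda>x. z * const_fun (\<lambda>_. 1) x"]) (auto simp: const_fun_def diff_rat_const_1)
next
  case (polyfun_coord k)
  then have "const_fun (crd k) \<in> fspan (const_fun ` \<A>)"
    by (intro fspan_incl imageI polyfun.polyfun_coord)
  then show ?case by (rule rev_bexI) (simp add: const_fun_def)
next
  case (polyfun_add f g)
  then obtain f' g' where "f' \<in> fspan (const_fun ` \<A>)" "\<forall>x\<in>G. f x = f' x"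
    "g' \<in> fspan (const_fun ` \<A>)" "\<forall>x\<in>G. g x = g' x" by blast
  then show ?case by (intro bexI[of _ "\<lambda>x. f' x + g' x"] fspan_add) auto
next
  case (polyfun_mult f g)
  then obtain f' g' where "f' \<in> fspan (const_fun ` \<A>)" "\<forall>x\<in>G. f x = f' x"
    "g' \<in> fspan (const_fun ` \<A>)" "\<forall>x\<in>G. g x = g' x" by blast
  then show ?case by (intro bexI[of _ "\<lambda>x. f' x * g' x"] fspan_const_fun_mult) auto
next
  case (polyfun_cong f g)
  then show ?case by auto
qed

lemma fspan_finite: "f \<in> fspan S \<Longrightarrow> \<exists>T. finite T \<and> T \<subseteq> S \<and> f \<in> fspan T"
proof (induction rule: fspan.induct)
  case fspan_0
  show ?case by (rule exI[of _ "{}"]) (simp add: fspan.fspan_0)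
next
  case (fspan_step f u a)
  then obtain T where T: "finite T" "T \<subseteq> S" "f \<in> fspan T" by blast
  then have "(\<lambda>x. a * u x + f x) \<in> fspan (insert u T)"
    using fspan_mono[of T "insert u T"] by (intro fspan.fspan_step) auto
  then show ?case using T fspan_step by (intro exI[of _ "insert u T"]) auto
qed

text \<open>The finite set \<open>U\<close> may be enlarged, so that finitely many functions have a common \<open>P\<close>, \<open>b\<close>.\<close>

lemma regular_interpolate:
  assumes "f \<in> \<F>"
  shows "\<exists>U. finite U \<and> U \<subseteq> \<A> \<and> (\<forall>P b. interpolates G U P b \<longrightarrow>
    (\<forall>x\<in>G. f x = (\<Sum>p\<in>P. f p * \<kappa> (b p x))))"
proof -
  obtain g where g: "g \<in> fspan (const_fun ` \<A>)" "\<forall>x\<in>G. f x = g x"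
    using regular_fspan[OF assms] by blast
  obtain T where T: "finite T" "T \<subseteq> const_fun ` \<A>" "g \<in> fspan T"
    using fspan_finite[OF g(1)] by blast
  obtain U where U: "U \<subseteq> \<A>" "finite U" "T = const_fun ` U"
    using finite_subset_image[OF T(1,2)] by blast
  have "f x = (\<Sum>p\<in>P. f p * \<kappa> (b p x))" if P: "interpolates G U P b" and x: "x \<in> G" for P b x
  proof -
    have "g x = (\<Sum>p\<in>P. g p * \<kappa> (b p x))"
      using T(3)
    proof induction
      case (fspan_step h u a)
      then obtain c where c: "c \<in> U" "u = const_fun c" using U(3) by blast
      then have "c x = (\<Sum>p\<in>P. c p * b p x)" using P x by (simp add: interpolates_def)
      then have "u x = (\<Sum>p\<in>P. u p * \<kappa> (b p x))"
        by (simp add: c const_fun_def const_sum diff_rat_const_mult)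
      then show ?case
        using fspan_step.IH by (simp add: distrib_right sum.distrib sum_distrib_left mult.assoc)
    qed simp
    moreover have "(\<Sum>p\<in>P. f p * \<kappa> (b p x)) = (\<Sum>p\<in>P. g p * \<kappa> (b p x))"
      using P g(2) by (intro sum.cong) (auto simp: interpolates_def)
    ultimately show ?thesis using g(2) x by simp
  qed
  then show ?thesis using U by blast
qed

text \<open>This says that \<open>f\<close> is the tensor with summands
  \<open>z i \<otimes> a i\<close>. The index type is free because sums and products of
  representations are indexed by disjoint unions and by pairs.\<close>

definition represents :: "('c mat \<Rightarrow> 'c diff_rat) \<Rightarrow> 'i set \<Rightarrow> ('i \<Rightarrow> 'c diff_rat) \<Rightarrow> ('i \<Rightarrow> 'c mat \<Rightarrow> 'c) \<Rightarrow> bool"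
  where "represents f I z a \<longleftrightarrow> finite I \<and> (\<forall>i\<in>I. a i \<in> \<A>) \<and>
    (\<forall>x\<in>G. f x = (\<Sum>i\<in>I. z i * \<kappa> (a i x)))"

lemma ex_represents:
  assumes "f \<in> \<F>"
  shows "\<exists>P (b :: 'c mat \<Rightarrow> 'c mat \<Rightarrow> 'c). represents f P f b"
proof -
  obtain U where U: "finite U" "U \<subseteq> \<A>" and rep: "\<forall>P b. interpolates G U P b \<longrightarrow>
    (\<forall>x\<in>G. f x = (\<Sum>p\<in>P. f p * \<kappa> (b p x)))"
    using regular_interpolate[OF assms] by blast
  obtain P b where P: "interpolates G (fspan U) P b" "\<And>p. p \<in> P \<Longrightarrow> b p \<in> fspan U"
    by (rule ex_interpolates[OF U(1), of G], rule that)
  have "interpolates G U P b"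
    using P(1) fspan_incl[of _ U] by (simp add: interpolates_def)
  moreover have "b p \<in> \<A>" if "p \<in> P" for p
    using P(2)[OF that] fspan_mono[OF U(2)] fspan_regular by blast
  ultimately show ?thesis
    using rep P(1) unfolding represents_def interpolates_def by blast
qed

lemma represents_regular: "represents f I z a \<Longrightarrow> f \<in> \<F>"
  by (rule polyfun_cong[of "\<lambda>x. \<Sum>i\<in>I. z i * \<kappa> (a i x)"], intro polyfun_sum polyfun_scale const_regular)
    (auto simp: represents_def)

lemma represents_translate:
  "represents f I z a \<Longrightarrow> y \<in> G \<Longrightarrow> represents (\<lambda>x. f (x * y)) I z (\<lambda>i x. a i (x * y))"
  by (auto simp: represents_def translate_right_regular)

lemma represents_add:
  assumes "represents f I z a" "represents g J w b"
  shows "represents (\<lambda>x. f x + g x) (I <+> J) (case_sum z w) (case_sum a b)"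
  using assms by (auto simp: represents_def sum.Plus)

lemma represents_mult:
  assumes "represents f I z a" "represents g J w b"
  shows "represents (\<lambda>x. f x * g x) (I \<times> J) (\<lambda>(i, j). z i * w j) (\<lambda>(i, j) x. a i x * b j x)"
  using assms
  by (auto simp: represents_def polyfun_mult sum_product sum.cartesian_product case_prod_beta
      diff_rat_const_mult ac_simps intro!: sum.cong)

text \<open>The value of \<open>\<Sum>\<^sub>k t\<^sub>1^(k+1) D\<^sub>k\<close> at the unit.\<close>

definition tau :: "('c mat \<Rightarrow> 'c) \<Rightarrow> 'c diff_rat"
  where "tau a = (\<Sum>k\<in>B. tpow k * \<kappa> (dpt k a))"

lemma tau_sum:
  assumes "finite I" "\<And>i. i \<in> I \<Longrightarrow> a i \<in> \<A>" "\<And>x. x \<in> G \<Longrightarrow> f x = (\<Sum>i\<in>I. c i * a i x)"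
  shows "tau f = (\<Sum>i\<in>I. \<kappa> (c i) * tau (a i))"
proof -
  have "dpt k f = (\<Sum>i\<in>I. c i * dpt k (a i))" if "k \<in> B" for k
  proof -
    have "dpt k f = dpt k (\<lambda>x. \<Sum>i\<in>I. c i * a i x)"
      by (rule dpt_cong[symmetric], intro polyfun_sum polyfun_scale) (use assms that in auto)
    also have "\<dots> = (\<Sum>i\<in>I. dpt k (\<lambda>x. c i * a i x))"
      by (rule dpt_sum) (use assms that in \<open>auto intro: polyfun_scale\<close>)
    finally show ?thesis using assms that by (simp add: dpt_scale)
  qed
  then have "tau f = (\<Sum>k\<in>B. \<Sum>i\<in>I. tpow k * \<kappa> (c i * dpt k (a i)))"
    by (simp add: tau_def const_sum sum_distrib_left)
  also have "\<dots> = (\<Sum>i\<in>I. \<Sum>k\<in>B. tpow k * \<kappa> (c i * dpt k (a i)))"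
    by (rule sum.swap)
  finally show ?thesis
    by (simp add: tau_def sum_distrib_left diff_rat_const_mult ac_simps)
qed

text \<open>The \<open>F\<close>-linear extension of \<open>tau\<close> is well defined:
  interpolating all \<open>a i\<close> and \<open>b j\<close> by common functions
  \<open>e p\<close>, both sides become the sum of \<open>f p * tau (e p)\<close>, which depends on
  \<open>f\<close> only.\<close>

lemma represents_tau_unique:
  assumes "represents f I z a" "represents f J w b"
  shows "(\<Sum>i\<in>I. z i * tau (a i)) = (\<Sum>j\<in>J. w j * tau (b j))"
proof -
  let ?U = "a ` I \<union> b ` J"
  have U: "finite ?U" "?U \<subseteq> \<A>" using assms by (auto simp: represents_def)
  obtain P e where P: "interpolates G (fspan ?U) P e" "\<And>p. p \<in> P \<Longrightarrow> e p \<in> fspan ?U"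
    by (rule ex_interpolates[OF U(1), of G], rule that)
  have e: "e p \<in> \<A>" if "p \<in> P" for p
    using P(2)[OF that] fspan_mono[OF U(2)] fspan_regular by blast
  have 1: "tau u = (\<Sum>p\<in>P. \<kappa> (u p) * tau (e p))" if "u \<in> ?U" for u
    by (rule tau_sum) (use P(1) e fspan_incl[OF that] in \<open>auto simp: interpolates_def\<close>)
  have *: "(\<Sum>i\<in>L. v i * tau (c i)) = (\<Sum>p\<in>P. f p * tau (e p))"
    if "represents f L v c" "c ` L \<subseteq> ?U" for L v and c :: "'l \<Rightarrow> 'c mat \<Rightarrow> 'c"
  proof -
    have "(\<Sum>i\<in>L. v i * tau (c i)) = (\<Sum>i\<in>L. \<Sum>p\<in>P. v i * \<kappa> (c i p) * tau (e p))"
      using that(2) by (intro sum.cong refl) (auto simp: 1 sum_distrib_left mult.assoc)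
    also have "\<dots> = (\<Sum>p\<in>P. \<Sum>i\<in>L. v i * \<kappa> (c i p) * tau (e p))"
      by (rule sum.swap)
    also have "\<dots> = (\<Sum>p\<in>P. f p * tau (e p))"
      using that(1) P(1) by (intro sum.cong refl)
        (auto simp: represents_def interpolates_def subset_iff sum_distrib_right)
    finally show ?thesis .
  qed
  show ?thesis using *[OF assms(1)] *[OF assms(2)] by simp
qed

text \<open>The \<open>F\<close>-linear extension of \<open>tau\<close>. The choice ranges over
  representations indexed by points with \<open>f\<close> itself as coefficients, which fixes the
  index type; \<open>tauF_eq\<close> then admits any representation.\<close>

definition tauF :: "('c mat \<Rightarrow> 'c diff_rat) \<Rightarrow> 'c diff_rat"
  where "tauF f = (SOME w. \<exists>P (b :: 'c mat \<Rightarrow> 'c mat \<Rightarrow> 'c). represents f P f b \<and>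
    w = (\<Sum>p\<in>P. f p * tau (b p)))"

lemma tauF_eq:
  assumes "represents f I z a"
  shows "tauF f = (\<Sum>i\<in>I. z i * tau (a i))"
proof -
  obtain Q and e :: "'c mat \<Rightarrow> 'c mat \<Rightarrow> 'c" where "represents f Q f e"
    using ex_represents[OF represents_regular[OF assms]] by blast
  then have "\<exists>w P (b :: 'c mat \<Rightarrow> 'c mat \<Rightarrow> 'c). represents f P f b \<and> w = (\<Sum>p\<in>P. f p * tau (b p))"
    by (intro exI[of _ "\<Sum>p\<in>Q. f p * tau (e p)"] exI[of _ Q] exI[of _ e] conjI refl)
  then have "\<exists>P (b :: 'c mat \<Rightarrow> 'c mat \<Rightarrow> 'c). represents f P f b \<and> tauF f = (\<Sum>p\<in>P. f p * tau (b p))"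
    unfolding tauF_def by (rule someI_ex)
  then obtain P and b :: "'c mat \<Rightarrow> 'c mat \<Rightarrow> 'c"
    where "represents f P f b" and eq: "tauF f = (\<Sum>p\<in>P. f p * tau (b p))"
    by (elim exE conjE)
  from represents_tau_unique[OF assms this(1)] show ?thesis
    using eq by simp
qed

lemma tauF_add:
  assumes "f \<in> \<F>" "g \<in> \<F>"
  shows "tauF (\<lambda>x. f x + g x) = tauF f + tauF g"
proof -
  obtain P and b :: "'c mat \<Rightarrow> 'c mat \<Rightarrow> 'c" where f: "represents f P f b"
    using ex_represents[OF assms(1)] by blast
  obtain Q and e :: "'c mat \<Rightarrow> 'c mat \<Rightarrow> 'c" where g: "represents g Q g e"
    using ex_represents[OF assms(2)] by blast
  have "finite P" "finite Q" using f g by (auto simp: represents_def)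
  then show ?thesis
    by (simp add: tauF_eq[OF f] tauF_eq[OF g] tauF_eq[OF represents_add[OF f g]] sum.Plus)
qed

lemma tau_mult:
  assumes "a \<in> \<A>" "b \<in> \<A>"
  shows "tau (\<lambda>x. a x * b x) = \<kappa> (a unit) * tau b + \<kappa> (b unit) * tau a"
  using assms
  by (simp add: tau_def dpt_mult diff_rat_const_add diff_rat_const_mult sum_distrib_left
      distrib_left sum.distrib ac_simps)

lemma tauF_mult:
  assumes "f \<in> \<F>" "g \<in> \<F>"
  shows "tauF (\<lambda>x. f x * g x) = f unit * tauF g + g unit * tauF f"
proof -
  obtain P and b :: "'c mat \<Rightarrow> 'c mat \<Rightarrow> 'c" where f: "represents f P f b"
    using ex_represents[OF assms(1)] by blast
  obtain Q and e :: "'c mat \<Rightarrow> 'c mat \<Rightarrow> 'c" where g: "represents g Q g e"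
    using ex_represents[OF assms(2)] by blast
  have b: "b p \<in> \<A>" if "p \<in> P" for p using f that by (simp add: represents_def)
  have e: "e q \<in> \<A>" if "q \<in> Q" for q using g that by (simp add: represents_def)
  have fu: "f unit = (\<Sum>p\<in>P. f p * \<kappa> (b p unit))" and gu: "g unit = (\<Sum>q\<in>Q. g q * \<kappa> (e q unit))"
    using f g unit_in_G by (auto simp: represents_def)
  have "tauF (\<lambda>x. f x * g x) = (\<Sum>p\<in>P. \<Sum>q\<in>Q. f p * g q * tau (\<lambda>x. b p x * e q x))"
    by (simp add: tauF_eq[OF represents_mult[OF f g]] sum.cartesian_product case_prod_beta)
  also have "\<dots> = (\<Sum>p\<in>P. \<Sum>q\<in>Q. f p * \<kappa> (b p unit) * (g q * tau (e q)) +
      g q * \<kappa> (e q unit) * (f p * tau (b p)))"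
    by (intro sum.cong refl) (simp add: tau_mult b e algebra_simps)
  also have "\<dots> = f unit * tauF g + g unit * tauF f"
    unfolding fu gu tauF_eq[OF f] tauF_eq[OF g] sum.distrib sum_product
    by (subst (3) sum.swap) (rule refl)
  finally show ?thesis .
qed

lemma tauF_cong:
  assumes "f \<in> \<F>" "\<And>x. x \<in> G \<Longrightarrow> f x = g x"
  shows "tauF f = tauF g"
proof -
  obtain P and b :: "'c mat \<Rightarrow> 'c mat \<Rightarrow> 'c" where f: "represents f P f b"
    using ex_represents[OF assms(1)] by blast
  moreover have "represents g P f b"
    using f assms(2) by (simp add: represents_def)
  ultimately show ?thesis by (simp add: tauF_eq)
qed

text \<open>In terms of tensors, \<open>z \<otimes> a\<close> goes to \<open>z' \<otimes> a\<close>
  plus \<open>z\<close> times the combined invariant field applied to \<open>a\<close>. Since points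
  of \<open>G\<close> have coordinates in \<open>C\<close>, the first summand is the derivative of
  the value at \<open>y\<close>.\<close>

definition delta :: "('c mat \<Rightarrow> 'c diff_rat) \<Rightarrow> 'c mat \<Rightarrow> 'c diff_rat"
  where "delta f y = diff_rat_deriv (f y) + tauF (\<lambda>x. f (x * y))"

lemma translate_right_regularF: "f \<in> \<F> \<Longrightarrow> y \<in> G \<Longrightarrow> (\<lambda>x. f (x * y)) \<in> \<F>"
  using ex_represents represents_translate represents_regular by blast

lemma delta_add:
  "f \<in> \<F> \<Longrightarrow> g \<in> \<F> \<Longrightarrow> y \<in> G \<Longrightarrow> delta (\<lambda>x. f x + g x) y = delta f y + delta g y"
  by (simp add: delta_def tauF_add translate_right_regularF diff_rat_deriv_add)

lemma delta_mult:
  "f \<in> \<F> \<Longrightarrow> g \<in> \<F> \<Longrightarrow> y \<in> G \<Longrightarrow> delta (\<lambda>x. f x * g x) y = delta f y * g y + f y * delta g y"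
  by (simp add: delta_def tauF_mult translate_right_regularF diff_rat_deriv_mult unit_mult algebra_simps)

lemma delta_cong:
  "f \<in> \<F> \<Longrightarrow> (\<And>x. x \<in> G \<Longrightarrow> f x = g x) \<Longrightarrow> y \<in> G \<Longrightarrow> delta f y = delta g y"
  using tauF_cong[OF translate_right_regularF, of f y "\<lambda>x. g (x * y)"] by (simp add: delta_def)

definition Tau :: "('c mat \<Rightarrow> 'c) \<Rightarrow> 'c mat \<Rightarrow> 'c diff_rat"
  where "Tau a y = (\<Sum>k\<in>B. tpow k * \<kappa> (dinv k a y))"

lemma delta_represents:
  assumes "represents f I z a" "y \<in> G"
  shows "delta f y = diff_rat_deriv (f y) + (\<Sum>i\<in>I. z i * Tau (a i) y)"
  using tauF_eq[OF represents_translate[OF assms]]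
  by (simp add: delta_def Tau_def tau_def dinv_def)

lemma Tau_regular: "a \<in> \<A> \<Longrightarrow> Tau a \<in> \<F>"
  unfolding Tau_def[abs_def] by (intro polyfun_sum polyfun_scale const_regular dinv_regular)

lemma deriv_0: "diff_rat_deriv 0 = 0" and deriv_1: "diff_rat_deriv 1 = 0"
  using derivation_0[OF derivation_diff_rat_deriv] derivation_1[OF derivation_diff_rat_deriv] by auto

lemma delta_regular:
  assumes "f \<in> \<F>"
  shows "delta f \<in> \<F>"
proof -
  obtain P and b :: "'c mat \<Rightarrow> 'c mat \<Rightarrow> 'c" where f: "represents f P f b"
    using ex_represents[OF assms] by blast
  have b: "b p \<in> \<A>" if "p \<in> P" for p using f that by (simp add: represents_def)
  have "(\<lambda>y. (\<Sum>p\<in>P. diff_rat_deriv (f p) * \<kappa> (b p y)) + (\<Sum>p\<in>P. f p * Tau (b p) y)) \<in> \<F>"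
    by (intro polyfun_add polyfun_sum polyfun_scale const_regular Tau_regular b)
  then show ?thesis
  proof (rule polyfun_cong)
    fix y assume y: "y \<in> G"
    then have "f y = (\<Sum>p\<in>P. f p * \<kappa> (b p y))" using f by (simp add: represents_def)
    then have "diff_rat_deriv (f y) = diff_rat_deriv (\<Sum>p\<in>P. f p * \<kappa> (b p y))" by simp
    also have "\<dots> = (\<Sum>p\<in>P. diff_rat_deriv (f p) * \<kappa> (b p y))"
      by (simp add: derivation_sum[OF derivation_diff_rat_deriv] diff_rat_deriv_mult)
    finally show "delta f y = (\<Sum>p\<in>P. diff_rat_deriv (f p) * \<kappa> (b p y)) + (\<Sum>p\<in>P. f p * Tau (b p) y)"
      using delta_represents[OF f y] by simp
  qed
qed

lemma delta_const: "y \<in> G \<Longrightarrow> delta (\<lambda>_. z) y = diff_rat_deriv z"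
  using delta_represents[of "\<lambda>_. z" "{()}" "\<lambda>_. z" "\<lambda>_ _. 1" y]
  by (simp add: represents_def polyfun_const diff_rat_const_1 Tau_def dinv_const diff_rat_const_0)

lemma delta_const_fun: "a \<in> \<A> \<Longrightarrow> y \<in> G \<Longrightarrow> delta (\<lambda>x. \<kappa> (a x)) y = Tau a y"
  using delta_represents[of "\<lambda>x. \<kappa> (a x)" "{()}" "\<lambda>_. 1" "\<lambda>_. a" y]
  by (simp add: represents_def)

section \<open>Differential simplicity\<close>

lemma const_diff: "\<kappa> (a - b) = \<kappa> a - \<kappa> b"
  using diff_rat_const_add[of "a - b" b] by simp

section \<open>Finite-dimensional spaces stable under the invariant derivations\<close>

text \<open>The left translates \<open>y \<mapsto> a (p * y)\<close> from local finiteness span a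
  stable space: an invariant field acts on one of them through \<open>x\<close> in
  \<open>a (q * x * y)\<close>, and this is a combination of the \<open>a (p * y)\<close> with
  coefficients \<open>b p (q * x)\<close>.\<close>

lemma ex_invariant_fspan_single:
  assumes a: "a \<in> \<A>"
  shows "\<exists>V. finite V \<and> V \<subseteq> \<A> \<and> (\<exists>v\<in>fspan V. \<forall>x\<in>G. a x = v x) \<and>
    (\<forall>v\<in>V. \<forall>k\<in>B. \<exists>w\<in>fspan V. \<forall>y\<in>G. dinv k v y = w y)"
proof -
  obtain P b where P: "finite P" "P \<subseteq> G" "\<And>p. p \<in> P \<Longrightarrow> b p \<in> \<A>"
    and ab: "\<And>x y. x \<in> G \<Longrightarrow> y \<in> G \<Longrightarrow> a (x * y) = (\<Sum>p\<in>P. a (p * y) * b p x)"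
    by (rule mult_interpolate[OF a], rule that)
  define V where "V = (\<lambda>p y. a (p * y)) ` P"
  have V: "(\<lambda>y. a (p * y)) \<in> fspan V" if "p \<in> P" for p
    unfolding V_def using that by (intro fspan_incl) auto
  have comb: "(\<lambda>y. \<Sum>p\<in>P. c p * a (p * y)) \<in> fspan V" for c
    by (intro fspan_sum fspan_scale V)
  show ?thesis
  proof (intro exI[of _ V] conjI ballI)
    show "finite V" "V \<subseteq> \<A>"
      unfolding V_def using P a by (auto intro: translate_left_regular)
    have "a y = (\<Sum>p\<in>P. b p unit * a (p * y))" if "y \<in> G" for y
      using ab[OF unit_in_G that] that by (simp add: unit_mult mult.commute)
    then show "\<exists>v\<in>fspan V. \<forall>x\<in>G. a x = v x"
      using comb[of "\<lambda>p. b p unit"] by (intro bexI[of _ "\<lambda>y. \<Sum>p\<in>P. b p unit * a (p * y)"]) auto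
  next
    fix v k assume v: "v \<in> V" and k: "k \<in> B"
    obtain q where q: "q \<in> P" and v_eq: "v = (\<lambda>y. a (q * y))" using v by (auto simp: V_def)
    have qG: "q \<in> G" using q P by blast
    have "dinv k v y = (\<Sum>p\<in>P. dpt k (\<lambda>x. b p (q * x)) * a (p * y))" if y: "y \<in> G" for y
    proof -
      have "dinv k v y = dpt k (\<lambda>x. \<Sum>p\<in>P. a (p * y) * b p (q * x))"
        unfolding dinv_def v_eq
      proof (rule dpt_cong[symmetric])
        show "(\<lambda>x. \<Sum>p\<in>P. a (p * y) * b p (q * x)) \<in> \<A>"
          by (intro polyfun_sum polyfun_scale translate_left_regular P(3) qG)
        show "(\<Sum>p\<in>P. a (p * y) * b p (q * x)) = a (q * (x * y))" if "x \<in> G" for x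
          using ab[OF mult_in_G[OF qG that] y] G_assoc[OF qG that y] by simp
      qed (rule k)
      also have "\<dots> = (\<Sum>p\<in>P. dpt k (\<lambda>x. a (p * y) * b p (q * x)))"
        by (rule dpt_sum) (use P qG k in \<open>auto intro!: polyfun_scale translate_left_regular\<close>)
      also have "\<dots> = (\<Sum>p\<in>P. a (p * y) * dpt k (\<lambda>x. b p (q * x)))"
        by (intro sum.cong refl dpt_scale translate_left_regular P(3) qG k)
      finally show ?thesis by (simp add: mult.commute)
    qed
    then show "\<exists>w\<in>fspan V. \<forall>y\<in>G. dinv k v y = w y"
      using comb[of "\<lambda>p. dpt k (\<lambda>x. b p (q * x))"] by (intro bexI) auto
  qed
qed

lemma ex_invariant_fspan:
  assumes "finite U" "U \<subseteq> \<A>"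
  shows "\<exists>V. finite V \<and> V \<subseteq> \<A> \<and> (\<forall>u\<in>U. \<exists>v\<in>fspan V. \<forall>x\<in>G. u x = v x) \<and>
    (\<forall>v\<in>V. \<forall>k\<in>B. \<exists>w\<in>fspan V. \<forall>y\<in>G. dinv k v y = w y)"
  using assms
proof induction
  case empty
  show ?case by (rule exI[of _ "{}"]) auto
next
  case (insert u U)
  then obtain V where V: "finite V" "V \<subseteq> \<A>" "\<forall>u\<in>U. \<exists>v\<in>fspan V. \<forall>x\<in>G. u x = v x"
    "\<forall>v\<in>V. \<forall>k\<in>B. \<exists>w\<in>fspan V. \<forall>y\<in>G. dinv k v y = w y"
    by auto
  obtain W where W: "finite W" "W \<subseteq> \<A>" "\<exists>v\<in>fspan W. \<forall>x\<in>G. u x = v x"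
    "\<forall>v\<in>W. \<forall>k\<in>B. \<exists>w\<in>fspan W. \<forall>y\<in>G. dinv k v y = w y"
    using ex_invariant_fspan_single[of u] insert.prems by auto
  note mono = fspan_mono[OF Un_upper1[of V W]] fspan_mono[OF Un_upper2[of W V]]
  show ?case
  proof (intro exI[of _ "V \<union> W"] conjI ballI)
    fix u' assume "u' \<in> insert u U"
    then show "\<exists>v\<in>fspan (V \<union> W). \<forall>x\<in>G. u' x = v x"
      using V(3) W(3) mono by blast
  next
    fix v k assume "v \<in> V \<union> W" "k \<in> B"
    then show "\<exists>w\<in>fspan (V \<union> W). \<forall>y\<in>G. dinv k v y = w y"
      using V(4) W(4) mono by blast
  qed (use V W in auto)
qed

lemma ex_invariant_interpolation:
  assumes "finite U" "U \<subseteq> \<A>"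
  obtains H b where "interpolates G U H b" "\<And>h. h \<in> H \<Longrightarrow> b h \<in> \<A>"
    "\<And>h k y. h \<in> H \<Longrightarrow> k \<in> B \<Longrightarrow> y \<in> G \<Longrightarrow> dinv k (b h) y = (\<Sum>q\<in>H. dinv k (b h) q * b q y)"
proof -
  obtain V where V: "finite V" "V \<subseteq> \<A>" and U: "\<forall>u\<in>U. \<exists>v\<in>fspan V. \<forall>x\<in>G. u x = v x"
    and DV: "\<forall>v\<in>V. \<forall>k\<in>B. \<exists>w\<in>fspan V. \<forall>y\<in>G. dinv k v y = w y"
    using ex_invariant_fspan[OF assms] by blast
  obtain H b where H: "interpolates G (fspan V) H b" and b: "\<And>h. h \<in> H \<Longrightarrow> b h \<in> fspan V"
    by (rule ex_interpolates[OF V(1), of G], rule that)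
  have H1: "H \<subseteq> G" using H by (simp add: interpolates_def)
  have fs: "fspan V \<subseteq> \<A>" using fspan_mono[OF V(2)] by (simp add: fspan_regular)
  have D: "\<exists>w'\<in>fspan V. \<forall>y\<in>G. dinv k w y = w' y" if w: "w \<in> fspan V" and k: "k \<in> B" for w k
    using w
  proof induction
    case fspan_0
    show ?case using k by (intro bexI[of _ "\<lambda>_. 0"] fspan.fspan_0) (simp add: dinv_const)
  next
    case (fspan_step f u c)
    obtain f' where f': "f' \<in> fspan V" "\<forall>y\<in>G. dinv k f y = f' y" using fspan_step.IH by blast
    obtain u' where u': "u' \<in> fspan V" "\<forall>y\<in>G. dinv k u y = u' y"
      using DV fspan_step.hyps(2) k by blast
    have "u \<in> \<A>" "f \<in> \<A>" using fspan_step V fs by auto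
    then have "dinv k (\<lambda>x. c * u x + f x) y = c * u' y + f' y" if "y \<in> G" for y
      using that k f' u' by (simp add: dinv_add dinv_scale polyfun_scale)
    then show ?case using f' u' by (intro bexI[of _ "\<lambda>y. c * u' y + f' y"] fspan_add fspan_scale) auto
  qed
  show thesis
  proof (rule that[of H b])
    show "interpolates G U H b"
      unfolding interpolates_def
    proof (intro conjI ballI)
      fix u x assume "u \<in> U" "x \<in> G"
      then obtain v where v: "v \<in> fspan V" "\<forall>x\<in>G. u x = v x" using U by blast
      then have "u x = (\<Sum>p\<in>H. v p * b p x)" using \<open>x \<in> G\<close> H by (simp add: interpolates_def)
      also have "\<dots> = (\<Sum>p\<in>H. u p * b p x)" using v H1 by (intro sum.cong) auto
      finally show "u x = (\<Sum>p\<in>H. u p * b p x)" .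
    qed (use H in \<open>auto simp: interpolates_def\<close>)
    show "b h \<in> \<A>" if "h \<in> H" for h using b[OF that] fs by blast
    fix h k y assume h: "h \<in> H" and k: "k \<in> B" and y: "y \<in> G"
    obtain w where w: "w \<in> fspan V" "\<forall>y\<in>G. dinv k (b h) y = w y" using D[OF b[OF h] k] by blast
    then have "dinv k (b h) y = (\<Sum>p\<in>H. w p * b p y)" using y H by (simp add: interpolates_def)
    also have "\<dots> = (\<Sum>p\<in>H. dinv k (b h) p * b p y)" using w H1 by (intro sum.cong) auto
    finally show "dinv k (b h) y = (\<Sum>p\<in>H. dinv k (b h) p * b p y)" .
  qed
qed

end

text \<open>The span of the functions \<open>b h\<close> is stable under the invariant derivations.\<close>

locale invariant_space = matrix_group_char_0 m G
  for m :: nat and G :: "'c::field_char_0 mat set" +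
  fixes H :: "'c mat set" and b :: "'c mat \<Rightarrow> 'c mat \<Rightarrow> 'c"
  assumes finite_H: "finite H" and H_G: "H \<subseteq> G"
    and b_dual: "\<forall>p\<in>H. \<forall>q\<in>H. b p q = (if p = q then 1 else 0)"
    and b_regular: "h \<in> H \<Longrightarrow> b h \<in> \<A>"
    and dinv_b: "h \<in> H \<Longrightarrow> k \<in> B \<Longrightarrow> y \<in> G \<Longrightarrow> dinv k (b h) y = (\<Sum>q\<in>H. dinv k (b h) q * b q y)"
begin

definition space :: "('c mat \<Rightarrow> 'c diff_rat) set"
  where "space = {w. \<forall>x\<in>G. w x = (\<Sum>h\<in>H. w h * \<kappa> (b h x))}"

lemma spaceI:
  assumes "\<And>x. x \<in> G \<Longrightarrow> w x = (\<Sum>h\<in>H. c h * \<kappa> (b h x))"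
  shows "w \<in> space"
proof -
  have "\<forall>p\<in>H. \<forall>q\<in>H. \<kappa> (b p q) = (if p = q then 1 else 0)"
    using b_dual by (simp add: diff_rat_const_0 diff_rat_const_1)
  from interpolates_combination[OF finite_H this H_G assms] show ?thesis
    by (simp add: space_def)
qed

lemma space_represents: "w \<in> space \<Longrightarrow> represents w H w b"
  by (simp add: represents_def space_def finite_H b_regular)

lemma delta_space:
  "w \<in> space \<Longrightarrow> y \<in> G \<Longrightarrow> delta w y = diff_rat_deriv (w y) + (\<Sum>h\<in>H. w h * Tau (b h) y)"
  by (rule delta_represents[OF space_represents])

lemma Tau_b:
  assumes "h \<in> H" "y \<in> G"
  shows "Tau (b h) y = (\<Sum>q\<in>H. Tau (b h) q * \<kappa> (b q y))"
proof -
  have "Tau (b h) y = (\<Sum>k\<in>B. \<Sum>q\<in>H. tpow k * \<kappa> (dinv k (b h) q * b q y))"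
    unfolding Tau_def using assms
    by (intro sum.cong refl) (simp add: dinv_b[of h _ y] const_sum sum_distrib_left)
  also have "\<dots> = (\<Sum>q\<in>H. \<Sum>k\<in>B. tpow k * \<kappa> (dinv k (b h) q * b q y))"
    by (rule sum.swap)
  finally show ?thesis
    by (simp add: Tau_def sum_distrib_right diff_rat_const_mult mult.assoc)
qed

lemma delta_in_space:
  assumes w: "w \<in> space"
  shows "delta w \<in> space"
proof (rule spaceI)
  fix y assume y: "y \<in> G"
  have wy: "w y = (\<Sum>h\<in>H. w h * \<kappa> (b h y))" using w y by (simp add: space_def)
  have "diff_rat_deriv (w y) = (\<Sum>h\<in>H. diff_rat_deriv (w h) * \<kappa> (b h y))"
    by (subst wy) (simp add: derivation_sum[OF derivation_diff_rat_deriv] diff_rat_deriv_mult)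
  moreover have "(\<Sum>h\<in>H. w h * Tau (b h) y) = (\<Sum>q\<in>H. (\<Sum>h\<in>H. w h * Tau (b h) q) * \<kappa> (b q y))"
  proof -
    have "(\<Sum>h\<in>H. w h * Tau (b h) y) = (\<Sum>h\<in>H. \<Sum>q\<in>H. w h * Tau (b h) q * \<kappa> (b q y))"
      using y by (intro sum.cong refl) (simp add: Tau_b[of _ y] sum_distrib_left mult.assoc)
    also have "\<dots> = (\<Sum>q\<in>H. \<Sum>h\<in>H. w h * Tau (b h) q * \<kappa> (b q y))"
      by (rule sum.swap)
    finally show ?thesis by (simp add: sum_distrib_right)
  qed
  ultimately show "delta w y =
      (\<Sum>q\<in>H. (diff_rat_deriv (w q) + (\<Sum>h\<in>H. w h * Tau (b h) q)) * \<kappa> (b q y))"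
    using delta_space[OF w y] by (simp add: distrib_right sum.distrib)
qed

text \<open>Only \<open>t\<^sub>1\<close> itself occurs in \<open>Tau a y\<close>, none of its
  derivatives. So the differential equations for coefficients below have right-hand sides of no
  higher order than their unknowns.\<close>

lemma Tau_order_less: "Tau a y \<in> order_less (Suc N)"
  unfolding Tau_def by (intro order_less_sum order_less_mult tpow_order_less order_less_const)

lemma space_const:
  assumes "w \<in> space" "\<forall>h\<in>H. w h = \<kappa> (c h)"
  defines "s \<equiv> \<lambda>x. \<Sum>h\<in>H. c h * b h x"
  shows "s \<in> \<A>" "\<And>x. x \<in> G \<Longrightarrow> w x = \<kappa> (s x)" "\<And>y. y \<in> G \<Longrightarrow> delta w y = Tau s y"
proof -
  show s: "s \<in> \<A>" unfolding s_def by (intro polyfun_sum polyfun_scale b_regular)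
  show w: "w x = \<kappa> (s x)" if "x \<in> G" for x
    using assms that by (simp add: space_def s_def const_sum diff_rat_const_mult)
  show "delta w y = Tau s y" if "y \<in> G" for y
  proof -
    have "delta (\<lambda>x. \<kappa> (s x)) y = delta w y"
      by (rule delta_cong[OF const_regular[OF s]]) (use w that in auto)
    then show ?thesis using delta_const_fun[OF s that] by simp
  qed
qed

end

context connected_matrix_group
begin

lemma dinv_0_const:
  assumes s: "s \<in> \<A>" and D: "\<And>k y. k \<in> B \<Longrightarrow> y \<in> G \<Longrightarrow> dinv k s y = 0" and x: "x \<in> G"
  shows "s x = s unit"
proof -
  let ?g = "\<lambda>x. s x - s unit"
  have g: "?g \<in> \<A>" by (intro polyfun_diff polyfun_const s)
  have "w unit = 0 \<and> (\<forall>k\<in>B. \<forall>y\<in>G. dinv k w y = 0)" if "w \<in> dclosure ?g" for w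
    using that
  proof induction
    case dclosure_base
    show ?case using dinv_diff[OF s polyfun_const] D by (simp add: dinv_const)
  next
    case (dclosure_step w k)
    have "dinv k w \<in> \<A>" using dclosure_step dclosure_regular[OF _ g] dinv_regular by blast
    then have "dinv j (dinv k w) y = 0" if "j \<in> B" "y \<in> G" for j y
      using dinv_cong[of "dinv k w" "\<lambda>_. 0" j y] dclosure_step that by (simp add: dinv_const)
    then show ?case using dclosure_step unit_in_G by simp
  qed
  then have "?g x = 0" by (intro flat_zero[OF g _ x]) blast
  then show ?thesis by simp
qed

lemma Tau_eq_0:
  assumes "Tau s y = 0" "k \<in> B"
  shows "dinv k s y = 0"
  using tpow_independent[of B "\<lambda>k. dinv k s y" k] assms by (simp add: Tau_def)

text \<open>Inside a stable space, \<open>delta f = 0\<close> is a linear autonomous system for the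
  values of \<open>f\<close> on \<open>H\<close>, so these values are constants. Then
  \<open>Tau s = 0\<close> for a regular function \<open>s\<close> over \<open>C\<close>, each
  \<open>dinv k s\<close> is zero by independence of powers of \<open>t\<^sub>1\<close>, and
  \<open>s\<close> is constant by rigidity.\<close>

theorem delta_constants:
  assumes f: "f \<in> \<F>" and 0: "\<And>y. y \<in> G \<Longrightarrow> delta f y = 0"
  obtains c where "\<And>x. x \<in> G \<Longrightarrow> f x = \<kappa> c"
proof -
  obtain U where U: "finite U" "U \<subseteq> \<A>" and rep: "\<forall>P b. interpolates G U P b \<longrightarrow>
    (\<forall>x\<in>G. f x = (\<Sum>p\<in>P. f p * \<kappa> (b p x)))"
    using regular_interpolate[OF f] by blast
  obtain H b where H: "interpolates G U H b" "\<And>h. h \<in> H \<Longrightarrow> b h \<in> \<A>"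
    "\<And>h k y. h \<in> H \<Longrightarrow> k \<in> B \<Longrightarrow> y \<in> G \<Longrightarrow> dinv k (b h) y = (\<Sum>q\<in>H. dinv k (b h) q * b q y)"
    by (rule ex_invariant_interpolation[OF U], rule that)
  interpret invariant_space m G H b
    by unfold_locales (use H in \<open>auto simp: interpolates_def\<close>)
  have fs: "f \<in> space" using rep H(1) by (simp add: space_def)
  have "\<exists>c. f h = \<kappa> c" if h: "h \<in> H" for h
  proof -
    have "diff_rat_deriv z \<in> order_less (Suc N)"
      if S: "f ` H \<subseteq> order_less (Suc N)" "z \<in> f ` H" for N z
    proof -
      obtain y where y: "y \<in> H" "z = f y" using S(2) by blast
      then have "diff_rat_deriv z = 0 - (\<Sum>h\<in>H. f h * Tau (b h) y)"
        using 0[of y] delta_space[OF fs, of y] H_G by (auto simp: eq_neg_iff_add_eq_0)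
      also have "\<dots> \<in> order_less (Suc N)"
        using S(1) order_less_const[of "0 :: 'c"]
        by (intro order_less_diff order_less_sum order_less_mult Tau_order_less)
          (auto simp: diff_rat_const_0)
      finally show ?thesis .
    qed
    from autonomous_system_const[of "f ` H", OF _ this] show ?thesis
      using finite_H h by blast
  qed
  then have "\<exists>c. \<forall>h\<in>H. f h = \<kappa> (c h)" by (intro bchoice ballI)
  then obtain c where c: "\<forall>h\<in>H. f h = \<kappa> (c h)" by (rule exE)
  note s = space_const[OF fs c]
  have "f x = \<kappa> (\<Sum>h\<in>H. c h * b h unit)" if "x \<in> G" for x
    using s(2)[OF that] dinv_0_const[OF s(1) Tau_eq_0 that] s(3) 0 by simp
  then show thesis by (rule that)
qed

text \<open>The assumptions describe a nonzero differential ideal; it is closed under equality on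
  \<open>G\<close> because values elsewhere carry no meaning. The finite-dimensional subspace to
  work with is \<open>I \<inter> space\<close>, stable because both parts are, with reduced basis
  \<open>r\<close> and pivots \<open>P\<close>.\<close>

theorem delta_simple:
  assumes I: "I \<subseteq> \<F>" "\<And>f g. f \<in> I \<Longrightarrow> g \<in> I \<Longrightarrow> (\<lambda>x. f x + g x) \<in> I"
      "\<And>f g. f \<in> \<F> \<Longrightarrow> g \<in> I \<Longrightarrow> (\<lambda>x. f x * g x) \<in> I" "\<And>f. f \<in> I \<Longrightarrow> delta f \<in> I"
      "\<And>f g. f \<in> I \<Longrightarrow> (\<And>x. x \<in> G \<Longrightarrow> g x = f x) \<Longrightarrow> g \<in> I"
    and f: "f \<in> I" "x0 \<in> G" "f x0 \<noteq> 0"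
  shows "(\<lambda>_. 1) \<in> I"
proof -
  have I0: "(\<lambda>_. 0) \<in> I" using I(3)[OF polyfun_const f(1), of 0] by simp
  have I_sum: "(\<lambda>x. \<Sum>i\<in>J. g i x) \<in> I" if "\<And>i. i \<in> J \<Longrightarrow> g i \<in> I" for J :: "'c mat set" and g
    using that by (induction J rule: infinite_finite_induct) (auto intro: I0 I(2))
  obtain U where U: "finite U" "U \<subseteq> \<A>" and rep: "\<forall>P b. interpolates G U P b \<longrightarrow>
    (\<forall>x\<in>G. f x = (\<Sum>p\<in>P. f p * \<kappa> (b p x)))"
    using regular_interpolate[of f] I(1) f(1) by blast
  obtain H b where H: "interpolates G U H b" "\<And>h. h \<in> H \<Longrightarrow> b h \<in> \<A>"
    "\<And>h k y. h \<in> H \<Longrightarrow> k \<in> B \<Longrightarrow> y \<in> G \<Longrightarrow> dinv k (b h) y = (\<Sum>q\<in>H. dinv k (b h) q * b q y)"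
    by (rule ex_invariant_interpolation[OF U], rule that)
  interpret invariant_space m G H b
    by unfold_locales (use H in \<open>auto simp: interpolates_def\<close>)
  have fs: "f \<in> I \<inter> space" using rep H(1) f(1) by (simp add: space_def)
  obtain P r where P: "interpolates G (I \<inter> space) P r" and r: "\<And>p. p \<in> P \<Longrightarrow> r p \<in> I \<inter> space"
  proof (rule ex_interpolates_determined[OF finite_H H_G, of "I \<inter> space"])
    show "(\<lambda>_. 0) \<in> I \<inter> space" using I0 by (simp add: space_def)
    show "(\<lambda>x. g x + h x) \<in> I \<inter> space" if "g \<in> I \<inter> space" "h \<in> I \<inter> space" for g h
      using that I(2) by (auto simp: space_def distrib_right sum.distrib)
    show "(\<lambda>x. a * g x) \<in> I \<inter> space" if "g \<in> I \<inter> space" for a g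
      using that I(3)[OF polyfun_const, of g a] by (auto simp: space_def mult.assoc sum_distrib_left)
    show "w x = 0" if "w \<in> I \<inter> space" "\<forall>h\<in>H. w h = 0" "x \<in> G" for w x
      using that by (auto simp: space_def)
  qed (rule that)
  have PG: "P \<subseteq> G" and fin_P: "finite P" and r_dual: "\<forall>p\<in>P. \<forall>q\<in>P. r p q = (if p = q then 1 else 0)"
    and W_rep: "\<And>w y. w \<in> I \<inter> space \<Longrightarrow> y \<in> G \<Longrightarrow> w y = (\<Sum>p\<in>P. w p * r p y)"
    using P by (simp_all add: interpolates_def)
  have "P \<noteq> {}" using W_rep[OF fs f(2)] f(3) by auto
  then obtain p0 where p0: "p0 \<in> P" by blast
  have W_delta: "delta w \<in> I \<inter> space" if "w \<in> I \<inter> space" for w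
    using that I(4) delta_in_space by blast
  let ?T = "\<lambda>p y. \<Sum>h\<in>H. r p h * Tau (b h) y"
  \<comment> \<open>At the pivots the values of \<open>r p\<close> are \<open>0\<close> or
    \<open>1\<close>, so their derivatives vanish there and \<open>?T p q\<close> are the
    coefficients of \<open>delta (r p)\<close> in the reduced basis. Evaluation at \<open>h\<close>
    gives the quadratic system.\<close>
  have deriv: "diff_rat_deriv (r p h) = (\<Sum>q\<in>P. ?T p q * r q h) - ?T p h" if p: "p \<in> P" and h: "h \<in> G" for p h
  proof -
    have rp: "r p \<in> space" using r[OF p] by blast
    have "delta (r p) q = ?T p q" if "q \<in> P" for q
    proof -
      have "diff_rat_deriv (r p q) = 0" using r_dual p that by (simp add: deriv_0 deriv_1)
      then show ?thesis using delta_space[OF rp] that PG by auto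
    qed
    then have "delta (r p) h = (\<Sum>q\<in>P. ?T p q * r q h)"
      using W_rep[OF W_delta[OF r[OF p]] h] by simp
    then show ?thesis using delta_space[OF rp h] by (simp add: algebra_simps)
  qed
  have "\<exists>c. r p h = \<kappa> c" if p: "p \<in> P" and h: "h \<in> H" for p h
  proof -
    let ?S = "(\<lambda>(p, h). r p h) ` (P \<times> H)"
    have "diff_rat_deriv z \<in> order_less (Suc N)" if S: "?S \<subseteq> order_less (Suc N)" "z \<in> ?S" for N z
    proof -
      obtain q y where q: "q \<in> P" "y \<in> H" "z = r q y" using S(2) by auto
      have rS: "r p h \<in> order_less (Suc N)" if "p \<in> P" "h \<in> H" for p h
        using S(1) that by auto
      have T: "?T q x \<in> order_less (Suc N)" for x
        using rS q by (intro order_less_sum order_less_mult Tau_order_less)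
      have "(\<Sum>q'\<in>P. ?T q q' * r q' y) - ?T q y \<in> order_less (Suc N)"
        using rS q T by (intro order_less_diff order_less_sum[of P] order_less_mult[OF T])
      then show ?thesis using deriv[OF q(1), of y] q H_G by auto
    qed
    from autonomous_system_const[of ?S, OF _ this, of "r p h"] show ?thesis
      using finite_H fin_P p h by auto
  qed
  then have "\<exists>d. \<forall>h\<in>H. r p h = \<kappa> (d h)" if "p \<in> P" for p
    using that by (intro bchoice ballI)
  then have "\<forall>p\<in>P. \<exists>d. \<forall>h\<in>H. r p h = \<kappa> (d h)" by (rule ballI)
  then have "\<exists>c. \<forall>p\<in>P. \<forall>h\<in>H. r p h = \<kappa> (c p h)" by (rule bchoice)
  then obtain c where c: "\<And>p. p \<in> P \<Longrightarrow> \<forall>h\<in>H. r p h = \<kappa> (c p h)" by (elim exE) blast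
  define s where "s p x = (\<Sum>h\<in>H. c p h * b h x)" for p x
  have s: "s p \<in> \<A>" and rs: "\<And>x. x \<in> G \<Longrightarrow> r p x = \<kappa> (s p x)"
    and delta_r: "\<And>y. y \<in> G \<Longrightarrow> delta (r p) y = Tau (s p) y" if p: "p \<in> P" for p
    using space_const[of "r p" "c p"] r[OF p] c[OF p] unfolding s_def[abs_def] by auto
  have \<kappa>_inj: "a = a'" if "\<kappa> a = \<kappa> a'" for a a'
    using that diff_rat_const_eq_0[of "a - a'"] by (simp add: const_diff)
  have s_dual: "\<forall>p\<in>P. \<forall>q\<in>P. s p q = (if p = q then 1 else 0)"
  proof (intro ballI)
    fix p q assume "p \<in> P" "q \<in> P"
    then have "\<kappa> (s p q) = \<kappa> (if p = q then 1 else 0)"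
      using rs[of p q] r_dual PG by (auto simp: diff_rat_const_0 diff_rat_const_1)
    then show "s p q = (if p = q then 1 else 0)" by (rule \<kappa>_inj)
  qed
  \<comment> \<open>Both sides of the stability under \<open>delta\<close> are polynomials in
    \<open>t\<^sub>1\<close> without constant term; comparing coefficients gives stability under
    each invariant field separately.\<close>
  have s_dinv: "dinv k (s p) y = (\<Sum>q\<in>P. dinv k (s p) q * s q y)" if p: "p \<in> P" and k: "k \<in> B" and y: "y \<in> G" for p k y
  proof -
    have "Tau (s p) y = (\<Sum>q\<in>P. Tau (s p) q * \<kappa> (s q y))"
      using W_rep[OF W_delta[OF r[OF p]] y] PG y delta_r[OF p] rs by (simp add: subset_iff)
    also have "\<dots> = (\<Sum>k\<in>B. \<Sum>q\<in>P. tpow k * \<kappa> (dinv k (s p) q * s q y))"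
      by (subst sum.swap) (simp add: Tau_def sum_distrib_right diff_rat_const_mult mult.assoc)
    finally have "(\<Sum>k\<in>B. tpow k * \<kappa> (dinv k (s p) y - (\<Sum>q\<in>P. dinv k (s p) q * s q y))) = 0"
      by (simp add: Tau_def const_diff const_sum right_diff_distrib sum_subtractf sum_distrib_left)
    from tpow_independent[OF finite_B this k] show ?thesis by simp
  qed
  have comb: "w y = (\<Sum>q\<in>P. w q * s q y)" if "\<And>x. x \<in> G \<Longrightarrow> w x = (\<Sum>q\<in>P. e q * s q x)" "y \<in> G" for w e y
    by (rule interpolates_combination[OF fin_P s_dual PG that])
  have closure: "w y = (\<Sum>q\<in>P. w q * s q y)" if "w \<in> dclosure (s p)" "p \<in> P" "y \<in> G" for w p y
    using that(1,3)
  proof (induction arbitrary: y)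
    case dclosure_base
    have "s p x = (\<Sum>q\<in>P. (if q = p then 1 else 0) * s q x)" for x
      using \<open>p \<in> P\<close> fin_P by (simp add: if_distrib[of "\<lambda>a. a * _"] cong: if_cong)
    then show ?case by (rule comb) (use dclosure_base in auto)
  next
    case (dclosure_step w k)
    have "dinv k w x = (\<Sum>q\<in>P. (\<Sum>q'\<in>P. w q' * dinv k (s q') q) * s q x)" if x: "x \<in> G" for x
    proof -
      have "dinv k w x = dinv k (\<lambda>x. \<Sum>q\<in>P. w q * s q x) x"
        by (rule dinv_cong[OF dclosure_regular[OF dclosure_step.hyps(1) s[OF \<open>p \<in> P\<close>]]])
          (use dclosure_step x in auto)
      also have "\<dots> = (\<Sum>q'\<in>P. dinv k (\<lambda>x. w q' * s q' x) x)"
        by (rule dinv_sum) (use s dclosure_step x in \<open>auto intro: polyfun_scale\<close>)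
      also have "\<dots> = (\<Sum>q'\<in>P. \<Sum>q\<in>P. w q' * dinv k (s q') q * s q x)"
      proof (rule sum.cong[OF refl])
        fix q' assume q': "q' \<in> P"
        show "dinv k (\<lambda>x. w q' * s q' x) x = (\<Sum>q\<in>P. w q' * dinv k (s q') q * s q x)"
          using dinv_scale[OF s[OF q'] dclosure_step.hyps(2) x] s_dinv[OF q' dclosure_step.hyps(2) x]
          by (simp add: sum_distrib_left mult.assoc)
      qed
      also have "\<dots> = (\<Sum>q\<in>P. \<Sum>q'\<in>P. w q' * dinv k (s q') q * s q x)"
        by (rule sum.swap)
      finally show ?thesis by (simp add: sum_distrib_right)
    qed
    then show ?case by (rule comb) (use dclosure_step.prems in auto)
  qed
  \<comment> \<open>For fixed \<open>y\<close> the difference \<open>?h\<close> of the two sides is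
    a function of \<open>z\<close>. By right invariance its iterated derivatives have the same form
    with an iterated derivative \<open>v\<close> of \<open>s p0\<close> in place of
    \<open>s p0\<close>, and at the unit they vanish since \<open>v\<close> lies in the span of the
    functions \<open>s q\<close>. Rigidity makes \<open>?h\<close> zero.\<close>
  have invariant: "s p0 (z * y) = (\<Sum>q\<in>P. s p0 (z * q) * s q y)" if z: "z \<in> G" and y: "y \<in> G" for z y
  proof -
    let ?h = "\<lambda>z. s p0 (z * y) - (\<Sum>q\<in>P. s q y * s p0 (z * q))"
    have h: "?h \<in> \<A>"
      by (intro polyfun_diff polyfun_sum polyfun_scale translate_right_regular s p0 y) (use PG in auto)
    have "\<exists>v\<in>dclosure (s p0). \<forall>z\<in>G. w z = v (z * y) - (\<Sum>q\<in>P. s q y * v (z * q))" if "w \<in> dclosure ?h" for w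
      using that
    proof induction
      case dclosure_base
      show ?case by (rule bexI[of _ "s p0"]) (auto intro: dclosure.intros)
    next
      case (dclosure_step w k)
      then obtain v where v: "v \<in> dclosure (s p0)" "\<forall>z\<in>G. w z = v (z * y) - (\<Sum>q\<in>P. s q y * v (z * q))"
        by blast
      have vA: "v \<in> \<A>" using v(1) s[OF p0] by (rule dclosure_regular)
      have t: "(\<lambda>x. v (x * q)) \<in> \<A>" if "q \<in> G" for q
        by (rule translate_right_regular[OF vA that])
      have tq: "(\<lambda>x. v (x * q)) \<in> \<A>" if "q \<in> P" for q
        using t that PG by blast
      have "dinv k w z = dinv k v (z * y) - (\<Sum>q\<in>P. s q y * dinv k v (z * q))" if z: "z \<in> G" for z
      proof -
        have "dinv k w z = dinv k (\<lambda>z. v (z * y) - (\<Sum>q\<in>P. s q y * v (z * q))) z"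
          by (rule dinv_cong[OF dclosure_regular[OF dclosure_step.hyps(1) h]])
            (use v dclosure_step z in auto)
        also have "\<dots> = dinv k (\<lambda>z. v (z * y)) z - dinv k (\<lambda>z. \<Sum>q\<in>P. s q y * v (z * q)) z"
          by (intro dinv_diff polyfun_sum polyfun_scale t tq y dclosure_step.hyps z)
        also have "dinv k (\<lambda>z. v (z * y)) z = dinv k v (z * y)"
          by (rule dinv_translate[OF vA dclosure_step.hyps(2) z y])
        also have "dinv k (\<lambda>z. \<Sum>q\<in>P. s q y * v (z * q)) z = (\<Sum>q\<in>P. dinv k (\<lambda>z. s q y * v (z * q)) z)"
          by (intro dinv_sum polyfun_scale tq dclosure_step.hyps z)
        also have "\<dots> = (\<Sum>q\<in>P. s q y * dinv k v (z * q))"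
        proof (rule sum.cong[OF refl])
          fix q assume "q \<in> P"
          then show "dinv k (\<lambda>z. s q y * v (z * q)) z = s q y * dinv k v (z * q)"
            using dinv_scale[OF tq dclosure_step.hyps(2) z]
              dinv_translate[OF vA dclosure_step.hyps(2) z] PG by auto
        qed
        finally show ?thesis .
      qed
      then show ?case using v(1) dclosure_step.hyps(2)
        by (intro bexI[of _ "dinv k v"]) (auto intro: dclosure.intros)
    qed
    note ex = this
    have "w unit = 0" if wc: "w \<in> dclosure ?h" for w
    proof -
      obtain v where v: "v \<in> dclosure (s p0)"
        and w: "\<forall>z\<in>G. w z = v (z * y) - (\<Sum>q\<in>P. s q y * v (z * q))"
        using ex[OF wc] by blast
      have "w unit = v y - (\<Sum>q\<in>P. s q y * v q)"
        using w unit_in_G y PG by (simp add: unit_mult subset_iff)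
      then show ?thesis using closure[OF v p0 y] by (simp add: mult.commute)
    qed
    then have "?h z = 0" by (rule flat_zero[OF h _ z])
    then show ?thesis by (simp add: mult.commute)
  qed
  \<comment> \<open>Taking \<open>z = p0 * invm m y\<close> in the invariance turns its left side
    into \<open>s p0 p0 = 1\<close>, while the coefficients remain regular in
    \<open>y\<close>.\<close>
  have "(\<lambda>y. \<Sum>q\<in>P. \<kappa> (s p0 (p0 * invm m y * q)) * r q y) \<in> I"
  proof (rule I_sum)
    fix q assume q: "q \<in> P"
    have "(\<lambda>x. s p0 (x * q)) \<in> \<A>"
      by (intro translate_right_regular s p0) (use q PG in auto)
    then have "(\<lambda>x. s p0 (p0 * x * q)) \<in> \<A>"
      by (rule translate_left_regular) (use p0 PG in auto)
    then have "(\<lambda>y. s p0 (p0 * invm m y * q)) \<in> \<A>"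
      by (rule invm_regular)
    then have "(\<lambda>y. \<kappa> (s p0 (p0 * invm m y * q))) \<in> \<F>"
      by (rule const_regular)
    then show "(\<lambda>y. \<kappa> (s p0 (p0 * invm m y * q)) * r q y) \<in> I"
      using I(3) r[OF q] by blast
  qed
  then show ?thesis
  proof (rule I(5))
    fix y assume y: "y \<in> G"
    have p0G: "p0 \<in> G" using p0 PG by blast
    have "p0 * invm m y * y = p0"
      using y p0G by (simp add: G_assoc invm_mult unit_mult)
    then have "(\<Sum>q\<in>P. s p0 (p0 * invm m y * q) * s q y) = 1"
      using invariant[of "p0 * invm m y" y] y p0G s_dual p0 by simp
    then have "\<kappa> (\<Sum>q\<in>P. s p0 (p0 * invm m y * q) * s q y) = 1"
      by (simp add: diff_rat_const_1)
    then show "1 = (\<Sum>q\<in>P. \<kappa> (s p0 (p0 * invm m y * q)) * r q y)"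
      using rs y by (simp add: const_sum diff_rat_const_mult)
  qed
qed

end

section \<open>The Picard-Vessiot ring\<close>

text \<open>The ideal \<open>(t\<^sub>0, \<dots>, t\<^sub>i\<^sub>-\<^sub>1)\<close>.\<close>

inductive_set low :: "nat \<Rightarrow> 'c::field diff_poly set" for i where
  low_0: "0 \<in> low i"
| low_var: "k < i \<Longrightarrow> tvar k * q \<in> low i"
| low_add: "p \<in> low i \<Longrightarrow> q \<in> low i \<Longrightarrow> p + q \<in> low i"

lemma diff_poly_deriv_tvar: "diff_poly_deriv (tvar k) = tvar (Suc k)"
  unfolding tvar_def by (rule diff_poly_deriv_var)

lemma poly_eval_tvar: "poly_eval x (tvar k) = x k"
  unfolding tvar_def by (rule poly_eval_var)

lemma low_mult: "p \<in> low i \<Longrightarrow> r * p \<in> low i"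
proof (induction rule: low.induct)
  case (low_var k q)
  from low.low_var[OF low_var, of "r * q"] show ?case by (simp add: ac_simps)
qed (auto simp: distrib_left intro: low.intros)

lemma low_sum: "(\<And>a. a \<in> A \<Longrightarrow> f a \<in> low i) \<Longrightarrow> sum f A \<in> low i"
  by (induction A rule: infinite_finite_induct) (auto intro: low.intros)

lemma low_deriv: "p \<in> low i \<Longrightarrow> diff_poly_deriv p \<in> low (Suc i)"
proof (induction rule: low.induct)
  case (low_var k q)
  then show ?case
    by (simp add: diff_poly_deriv_mult diff_poly_deriv_tvar, intro low.low_add low.low_var) simp_all
qed (auto simp: diff_poly_deriv_add intro: low.intros)

lemma poly_eval_low:
  assumes "p \<in> low i" "\<And>k. k < i \<Longrightarrow> x k = 0"
  shows "poly_eval x p = 0"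
  using assms(1)
  by induction (simp_all add: poly_eval_add poly_eval_mult poly_eval_tvar assms(2))

lemma comm_ring_hom_frc: "comm_ring_hom frc"
  by unfold_locales (simp_all add: frc_0 frc_1 frc_add frc_mult)

lemma comm_ring_hom_diff_rat_const: "comm_ring_hom diff_rat_const"
  by unfold_locales (simp_all add: diff_rat_const_0 diff_rat_const_1 diff_rat_const_add diff_rat_const_mult)

lemma comm_ring_hom_poly_eval: "comm_ring_hom (poly_eval x)"
  by unfold_locales (simp_all add: poly_eval_add poly_eval_mult)

context matrix_group_char_0
begin

text \<open>The entries of the matrix \<open>A\<close> of the system \<open>X' = AX\<close>.\<close>

definition system_poly :: "nat \<Rightarrow> nat \<Rightarrow> 'c diff_poly"
  where "system_poly i l =
    (\<Sum>k\<in>B. Poly_Mapping.single (Poly_Mapping.single 0 (Suc k)) (dpt k (\<lambda>x. x $$ (i, l))))"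

lemma frc_system_poly: "frc (system_poly i l) = tau (\<lambda>x. x $$ (i, l))"
  by (simp add: system_poly_def tau_def frc_sum tpow_mult_const)

text \<open>Every monomial is a positive power of \<open>t\<^sub>1\<close>, because the exponents in
  \<open>tpow\<close> start at \<open>1\<close>. This keeps the system matrix out of the leading
  terms of the cyclic vector's derivatives.\<close>

lemma system_poly_low: "system_poly i l \<in> low (Suc n)"
proof -
  have "Poly_Mapping.single (Poly_Mapping.single 0 (Suc k)) c \<in> low (Suc n)" for k and c :: 'c
  proof -
    have eq: "Poly_Mapping.single (Poly_Mapping.single 0 (Suc k)) c =
        tvar 0 * Poly_Mapping.single (Poly_Mapping.single 0 k) c"
      by (simp add: tvar_def mult_single flip: single_add)
    show ?thesis unfolding eq by (rule low_var) simp
  qed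
  then show ?thesis unfolding system_poly_def by (intro low_sum)
qed

text \<open>Row \<open>i\<close> expresses the \<open>i\<close>-th derivative of the cyclic vector, the combination of the rows of a
  fundamental matrix with the derivatives of \<open>t\<^sub>1\<close> of orders \<open>m, 2m, \<dots>, m\<^sup>2\<close> as coefficients. These orders
  are so far apart that the entries of all rows have distinct leading variables.\<close>

fun row_poly :: "nat \<Rightarrow> nat \<Rightarrow> 'c diff_poly" where
  "row_poly 0 j = tvar (Suc j * m)"
| "row_poly (Suc i) j = diff_poly_deriv (row_poly i j) + (\<Sum>l<m. row_poly i l * system_poly l j)"

text \<open>Differentiation raises the index of the leading variable by one and maps
  \<open>low i\<close> into \<open>low (Suc i)\<close>; the terms from the system matrix are
  divisible by the variable of index \<open>0\<close>.\<close>

lemma row_poly_lead: "\<exists>q\<in>low i. row_poly i j = tvar (Suc j * m + i) + q"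
proof (induction i arbitrary: j)
  case 0
  show ?case by (rule bexI[of _ 0]) (auto intro: low_0)
next
  case (Suc i)
  then obtain q where q: "q \<in> low i" "row_poly i j = tvar (Suc j * m + i) + q" by blast
  have "row_poly (Suc i) j = tvar (Suc j * m + Suc i) +
      (diff_poly_deriv q + (\<Sum>l<m. row_poly i l * system_poly l j))"
    by (simp add: q(2) diff_poly_deriv_add diff_poly_deriv_tvar)
  moreover have "diff_poly_deriv q + (\<Sum>l<m. row_poly i l * system_poly l j) \<in> low (Suc i)"
    by (intro low_add low_deriv q low_sum low_mult system_poly_low)
  ultimately show ?case by blast
qed

definition cyclic_mat :: "'c diff_rat mat"
  where "cyclic_mat = mat m m (\<lambda>(i, j). frc (row_poly i j))"

lemma cyclic_mat_carrier [simp]: "cyclic_mat \<in> carrier_mat m m" "dim_row cyclic_mat = m" "dim_col cyclic_mat = m"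
  by (simp_all add: cyclic_mat_def)

lemma cyclic_mat_index [simp]: "i < m \<Longrightarrow> j < m \<Longrightarrow> cyclic_mat $$ (i, j) = frc (row_poly i j)"
  by (simp add: cyclic_mat_def)

text \<open>Set the variables with index \<open>Suc l * m + l\<close> to \<open>1\<close> and all
  others to \<open>0\<close>. The variables that generate \<open>low i\<close> have index below
  \<open>m\<close> and become \<open>0\<close>, so only the leading variables count and the matrix
  becomes the identity.\<close>

lemma det_cyclic_mat: "det cyclic_mat \<noteq> 0"
proof
  assume 0: "det cyclic_mat = 0"
  interpret frc: comm_ring_hom "frc :: 'c diff_poly \<Rightarrow> _" by (rule comm_ring_hom_frc)
  let ?Q = "mat m m (\<lambda>(i, j). row_poly i j)"
  define x :: "nat \<Rightarrow> 'c" where "x k = (if \<exists>l<m. k = Suc l * m + l then 1 else 0)" for k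
  interpret ev: comm_ring_hom "poly_eval x" by (rule comm_ring_hom_poly_eval)
  have "cyclic_mat = map_mat frc ?Q" by (rule eq_matI) auto
  then have "frc (det ?Q) = 0" using 0 by simp
  then have "det ?Q = 0" by (simp add: frc_eq_0)
  then have "det (map_mat (poly_eval x) ?Q) = 0" by simp
  moreover have "map_mat (poly_eval x) ?Q = 1\<^sub>m m"
  proof (rule eq_matI)
    fix i j assume "i < dim_row (1\<^sub>m m :: 'c mat)" "j < dim_col (1\<^sub>m m :: 'c mat)"
    then have ij: "i < m" "j < m" by auto
    obtain q where q: "q \<in> low i" "row_poly i j = tvar (Suc j * m + i) + q"
      using row_poly_lead by blast
    have "poly_eval x q = 0"
      by (rule poly_eval_low[OF q(1)]) (use ij in \<open>auto simp: x_def\<close>)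
    then have "poly_eval x (row_poly i j) = x (Suc j * m + i)"
      by (simp add: q(2) poly_eval_add poly_eval_tvar)
    also have "\<dots> = (if i = j then 1 else 0)"
    proof -
      have "(\<exists>l<m. Suc j * m + i = Suc l * m + l) \<longleftrightarrow> i = j"
      proof
        assume "\<exists>l<m. Suc j * m + i = Suc l * m + l"
        then obtain l where l: "l < m" "Suc j * m + i = Suc l * m + l" by blast
        have "i = (Suc j * m + i) mod m" using ij by (simp only: mod_mult_self3 mod_less)
        also have "\<dots> = l" using l by (simp only: mod_mult_self3 mod_less)
        finally have "i = l" .
        then show "i = j" using l ij by simp
      qed (use ij in auto)
      then show ?thesis by (simp add: x_def)
    qed
    finally show "map_mat (poly_eval x) ?Q $$ (i, j) = 1\<^sub>m m $$ (i, j)"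
      using ij by simp
  qed auto
  ultimately show False by simp
qed

text \<open>Row \<open>m\<close> times the inverse of the matrix of rows \<open>0\<close> to
  \<open>m - 1\<close>: the coefficients with which the \<open>m\<close>-th derivative of the cyclic
  vector depends on the lower ones.\<close>

definition lde_coeff :: "nat \<Rightarrow> 'c diff_rat"
  where "lde_coeff i = (\<Sum>l<m. frc (row_poly m l) * invm m cyclic_mat $$ (l, i))"

lemma invm_cyclic_mat: "invm m cyclic_mat \<in> carrier_mat m m"
  by (rule invm(1)) (auto simp: det_cyclic_mat)

lemma cyclic_mat_inverse:
  assumes "i < m" "j < m"
  shows "(\<Sum>l<m. invm m cyclic_mat $$ (i, l) * frc (row_poly l j)) = (if i = j then 1 else 0)"
proof -
  have "invm m cyclic_mat * cyclic_mat = 1\<^sub>m m" by (rule invm(3)) (auto simp: det_cyclic_mat)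
  then have "(invm m cyclic_mat * cyclic_mat) $$ (i, j) = (if i = j then 1 else 0)" using assms by simp
  then show ?thesis
    using assms invm_cyclic_mat by (simp add: scalar_prod_def lessThan_atLeast0)
qed

lemma lde_coeff:
  assumes j: "j < m"
  shows "frc (row_poly m j) = (\<Sum>i<m. lde_coeff i * frc (row_poly i j))"
proof -
  have "(\<Sum>i<m. lde_coeff i * frc (row_poly i j)) =
      (\<Sum>i<m. \<Sum>l<m. frc (row_poly m l) * (invm m cyclic_mat $$ (l, i) * frc (row_poly i j)))"
    by (simp add: lde_coeff_def sum_distrib_right mult.assoc)
  also have "\<dots> = (\<Sum>l<m. \<Sum>i<m. frc (row_poly m l) * (invm m cyclic_mat $$ (l, i) * frc (row_poly i j)))"
    by (rule sum.swap)
  also have "\<dots> = (\<Sum>l<m. frc (row_poly m l) * (if l = j then 1 else 0))"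
    by (intro sum.cong refl) (use j in \<open>simp add: cyclic_mat_inverse flip: sum_distrib_left\<close>)
  also have "\<dots> = frc (row_poly m j)"
    using j by (simp add: if_distrib[of "\<lambda>a. _ * a"] cong: if_cong)
  finally show ?thesis by simp
qed

section \<open>The generic matrix and the solutions\<close>

definition row_fun :: "(nat \<Rightarrow> 'c diff_rat) \<Rightarrow> nat \<Rightarrow> 'c mat \<Rightarrow> 'c diff_rat"
  where "row_fun z j x = (\<Sum>l<m. z l * \<kappa> (x $$ (l, j)))"

lemma row_fun_regular: "j < m \<Longrightarrow> row_fun z j \<in> \<F>"
  unfolding row_fun_def[abs_def] by (intro polyfun_sum polyfun_scale const_regular entry_regular) auto

text \<open>The generic matrix is a fundamental matrix of \<open>X' = A X\<close>, where
  \<open>A\<close> has the entries \<open>tau (\<lambda>x. x $$ (i, l))\<close>; this is the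
  derivative at the unit of the formula for the entries of \<open>x * y\<close>.\<close>

lemma Tau_entry:
  assumes "i < m" "j < m" "y \<in> G"
  shows "Tau (\<lambda>x. x $$ (i, j)) y = (\<Sum>l<m. tau (\<lambda>x. x $$ (i, l)) * \<kappa> (y $$ (l, j)))"
proof -
  have "Tau (\<lambda>x. x $$ (i, j)) y = tau (\<lambda>x. (x * y) $$ (i, j))"
    by (simp add: Tau_def tau_def dinv_def)
  also have "\<dots> = (\<Sum>l<m. \<kappa> (y $$ (l, j)) * tau (\<lambda>x. x $$ (i, l)))"
    by (rule tau_sum) (use assms in \<open>auto intro: entry_regular simp: mult.commute\<close>)
  finally show ?thesis by (simp add: mult.commute)
qed

lemma delta_row_fun:
  assumes j: "j < m" and y: "y \<in> G"
  shows "delta (row_fun z j) y =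
    row_fun (\<lambda>l. diff_rat_deriv (z l) + (\<Sum>i<m. z i * tau (\<lambda>x. x $$ (i, l)))) j y"
proof -
  have "represents (row_fun z j) {..<m} z (\<lambda>l x. x $$ (l, j))"
    using j by (auto simp: represents_def row_fun_def intro: entry_regular)
  from delta_represents[OF this y] have "delta (row_fun z j) y =
      diff_rat_deriv (row_fun z j y) + (\<Sum>i<m. z i * Tau (\<lambda>x. x $$ (i, j)) y)" .
  also have "diff_rat_deriv (row_fun z j y) = (\<Sum>l<m. diff_rat_deriv (z l) * \<kappa> (y $$ (l, j)))"
    by (simp add: row_fun_def derivation_sum[OF derivation_diff_rat_deriv] diff_rat_deriv_mult)
  also have "(\<Sum>i<m. z i * Tau (\<lambda>x. x $$ (i, j)) y) =
      (\<Sum>i<m. \<Sum>l<m. z i * tau (\<lambda>x. x $$ (i, l)) * \<kappa> (y $$ (l, j)))"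
    using j y by (simp add: Tau_entry sum_distrib_left mult.assoc)
  also have "(\<Sum>i<m. \<Sum>l<m. z i * tau (\<lambda>x. x $$ (i, l)) * \<kappa> (y $$ (l, j))) =
      (\<Sum>l<m. \<Sum>i<m. z i * tau (\<lambda>x. x $$ (i, l)) * \<kappa> (y $$ (l, j)))"
    by (rule sum.swap)
  finally show ?thesis
    by (simp add: row_fun_def[abs_def] distrib_right sum.distrib sum_distrib_right)
qed

text \<open>The default \<open>0\<close> makes every \<open>sol j\<close> regular without a bound on
  \<open>j\<close>, as the determinant formula \<open>pv_det\<close> asks for.\<close>

definition sol :: "nat \<Rightarrow> 'c mat \<Rightarrow> 'c diff_rat"
  where "sol j = (if j < m then row_fun (\<lambda>l. frc (row_poly 0 l)) j else (\<lambda>_. 0))"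

lemma sol_regular: "(delta ^^ i) (sol j) \<in> \<F>"
proof (induction i)
  case 0
  show ?case by (simp add: sol_def row_fun_regular polyfun_const)
next
  case (Suc i)
  then show ?case by (simp add: delta_regular)
qed

lemma delta_power_sol:
  "j < m \<Longrightarrow> y \<in> G \<Longrightarrow> (delta ^^ i) (sol j) y = row_fun (\<lambda>l. frc (row_poly i l)) j y"
proof (induction i arbitrary: y)
  case 0
  then show ?case by (simp add: sol_def)
next
  case (Suc i)
  have "(delta ^^ Suc i) (sol j) y = delta (row_fun (\<lambda>l. frc (row_poly i l)) j) y"
    using delta_cong[OF sol_regular Suc.IH[OF Suc.prems(1)] Suc.prems(2)] by simp
  also have "\<dots> = row_fun (\<lambda>l. frc (row_poly (Suc i) l)) j y"
    by (simp add: delta_row_fun[OF Suc.prems] diff_rat_deriv_frc frc_add frc_sum frc_mult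
        frc_system_poly[symmetric])
  finally show ?case .
qed

text \<open>A regular function is encoded by the coset of polynomials in the coordinates that define it.\<close>

definition enc :: "('c mat \<Rightarrow> 'c diff_rat) \<Rightarrow> (nat, 'c diff_rat) polys set"
  where "enc f = {p. \<forall>x\<in>G. poly_eval (\<lambda>k. \<kappa> (crd k x)) p = f x}"

text \<open>The members of a coset agree on \<open>G\<close>, so the choice does not affect the
  values there.\<close>

definition dec :: "(nat, 'c diff_rat) polys set \<Rightarrow> 'c mat \<Rightarrow> 'c diff_rat"
  where "dec r x = poly_eval (\<lambda>k. \<kappa> (crd k x)) (SOME p. p \<in> r)"

lemma enc_cong: "(\<And>x. x \<in> G \<Longrightarrow> f x = g x) \<Longrightarrow> enc f = enc g"
  by (simp add: enc_def)

lemma dec_enc [simp]: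
  assumes "f \<in> \<F>" "x \<in> G"
  shows "dec (enc f) x = f x"
proof -
  obtain p where "\<forall>x\<in>G. f x = poly_eval (\<lambda>k. \<kappa> (crd k x)) p"
    using polyfun_imp_poly_eval[OF assms(1)] by blast
  then have "p \<in> enc f" by (simp add: enc_def)
  then have "(SOME p. p \<in> enc f) \<in> enc f" by (rule someI)
  then show ?thesis using assms(2) by (simp add: dec_def enc_def)
qed

lemma enc_eqD: "enc f = enc g \<Longrightarrow> f \<in> \<F> \<Longrightarrow> g \<in> \<F> \<Longrightarrow> x \<in> G \<Longrightarrow> f x = g x"
  by (metis dec_enc)

section \<open>The ring of cosets\<close>

definition pv :: "(nat, 'c diff_rat) polys set ring"
  where "pv = \<lparr>carrier = enc ` \<F>, monoid.mult = (\<lambda>r s. enc (\<lambda>x. dec r x * dec s x)),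
    one = enc (\<lambda>_. 1), zero = enc (\<lambda>_. 0), add = (\<lambda>r s. enc (\<lambda>x. dec r x + dec s x))\<rparr>"

definition pv_deriv :: "(nat, 'c diff_rat) polys set \<Rightarrow> (nat, 'c diff_rat) polys set"
  where "pv_deriv r = enc (delta (dec r))"

definition pv_const :: "'c diff_rat \<Rightarrow> (nat, 'c diff_rat) polys set"
  where "pv_const z = enc (\<lambda>_. z)"

lemma pv_carrier: "carrier pv = enc ` \<F>"
  by (simp add: pv_def)

lemma pvE: "r \<in> carrier pv \<Longrightarrow> (\<And>f. f \<in> \<F> \<Longrightarrow> r = enc f \<Longrightarrow> thesis) \<Longrightarrow> thesis"
  by (auto simp: pv_carrier)

lemma enc_in_pv [simp]: "f \<in> \<F> \<Longrightarrow> enc f \<in> carrier pv"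
  by (simp add: pv_carrier)

lemma pv_mult [simp]: "f \<in> \<F> \<Longrightarrow> g \<in> \<F> \<Longrightarrow> enc f \<otimes>\<^bsub>pv\<^esub> enc g = enc (\<lambda>x. f x * g x)"
  by (simp add: pv_def, rule enc_cong, simp)

lemma pv_add [simp]: "f \<in> \<F> \<Longrightarrow> g \<in> \<F> \<Longrightarrow> enc f \<oplus>\<^bsub>pv\<^esub> enc g = enc (\<lambda>x. f x + g x)"
  by (simp add: pv_def, rule enc_cong, simp)

lemma pv_one: "\<one>\<^bsub>pv\<^esub> = enc (\<lambda>_. 1)" and pv_zero: "\<zero>\<^bsub>pv\<^esub> = enc (\<lambda>_. 0)"
  by (simp_all add: pv_def)

lemma pv_deriv_enc [simp]: "f \<in> \<F> \<Longrightarrow> pv_deriv (enc f) = enc (delta f)"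
  unfolding pv_deriv_def by (rule enc_cong) (rule delta_cong[symmetric], auto)

lemma pv_cring: "cring pv"
proof (rule cringI)
  show "abelian_group pv"
  proof (rule abelian_groupI)
    fix x assume "x \<in> carrier pv"
    then obtain f where f: "f \<in> \<F>" "x = enc f" by (rule pvE)
    then show "\<exists>y\<in>carrier pv. y \<oplus>\<^bsub>pv\<^esub> x = \<zero>\<^bsub>pv\<^esub>"
      by (intro bexI[of _ "enc (\<lambda>x. - f x)"]) (auto simp: pv_zero polyfun_uminus)
  qed (auto elim!: pvE simp: pv_zero polyfun_add polyfun_const ac_simps)
  show "comm_monoid pv"
    by (rule comm_monoidI) (auto elim!: pvE simp: pv_one polyfun_mult polyfun_const ac_simps)
qed (auto elim!: pvE simp: polyfun_mult polyfun_add distrib_right)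

sublocale pv: cring pv
  by (rule pv_cring)

lemma pv_uminus [simp]: "f \<in> \<F> \<Longrightarrow> \<ominus>\<^bsub>pv\<^esub> enc f = enc (\<lambda>x. - f x)"
  by (rule pv.minus_equality) (auto simp: polyfun_uminus pv_zero)

lemma pv_finsum:
  "finite I \<Longrightarrow> (\<And>i. i \<in> I \<Longrightarrow> f i \<in> \<F>) \<Longrightarrow> (\<Oplus>\<^bsub>pv\<^esub>i\<in>I. enc (f i)) = enc (\<lambda>x. \<Sum>i\<in>I. f i x)"
proof (induction I rule: finite_induct)
  case empty
  show ?case by (simp add: pv_zero)
next
  case (insert i I)
  then show ?case by (subst pv.finsum_insert) (auto simp: polyfun_sum)
qed

lemma pv_finprod:
  "finite I \<Longrightarrow> (\<And>i. i \<in> I \<Longrightarrow> f i \<in> \<F>) \<Longrightarrow> (\<Otimes>\<^bsub>pv\<^esub>i\<in>I. enc (f i)) = enc (\<lambda>x. \<Prod>i\<in>I. f i x)"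
proof (induction I rule: finite_induct)
  case empty
  show ?case by (simp add: pv_one)
next
  case (insert i I)
  then show ?case by (subst pv.finprod_insert) (auto simp: polyfun_prod)
qed

text \<open>Pointwise, \<open>ring_det\<close> becomes an ordinary determinant over
  \<open>F\<close>, which makes multiplicativity available for the Wronskian.\<close>

lemma pv_det:
  assumes M: "\<And>i j. M i j \<in> \<F>"
  shows "ring_det pv n (\<lambda>i j. enc (M i j)) = enc (\<lambda>x. det (mat n n (\<lambda>(i, j). M i j x)))"
proof -
  have "(if evenperm p then \<Otimes>\<^bsub>pv\<^esub>i\<in>{0..<n}. enc (M i (p i))
      else \<ominus>\<^bsub>pv\<^esub> (\<Otimes>\<^bsub>pv\<^esub>i\<in>{0..<n}. enc (M i (p i)))) =
      enc (\<lambda>x. signof p * (\<Prod>i = 0..<n. M i (p i) x))" for p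
    using M by (simp add: pv_finprod polyfun_prod sign_def)
  then have "ring_det pv n (\<lambda>i j. enc (M i j)) =
      (\<Oplus>\<^bsub>pv\<^esub>p\<in>{p. p permutes {0..<n}}. enc (\<lambda>x. signof p * (\<Prod>i = 0..<n. M i (p i) x)))"
    by (simp add: ring_det_def)
  also have "\<dots> = enc (\<lambda>x. \<Sum>p\<in>{p. p permutes {0..<n}}. signof p * (\<Prod>i = 0..<n. M i (p i) x))"
    by (rule pv_finsum, simp add: finite_permutations, intro polyfun_scale polyfun_prod M)
  also have "\<dots> = enc (\<lambda>x. det (mat n n (\<lambda>(i, j). M i j x)))"
  proof (rule enc_cong)
    fix x
    have "(\<Prod>i = 0..<n. M i (p i) x) = (\<Prod>i = 0..<n. mat n n (\<lambda>(i, j). M i j x) $$ (i, p i))"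
      if "p permutes {0..<n}" for p
      by (rule prod.cong) (use permutes_in_image[OF that] in auto)
    then show "(\<Sum>p\<in>{p. p permutes {0..<n}}. signof p * (\<Prod>i = 0..<n. M i (p i) x)) =
        det (mat n n (\<lambda>(i, j). M i j x))"
      by (simp add: det_def'[of _ n])
  qed
  finally show ?thesis .
qed

lemma pv_differential_extension: "differential_extension diff_rat_deriv pv pv_deriv pv_const"
  unfolding differential_extension_def differential_ring_def
proof (intro conjI ballI allI)
  show "pv_deriv \<in> carrier pv \<rightarrow> carrier pv"
    by (auto elim!: pvE simp: delta_regular)
  fix r s assume "r \<in> carrier pv" "s \<in> carrier pv"
  then obtain f g where fg: "f \<in> \<F>" "r = enc f" "g \<in> \<F>" "s = enc g" by (auto elim!: pvE)
  show "pv_deriv (r \<oplus>\<^bsub>pv\<^esub> s) = pv_deriv r \<oplus>\<^bsub>pv\<^esub> pv_deriv s"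
    using fg by (simp add: polyfun_add delta_regular, intro enc_cong) (simp add: delta_add)
  show "pv_deriv (r \<otimes>\<^bsub>pv\<^esub> s) = pv_deriv r \<otimes>\<^bsub>pv\<^esub> s \<oplus>\<^bsub>pv\<^esub> r \<otimes>\<^bsub>pv\<^esub> pv_deriv s"
    using fg by (simp add: polyfun_mult delta_regular, intro enc_cong) (simp add: delta_mult)
next
  show "pv_const \<in> Ring.ring_hom class_ring pv"
    by (rule ring_hom_memI) (auto simp: pv_const_def polyfun_const pv_one)
  show "pv_const (diff_rat_deriv z) = pv_deriv (pv_const z)" for z
    by (simp add: pv_const_def polyfun_const, rule enc_cong) (simp add: delta_const)
qed (rule pv_cring)

lemma pv_deriv_power_sol: "(pv_deriv ^^ i) (enc (sol j)) = enc ((delta ^^ i) (sol j))"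
  by (induction i) (simp_all add: sol_regular)

lemma sol_matrix:
  assumes "x \<in> G"
  shows "mat m m (\<lambda>(i, j). (delta ^^ i) (sol j) x) = cyclic_mat * map_mat \<kappa> x"
  by (rule eq_matI)
    (use assms in \<open>auto simp: delta_power_sol row_fun_def scalar_prod_def lessThan_atLeast0\<close>)

lemma wronskian_sol: "wronskian pv pv_deriv m (\<lambda>j. enc (sol j)) = enc (\<lambda>x. det cyclic_mat * \<kappa> (det x))"
proof -
  interpret \<kappa>: comm_ring_hom \<kappa> by (rule comm_ring_hom_diff_rat_const)
  have "wronskian pv pv_deriv m (\<lambda>j. enc (sol j)) =
      enc (\<lambda>x. det (mat m m (\<lambda>(i, j). (delta ^^ i) (sol j) x)))"
    unfolding wronskian_def pv_deriv_power_sol by (rule pv_det) (rule sol_regular)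
  also have "\<dots> = enc (\<lambda>x. det cyclic_mat * \<kappa> (det x))"
  proof (rule enc_cong)
    fix x assume x: "x \<in> G"
    show "det (mat m m (\<lambda>(i, j). (delta ^^ i) (sol j) x)) = det cyclic_mat * \<kappa> (det x)"
      unfolding sol_matrix[OF x]
      by (subst det_mult[of _ m]) (use x in auto)
  qed
  finally show ?thesis .
qed

lemma det_regularF: "(\<lambda>x. \<kappa> (det x)) \<in> \<F>"
  by (intro const_regular det_regular[of _ m]) (auto intro: entry_regular)

lemma wronskian_inverse:
  "enc (\<lambda>x. det cyclic_mat * \<kappa> (det x)) \<otimes>\<^bsub>pv\<^esub> enc (\<lambda>x. 1 / det cyclic_mat * \<kappa> (1 / det x)) = \<one>\<^bsub>pv\<^esub>"
proof -
  have r: "(\<lambda>x. 1 / det cyclic_mat * \<kappa> (1 / det x)) \<in> \<F>" "(\<lambda>x. det cyclic_mat * \<kappa> (det x)) \<in> \<F>"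
    by (intro polyfun_scale const_regular inverse_det_regular det_regularF)+
  have "det cyclic_mat * \<kappa> (det x) * (1 / det cyclic_mat * \<kappa> (1 / det x)) = 1" if "x \<in> G" for x
  proof -
    have "\<kappa> (det x) * \<kappa> (1 / det x) = \<kappa> 1"
      using that by (simp flip: diff_rat_const_mult)
    then show ?thesis using det_cyclic_mat by (simp add: diff_rat_const_1)
  qed
  then show ?thesis
    unfolding pv_mult[OF r(2,1)] pv_one by (rule enc_cong)
qed

lemma fundamental_solutions_sol:
  "fundamental_solutions pv pv_deriv pv_const m lde_coeff (\<lambda>j. enc (sol j))"
  unfolding fundamental_solutions_def
proof (intro conjI allI impI)
  have r: "(\<lambda>x. 1 / det cyclic_mat * \<kappa> (1 / det x)) \<in> \<F>" "(\<lambda>x. det cyclic_mat * \<kappa> (det x)) \<in> \<F>"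
    by (intro polyfun_scale const_regular inverse_det_regular det_regularF)+
  show "wronskian pv pv_deriv m (\<lambda>j. enc (sol j)) \<in> Units pv"
    unfolding wronskian_sol Units_def
    using wronskian_inverse enc_in_pv[OF r(1)] enc_in_pv[OF r(2)] pv.m_comm[OF enc_in_pv[OF r(2)] enc_in_pv[OF r(1)]]
    by (intro CollectI conjI bexI[of _ "enc (\<lambda>x. 1 / det cyclic_mat * \<kappa> (1 / det x))"]) (simp_all only:)
next
  fix j assume j: "j < m"
  have s: "sol j \<in> \<F>" using sol_regular[of 0 j] by simp
  have "(pv_deriv ^^ m) (enc (sol j)) = enc (\<lambda>x. \<Sum>i = 0..<m. lde_coeff i * (delta ^^ i) (sol j) x)"
    unfolding pv_deriv_power_sol
  proof (rule enc_cong)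
    fix x assume x: "x \<in> G"
    have "(delta ^^ m) (sol j) x = (\<Sum>l<m. \<Sum>i<m. lde_coeff i * frc (row_poly i l) * \<kappa> (x $$ (l, j)))"
      unfolding delta_power_sol[OF j x] row_fun_def
      by (intro sum.cong refl) (simp add: lde_coeff sum_distrib_right)
    also have "\<dots> = (\<Sum>i<m. \<Sum>l<m. lde_coeff i * frc (row_poly i l) * \<kappa> (x $$ (l, j)))"
      by (rule sum.swap)
    finally show "(delta ^^ m) (sol j) x = (\<Sum>i = 0..<m. lde_coeff i * (delta ^^ i) (sol j) x)"
      by (simp add: delta_power_sol[OF j x] row_fun_def sum_distrib_left mult.assoc lessThan_atLeast0)
  qed
  also have "\<dots> = (\<Oplus>\<^bsub>pv\<^esub>i\<in>{0..<m}. enc (\<lambda>x. lde_coeff i * (delta ^^ i) (sol j) x))"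
    by (rule pv_finsum[symmetric]) (auto intro: polyfun_scale sol_regular)
  also have "\<dots> = (\<Oplus>\<^bsub>pv\<^esub>i\<in>{0..<m}. pv_const (lde_coeff i) \<otimes>\<^bsub>pv\<^esub> (pv_deriv ^^ i) (enc (sol j)))"
    by (simp add: pv_const_def pv_deriv_power_sol polyfun_const sol_regular)
  finally show "lde_solution pv pv_deriv pv_const m lde_coeff (enc (sol j))"
    using s by (simp add: lde_solution_def)
qed

text \<open>The Wronskian matrix is \<open>cyclic_mat\<close> times the generic matrix, and
  \<open>cyclic_mat\<close> is invertible over \<open>F\<close>. So passing to the scalar equation
  loses no generators.\<close>

lemma entry_from_sol:
  assumes "i < m" "j < m" "x \<in> G"
  shows "\<kappa> (x $$ (i, j)) = (\<Sum>l<m. invm m cyclic_mat $$ (i, l) * (delta ^^ l) (sol j) x)"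
proof -
  have "(\<Sum>l<m. invm m cyclic_mat $$ (i, l) * (delta ^^ l) (sol j) x) =
      (\<Sum>l<m. \<Sum>q<m. invm m cyclic_mat $$ (i, l) * frc (row_poly l q) * \<kappa> (x $$ (q, j)))"
    using assms by (simp add: delta_power_sol row_fun_def sum_distrib_left mult.assoc)
  also have "\<dots> = (\<Sum>q<m. (\<Sum>l<m. invm m cyclic_mat $$ (i, l) * frc (row_poly l q)) * \<kappa> (x $$ (q, j)))"
    by (subst sum.swap) (simp add: sum_distrib_right)
  also have "\<dots> = (\<Sum>q<m. (if i = q then 1 else 0) * \<kappa> (x $$ (q, j)))"
    using assms by (intro sum.cong refl) (simp add: cyclic_mat_inverse)
  also have "\<dots> = \<kappa> (x $$ (i, j))"
    using assms by (simp add: if_distrib[of "\<lambda>a. a * _"] cong: if_cong)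
  finally show ?thesis by simp
qed

text \<open>The matrix entries come from the derivatives of the solutions, and
  \<open>1 / det\<close> from the inverse of the Wronskian, which is a nonzero element of
  \<open>F\<close> times \<open>det\<close>.\<close>

lemma pv_generated:
  "carrier pv = generate_ring pv (range pv_const \<union>
    {(pv_deriv ^^ i) (enc (sol j)) |i j. i < m \<and> j < m} \<union>
    {inv\<^bsub>pv\<^esub> (wronskian pv pv_deriv m (\<lambda>j. enc (sol j)))})"
    (is "_ = generate_ring pv ?H")
proof
  have r: "(\<lambda>x. 1 / det cyclic_mat * \<kappa> (1 / det x)) \<in> \<F>" "(\<lambda>x. det cyclic_mat * \<kappa> (det x)) \<in> \<F>"
    by (intro polyfun_scale const_regular inverse_det_regular det_regularF)+
  have inv: "inv\<^bsub>pv\<^esub> (wronskian pv pv_deriv m (\<lambda>j. enc (sol j))) =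
      enc (\<lambda>x. 1 / det cyclic_mat * \<kappa> (1 / det x))"
    unfolding wronskian_sol by (rule pv.comm_inv_char) (use r wronskian_inverse in auto)
  show "generate_ring pv ?H \<subseteq> carrier pv"
    by (rule pv.generate_ring_incl)
      (use r in \<open>auto simp: inv pv_const_def polyfun_const pv_deriv_power_sol sol_regular\<close>)
  have const: "enc (\<lambda>_. z) \<in> generate_ring pv ?H" for z
    by (rule generate_ring.incl) (auto simp: pv_const_def)
  have add: "enc (\<lambda>x. f x + g x) \<in> generate_ring pv ?H"
    if "f \<in> \<F>" "g \<in> \<F>" "enc f \<in> generate_ring pv ?H" "enc g \<in> generate_ring pv ?H" for f g
    using generate_ring.eng_add[OF that(3,4)] that by simp
  have mult: "enc (\<lambda>x. f x * g x) \<in> generate_ring pv ?H"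
    if "f \<in> \<F>" "g \<in> \<F>" "enc f \<in> generate_ring pv ?H" "enc g \<in> generate_ring pv ?H" for f g
    using generate_ring.eng_mult[OF that(3,4)] that by simp
  have sum: "enc (\<lambda>x. \<Sum>i\<in>I. f i x) \<in> generate_ring pv ?H"
    if "finite I" "\<And>i. i \<in> I \<Longrightarrow> f i \<in> \<F>" "\<And>i. i \<in> I \<Longrightarrow> enc (f i) \<in> generate_ring pv ?H"
    for I :: "nat set" and f
    using that
  proof (induction I rule: finite_induct)
    case empty
    show ?case using const[of 0] by (simp only: sum.empty)
  next
    case (insert i I)
    have "enc (\<lambda>x. f i x + (\<Sum>i\<in>I. f i x)) \<in> generate_ring pv ?H"
      by (intro add polyfun_sum insert) (use insert in auto)
    then show ?case using insert by (simp only: sum.insert not_False_eq_True)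
  qed
  have "enc f \<in> generate_ring pv ?H" if "f \<in> \<F>" for f
    using that
  proof induction
    case (polyfun_const z)
    show ?case by (rule const)
  next
    case (polyfun_coord k)
    then show ?case
    proof (cases rule: crd_cases)
      case (1 i j)
      have "enc (\<lambda>x. \<kappa> (crd k x)) = enc (\<lambda>x. \<Sum>l<m. invm m cyclic_mat $$ (i, l) * (delta ^^ l) (sol j) x)"
        using 1 by (intro enc_cong) (simp add: entry_from_sol)
      moreover have "enc ((delta ^^ l) (sol j)) \<in> generate_ring pv ?H" if "l < m" for l
        by (rule generate_ring.incl) (use that 1 pv_deriv_power_sol[of l j] in blast)
      then have "enc (\<lambda>x. \<Sum>l<m. invm m cyclic_mat $$ (i, l) * (delta ^^ l) (sol j) x) \<in> generate_ring pv ?H"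
        by (intro sum mult const polyfun_scale sol_regular polyfun.polyfun_const) auto
      ultimately show ?thesis by simp
    next
      case 2
      have "enc (\<lambda>x. 1 / det cyclic_mat * \<kappa> (1 / det x)) \<in> generate_ring pv ?H"
        by (rule generate_ring.incl) (simp add: inv)
      from mult[OF polyfun.polyfun_const r(1) const this, of "det cyclic_mat"]
      have "enc (\<lambda>x. det cyclic_mat * (1 / det cyclic_mat * \<kappa> (1 / det x))) \<in> generate_ring pv ?H" .
      then show ?thesis using 2 det_cyclic_mat by simp
    qed
  next
    case (polyfun_add f g)
    then show ?case by (intro add)
  next
    case (polyfun_mult f g)
    then show ?case by (intro mult)
  next
    case (polyfun_cong f g)
    then show ?case using enc_cong[of f g] by simp
  qed
  then show "carrier pv \<subseteq> generate_ring pv ?H" by (auto simp: pv_carrier)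
qed

end

context connected_matrix_group
begin

lemma pv_simple: "simple_differential_ring pv pv_deriv"
  unfolding simple_differential_ring_def
proof (intro conjI allI impI)
  show "\<one>\<^bsub>pv\<^esub> \<noteq> \<zero>\<^bsub>pv\<^esub>"
    using enc_eqD[of "\<lambda>_. 1" "\<lambda>_. 0" unit] by (auto simp: pv_one pv_zero polyfun_const)
  fix I assume "ideal I pv \<and> pv_deriv ` I \<subseteq> I"
  then interpret ideal I pv by blast
  have DI: "pv_deriv ` I \<subseteq> I" using \<open>ideal I pv \<and> pv_deriv ` I \<subseteq> I\<close> by blast
  show "I = {\<zero>\<^bsub>pv\<^esub>} \<or> I = carrier pv"
  proof (rule disjCI)
    assume "I \<noteq> carrier pv"
    then have one: "\<one>\<^bsub>pv\<^esub> \<notin> I" using one_imp_carrier by blast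
    have "r = \<zero>\<^bsub>pv\<^esub>" if "r \<in> I" for r
    proof (rule ccontr)
      assume r: "r \<noteq> \<zero>\<^bsub>pv\<^esub>"
      have "r \<in> carrier pv" using that a_subset by blast
      then obtain f where f: "f \<in> \<F>" "r = enc f" by (rule pvE)
      then obtain x0 where x0: "x0 \<in> G" "f x0 \<noteq> 0"
        using r enc_cong[of f "\<lambda>_. 0"] by (auto simp: pv_zero)
      have "(\<lambda>_. 1) \<in> {f \<in> \<F>. enc f \<in> I}"
      proof (rule delta_simple[of "{f \<in> \<F>. enc f \<in> I}" f x0])
        show "(\<lambda>x. g x + h x) \<in> {f \<in> \<F>. enc f \<in> I}"
          if "g \<in> {f \<in> \<F>. enc f \<in> I}" "h \<in> {f \<in> \<F>. enc f \<in> I}" for g h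
          using that a_closed[of "enc g" "enc h"] by (simp add: polyfun_add)
        show "(\<lambda>x. g x * h x) \<in> {f \<in> \<F>. enc f \<in> I}"
          if "g \<in> \<F>" "h \<in> {f \<in> \<F>. enc f \<in> I}" for g h
          using that I_l_closed[of "enc h" "enc g"] by (simp add: polyfun_mult)
        show "delta g \<in> {f \<in> \<F>. enc f \<in> I}" if "g \<in> {f \<in> \<F>. enc f \<in> I}" for g
        proof -
          have "pv_deriv (enc g) \<in> I" using DI that by blast
          then show ?thesis using that by (simp add: delta_regular)
        qed
        show "h \<in> {f \<in> \<F>. enc f \<in> I}"
          if "g \<in> {f \<in> \<F>. enc f \<in> I}" "\<And>x. x \<in> G \<Longrightarrow> h x = g x" for g h
          using that polyfun_cong[of g G K "\<lambda>k x. \<kappa> (crd k x)" h] enc_cong[of h g] by simp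
      qed (use f that x0 in auto)
      then show False using one by (simp add: pv_one)
    qed
    then show "I = {\<zero>\<^bsub>pv\<^esub>}" using zero_closed by blast
  qed
qed

lemma pv_picard_vessiot: "picard_vessiot_ring diff_rat_deriv m lde_coeff pv pv_deriv pv_const"
  unfolding picard_vessiot_ring_def
  using pv_differential_extension pv_simple fundamental_solutions_sol pv_generated
  by (intro conjI exI[of _ "\<lambda>j. enc (sol j)"])

section \<open>The differential Galois group\<close>

abbreviation "Gal \<equiv> differential_galois_group pv pv_deriv pv_const"

text \<open>Right translation of functions; it is restricted to the carrier because
  \<open>Bij\<close> consists of extensional maps.\<close>

definition galois_action :: "'c mat \<Rightarrow> (nat, 'c diff_rat) polys set \<Rightarrow> (nat, 'c diff_rat) polys set"
  where "galois_action g = (\<lambda>r\<in>carrier pv. enc (\<lambda>x. dec r (x * g)))"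

lemma galois_action_enc [simp]: "g \<in> G \<Longrightarrow> f \<in> \<F> \<Longrightarrow> galois_action g (enc f) = enc (\<lambda>x. f (x * g))"
  by (simp add: galois_action_def, rule enc_cong, simp)

lemma galois_action_closed: "g \<in> G \<Longrightarrow> r \<in> carrier pv \<Longrightarrow> galois_action g r \<in> carrier pv"
  by (elim pvE) (simp add: translate_right_regularF)

lemma galois_action_mult:
  assumes "g \<in> G" "h \<in> G" "r \<in> carrier pv"
  shows "galois_action g (galois_action h r) = galois_action (g * h) r"
  using assms(3)
  by (rule pvE) (simp add: translate_right_regularF assms(1,2), rule enc_cong, simp add: G_assoc assms(1,2))

lemma galois_action_unit: "r \<in> carrier pv \<Longrightarrow> galois_action unit r = r"
  by (elim pvE) (simp, rule enc_cong, simp add: unit_mult)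

lemma delta_translate:
  assumes "f \<in> \<F>" "g \<in> G" "y \<in> G"
  shows "delta (\<lambda>x. f (x * g)) y = delta f (y * g)"
  unfolding delta_def
  by (intro arg_cong2[of _ _ _ _ "(+)"] refl tauF_cong translate_right_regularF assms)
    (use assms in \<open>auto simp: G_assoc intro: translate_right_regularF\<close>)

lemma galois_action_in_Gal:
  assumes g: "g \<in> G"
  shows "galois_action g \<in> carrier Gal"
proof -
  have g': "invm m g \<in> G" using g by simp
  have "bij_betw (galois_action g) (carrier pv) (carrier pv)"
    by (rule bij_betwI[of _ _ _ "galois_action (invm m g)"])
      (use g g' in \<open>auto simp: galois_action_closed galois_action_mult invm_mult galois_action_unit\<close>)
  then have "galois_action g \<in> Bij (carrier pv)"
    by (simp add: Bij_def) (simp add: galois_action_def)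
  moreover have "galois_action g \<in> Ring.ring_hom pv pv"
    by (rule ring_hom_memI)
      (use g in \<open>auto elim!: pvE simp: translate_right_regularF polyfun_mult polyfun_add pv_one polyfun_const\<close>)
  moreover have "galois_action g (pv_deriv r) = pv_deriv (galois_action g r)" if "r \<in> carrier pv" for r
    using that g
    by (elim pvE) (auto simp: delta_regular translate_right_regularF delta_translate intro!: enc_cong)
  moreover have "galois_action g (pv_const z) = pv_const z" for z
    using g by (simp add: pv_const_def polyfun_const)
  ultimately show ?thesis
    by (simp add: differential_galois_group_def)
qed

lemma galois_action_inj:
  assumes "g \<in> G" "h \<in> G" "galois_action g = galois_action h"
  shows "g = h"
proof (rule eq_matI)
  fix i j assume "i < dim_row h" "j < dim_col h"
  then have ij: "i < m" "j < m" using assms by auto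
  have f: "(\<lambda>x. \<kappa> (x $$ (i, j))) \<in> \<F>" by (intro const_regular entry_regular ij)
  have "enc (\<lambda>x. \<kappa> ((x * g) $$ (i, j))) = enc (\<lambda>x. \<kappa> ((x * h) $$ (i, j)))"
    using galois_action_enc[OF assms(1) f] galois_action_enc[OF assms(2) f] assms(3) by simp
  from enc_eqD[OF this translate_right_regularF[OF f assms(1)] translate_right_regularF[OF f assms(2)] unit_in_G]
  have "\<kappa> (g $$ (i, j) - h $$ (i, j)) = 0"
    using assms by (simp add: unit_mult const_diff)
  then show "g $$ (i, j) = h $$ (i, j)" by (simp add: diff_rat_const_eq_0)
qed (use assms in auto)

lemma mat_poly_regular: "(\<lambda>x. mat_poly m p x) \<in> \<A>"
proof (induction p rule: polys_induct)
  case (const c)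
  show ?case by (simp add: mat_poly_def polyfun_const)
next
  case (var v)
  obtain i j where v: "v = (i, j)" by (cases v)
  show ?case
  proof (cases "i < m \<and> j < m")
    case True
    then show ?thesis using entry_regular v by (simp add: mat_poly_def)
  next
    case False
    then have "(\<lambda>x. if i < m \<and> j < m then x $$ (i, j) else 0) = (\<lambda>x :: 'c mat. 0)" by auto
    then show ?thesis using v by (simp add: mat_poly_def polyfun_const)
  qed
next
  case (add p q)
  from polyfun_add[OF this] show ?case by (simp add: mat_poly_def poly_eval_add)
next
  case (mult p q)
  from polyfun_mult[OF this] show ?case by (simp add: mat_poly_mult)
qed

text \<open>For an automorphism \<open>\<sigma>\<close>, the matrix \<open>X\<^sup>-\<^sup>1 \<sigma>(X)\<close> is constant, and it lies in \<open>G\<close> because \<open>\<sigma>\<close>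
  preserves the equations of \<open>G\<close>.\<close>

lemma galois_action_surj:
  assumes \<sigma>: "\<sigma> \<in> carrier Gal"
  obtains g where "g \<in> G" "\<sigma> = galois_action g"
proof -
  have ext: "\<sigma> \<in> extensional (carrier pv)" and hom: "\<sigma> \<in> Ring.ring_hom pv pv"
    and D: "\<And>r. r \<in> carrier pv \<Longrightarrow> \<sigma> (pv_deriv r) = pv_deriv (\<sigma> r)"
    and fixed: "\<And>z. \<sigma> (pv_const z) = pv_const z"
    using \<sigma> by (auto simp: differential_galois_group_def Bij_def)
  \<comment> \<open>The automorphism is moved from cosets to functions; identities for
    \<open>S\<close> are therefore claimed on \<open>G\<close> only.\<close>
  define S where "S f = dec (\<sigma> (enc f))" for f
  have S_enc: "enc (S f) = \<sigma> (enc f)" and S: "S f \<in> \<F>" if f: "f \<in> \<F>" for f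
  proof -
    have "\<sigma> (enc f) \<in> carrier pv" using ring_hom_closed[OF hom] f by simp
    then obtain h where h: "h \<in> \<F>" "\<sigma> (enc f) = enc h" by (rule pvE)
    show "S f \<in> \<F>" by (rule polyfun_cong[OF h(1)]) (simp add: S_def h)
    show "enc (S f) = \<sigma> (enc f)" unfolding h(2) by (rule enc_cong) (simp add: S_def h)
  qed
  have S_eqI: "S f x = h x" if "f \<in> \<F>" "h \<in> \<F>" "\<sigma> (enc f) = enc h" "x \<in> G" for f h x
    using that by (simp add: S_def)
  have S_add: "S (\<lambda>x. f x + h x) x = S f x + S h x" if "f \<in> \<F>" "h \<in> \<F>" "x \<in> G" for f h x
    using that ring_hom_add[OF hom, of "enc f" "enc h"]
    by (intro S_eqI polyfun_add S) (simp_all add: S flip: S_enc)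
  have S_mult: "S (\<lambda>x. f x * h x) x = S f x * S h x" if "f \<in> \<F>" "h \<in> \<F>" "x \<in> G" for f h x
    using that ring_hom_mult[OF hom, of "enc f" "enc h"]
    by (intro S_eqI polyfun_mult S) (simp_all add: S flip: S_enc)
  have S_const: "S (\<lambda>_. z) x = z" if "x \<in> G" for z x
    using that fixed[of z] by (intro S_eqI polyfun_const) (simp_all add: pv_const_def)
  have S_cong: "S f x = S h x" if "f \<in> \<F>" "\<And>x. x \<in> G \<Longrightarrow> f x = h x" for f h x
    using enc_cong[of f h] that by (simp add: S_def)
  have S_sum: "S (\<lambda>x. \<Sum>i\<in>I. f i x) x = (\<Sum>i\<in>I. S (f i) x)"
    if "finite I" "\<And>i. i \<in> I \<Longrightarrow> f i \<in> \<F>" "x \<in> G" for I :: "nat set" and f x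
    using that by (induction I rule: finite_induct) (auto simp: S_const S_add polyfun_sum)
  have S_delta: "S (delta f) x = delta (S f) x" if "f \<in> \<F>" "x \<in> G" for f x
    using that D[of "enc f"]
    by (intro S_eqI delta_regular S) (simp_all add: S flip: S_enc)
  define s where "s i j = S (\<lambda>x. \<kappa> (x $$ (i, j)))" for i j
  have ent: "(\<lambda>x. \<kappa> (x $$ (i, j))) \<in> \<F>" if "i < m" "j < m" for i j
    using that by (intro const_regular entry_regular)
  have s: "s i j \<in> \<F>" if "i < m" "j < m" for i j
    unfolding s_def by (rule S[OF ent[OF that]])
  let ?\<tau> = "\<lambda>i l. tau (\<lambda>x. x $$ (i, l))"
  have delta_s: "delta (s i j) y = (\<Sum>l<m. ?\<tau> i l * s l j y)" if ij: "i < m" "j < m" and y: "y \<in> G" for i j y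
  proof -
    have "delta (s i j) y = S (delta (\<lambda>x. \<kappa> (x $$ (i, j)))) y"
      unfolding s_def by (rule S_delta[OF ent[OF ij] y, symmetric])
    also have "\<dots> = S (\<lambda>x. \<Sum>l<m. ?\<tau> i l * \<kappa> (x $$ (l, j))) y"
      by (rule S_cong[OF delta_regular[OF ent[OF ij]]])
        (use ij in \<open>simp add: delta_const_fun entry_regular Tau_entry\<close>)
    also have "\<dots> = (\<Sum>l<m. S (\<lambda>x. ?\<tau> i l * \<kappa> (x $$ (l, j))) y)"
      by (rule S_sum) (use ij y ent in \<open>auto intro: polyfun_scale\<close>)
    also have "\<dots> = (\<Sum>l<m. ?\<tau> i l * s l j y)"
      unfolding s_def
      by (intro sum.cong refl) (use ij y ent in \<open>simp add: S_mult polyfun_const S_const\<close>)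
    finally show ?thesis .
  qed
  \<comment> \<open>The matrix \<open>X\<^sup>-\<^sup>1 \<sigma>(X)\<close>; \<open>c\<close> and
    \<open>g\<close> below are its constant value.\<close>
  define Z where "Z i j y = (\<Sum>l<m. \<kappa> (invm m y $$ (i, l)) * s l j y)" for i j y
  have Z: "Z i j \<in> \<F>" if "i < m" "j < m" for i j
    unfolding Z_def by (intro polyfun_sum polyfun_mult const_regular invm_entry_regular s) (use that in auto)
  have inv1: "(\<Sum>l<m. y $$ (i, l) * invm m y $$ (l, j)) = (if i = j then 1 else 0)"
    and inv2: "(\<Sum>l<m. invm m y $$ (i, l) * y $$ (l, j)) = (if i = j then 1 else 0)"
    if "y \<in> G" "i < m" "j < m" for y i j
    using that invm_mult[OF that(1)] entry_mult[of y "invm m y" i j] entry_mult[of "invm m y" y i j]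
    by (simp_all flip: index_mult_mat)
  have solve1: "(\<Sum>l<m. \<kappa> (y $$ (i, l)) * (\<Sum>q<m. \<kappa> (invm m y $$ (l, q)) * v q)) = v i"
    if y: "y \<in> G" and i: "i < m" for y i and v :: "nat \<Rightarrow> 'c diff_rat"
  proof -
    have "(\<Sum>l<m. \<kappa> (y $$ (i, l)) * (\<Sum>q<m. \<kappa> (invm m y $$ (l, q)) * v q)) =
        (\<Sum>q<m. \<kappa> (\<Sum>l<m. y $$ (i, l) * invm m y $$ (l, q)) * v q)"
      by (simp add: sum_distrib_left sum_distrib_right const_sum diff_rat_const_mult mult.assoc)
        (rule sum.swap)
    also have "\<dots> = (\<Sum>q<m. (if i = q then v q else 0))"
      using y i by (intro sum.cong refl) (simp add: inv1 diff_rat_const_0 diff_rat_const_1)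
    finally show ?thesis using i by simp
  qed
  have solve2: "(\<Sum>l<m. \<kappa> (invm m y $$ (i, l)) * (\<Sum>q<m. \<kappa> (y $$ (l, q)) * v q)) = v i"
    if y: "y \<in> G" and i: "i < m" for y i and v :: "nat \<Rightarrow> 'c diff_rat"
  proof -
    have "(\<Sum>l<m. \<kappa> (invm m y $$ (i, l)) * (\<Sum>q<m. \<kappa> (y $$ (l, q)) * v q)) =
        (\<Sum>q<m. \<kappa> (\<Sum>l<m. invm m y $$ (i, l) * y $$ (l, q)) * v q)"
      by (simp add: sum_distrib_left sum_distrib_right const_sum diff_rat_const_mult mult.assoc)
        (rule sum.swap)
    also have "\<dots> = (\<Sum>q<m. (if i = q then v q else 0))"
      using y i by (intro sum.cong refl) (simp add: inv2 diff_rat_const_0 diff_rat_const_1)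
    finally show ?thesis using i by simp
  qed
  have sZ: "s i j y = (\<Sum>l<m. \<kappa> (y $$ (i, l)) * Z l j y)" if "i < m" "j < m" "y \<in> G" for i j y
    unfolding Z_def using solve1[OF that(3,1), of "\<lambda>q. s q j y"] by simp
  \<comment> \<open>Both \<open>X\<close> and \<open>\<sigma>(X) = X Z\<close> satisfy the same
    linear system, so the product rule leaves \<open>X * delta Z = 0\<close>, and \<open>X\<close>
    is invertible.\<close>
  have "delta (Z q j) y = 0" if q: "q < m" and j: "j < m" and y: "y \<in> G" for q j y
  proof -
    have "(\<Sum>l<m. \<kappa> (y $$ (i, l)) * delta (Z l j) y) = 0" if i: "i < m" for i
    proof -
      have "delta (s i j) y = delta (\<lambda>y. \<Sum>l<m. \<kappa> (y $$ (i, l)) * Z l j y) y"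
        by (rule delta_cong[OF s]) (use i j y sZ in auto)
      also have "\<dots> = (\<Sum>l<m. delta (\<lambda>y. \<kappa> (y $$ (i, l)) * Z l j y) y)"
      proof -
        have "delta (\<lambda>y. \<Sum>l\<in>I. \<kappa> (y $$ (i, l)) * Z l j y) y =
            (\<Sum>l\<in>I. delta (\<lambda>y. \<kappa> (y $$ (i, l)) * Z l j y) y)" if "finite I" "I \<subseteq> {..<m}" for I
          using that
        proof (induction I rule: finite_induct)
          case empty
          show ?case using y by (simp add: delta_const deriv_0)
        next
          case (insert l I)
          then show ?case
            by simp (subst delta_add, auto intro!: polyfun_sum polyfun_mult ent Z i j y)
        qed
        then show ?thesis by simp
      qed
      also have "\<dots> = (\<Sum>l<m. (\<Sum>p<m. ?\<tau> i p * \<kappa> (y $$ (p, l))) * Z l j y + \<kappa> (y $$ (i, l)) * delta (Z l j) y)"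
        by (intro sum.cong refl)
          (use i j y in \<open>simp add: delta_mult ent Z delta_const_fun entry_regular Tau_entry\<close>)
      also have "\<dots> = (\<Sum>l<m. \<Sum>p<m. ?\<tau> i p * (\<kappa> (y $$ (p, l)) * Z l j y)) +
          (\<Sum>l<m. \<kappa> (y $$ (i, l)) * delta (Z l j) y)"
        by (simp add: sum.distrib sum_distrib_right mult.assoc)
      also have "(\<Sum>l<m. \<Sum>p<m. ?\<tau> i p * (\<kappa> (y $$ (p, l)) * Z l j y)) = (\<Sum>p<m. ?\<tau> i p * s p j y)"
        using j y by (subst sum.swap) (simp add: sZ sum_distrib_left)
      finally show ?thesis using delta_s[OF i j y] by simp
    qed
    then have "(\<Sum>l<m. \<kappa> (invm m y $$ (q, l)) * (\<Sum>p<m. \<kappa> (y $$ (l, p)) * delta (Z p j) y)) = 0"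
      by simp
    then show ?thesis using solve2[OF y q] by simp
  qed
  then have "\<exists>c. \<forall>x\<in>G. Z i j x = \<kappa> c" if "i < m" "j < m" for i j
    using delta_constants[OF Z[OF that]] that by metis
  then have "\<forall>i j. \<exists>c. i < m \<longrightarrow> j < m \<longrightarrow> (\<forall>x\<in>G. Z i j x = \<kappa> c)" by metis
  then obtain c where c: "\<And>i j x. i < m \<Longrightarrow> j < m \<Longrightarrow> x \<in> G \<Longrightarrow> Z i j x = \<kappa> (c i j)" by metis
  define g where "g = mat m m (\<lambda>(i, j). c i j)"
  have g: "g \<in> carrier_mat m m" by (simp add: g_def)
  have s_g: "s i j y = \<kappa> ((y * g) $$ (i, j))" if "i < m" "j < m" "y \<in> G" for i j y
    using that c by (simp add: sZ g_def scalar_prod_def const_sum diff_rat_const_mult lessThan_atLeast0)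
  have poly: "S (\<lambda>x. \<kappa> (mat_poly m p x)) y = \<kappa> (mat_poly m p (y * g))" if y: "y \<in> G" for p y
  proof (induction p rule: polys_induct)
    case (const a)
    show ?case using y by (simp add: mat_poly_def S_const)
  next
    case (var v)
    obtain i j where v: "v = (i, j)" by (cases v)
    show ?case
    proof (cases "i < m \<and> j < m")
      case True
      then show ?thesis using s_g[of i j y] v y by (simp add: mat_poly_def s_def)
    next
      case False
      then show ?thesis using v y by (auto simp: mat_poly_def S_const)
    qed
  next
    case (add p q)
    have "S (\<lambda>x. \<kappa> (mat_poly m p x) + \<kappa> (mat_poly m q x)) y =
        \<kappa> (mat_poly m p (y * g)) + \<kappa> (mat_poly m q (y * g))"
      using add y by (simp add: S_add const_regular mat_poly_regular)
    then show ?case by (simp add: mat_poly_def poly_eval_add diff_rat_const_add)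
  next
    case (mult p q)
    have "S (\<lambda>x. \<kappa> (mat_poly m p x) * \<kappa> (mat_poly m q x)) y =
        \<kappa> (mat_poly m p (y * g)) * \<kappa> (mat_poly m q (y * g))"
      using mult y by (simp add: S_mult const_regular mat_poly_regular)
    then show ?case by (simp add: mat_poly_mult diff_rat_const_mult)
  qed
  obtain dp where dp: "\<And>x. x \<in> carrier_mat m m \<Longrightarrow> det x = mat_poly m dp (x :: 'c mat)"
    using det_eq_mat_poly by blast
  \<comment> \<open>Applying the automorphism to \<open>det * (1 / det) = 1\<close> shows that
    \<open>g\<close> is invertible, before it is known to lie in \<open>G\<close>.\<close>
  have det: "\<kappa> (det (y * g)) * S (\<lambda>x. \<kappa> (1 / det x)) y = 1" if y: "y \<in> G" for y
  proof -
    have i: "(\<lambda>x. \<kappa> (1 / det x)) \<in> \<F>" "(\<lambda>x. \<kappa> (mat_poly m dp x)) \<in> \<F>"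
      by (intro const_regular inverse_det_regular mat_poly_regular)+
    have "\<kappa> (det (y * g)) * S (\<lambda>x. \<kappa> (1 / det x)) y = S (\<lambda>x. \<kappa> (mat_poly m dp x) * \<kappa> (1 / det x)) y"
      using y g i by (simp add: S_mult poly dp[of "y * g"] mult_carrier_mat[of _ m m])
    also have "\<dots> = S (\<lambda>_. 1) y"
      by (rule S_cong[OF polyfun_mult[OF i(2,1)]])
        (simp add: dp[symmetric] flip: diff_rat_const_mult, simp add: diff_rat_const_1)
    finally show ?thesis using y by (simp add: S_const)
  qed
  \<comment> \<open>An equation of \<open>G\<close> is the zero function on \<open>G\<close>; its
    image under the automorphism, evaluated at the unit, is the equation at
    \<open>g\<close>.\<close>
  have gG: "g \<in> G"
  proof -
    have "det g \<noteq> 0"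
      using det[OF unit_in_G] g by (auto simp: diff_rat_const_0)
    obtain P0 where P0: "G = GL_zeros m P0"
      using alg_group by (auto simp: linear_algebraic_group_def closedin_zariski)
    have "mat_poly m p g = 0" if p: "p \<in> P0" for p
    proof -
      have "mat_poly m p x = 0" if "x \<in> G" for x
        using that p by (simp add: P0 GL_zeros_def)
      then have "S (\<lambda>x. \<kappa> (mat_poly m p x)) unit = S (\<lambda>_. 0) unit"
        by (intro S_cong const_regular mat_poly_regular) (simp add: diff_rat_const_0)
      then show ?thesis
        using poly[OF unit_in_G, of p] g unit_in_G by (simp add: S_const diff_rat_const_eq_0)
    qed
    then have "g \<in> GL_zeros m P0"
      unfolding GL_zeros_def GL_def using g \<open>det g \<noteq> 0\<close> by blast
    then show ?thesis by (simp only: P0)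
  qed
  have "S f y = f (y * g)" if "f \<in> \<F>" "y \<in> G" for f y
    using that
  proof induction
    case (polyfun_const z)
    then show ?case by (simp add: S_const)
  next
    case (polyfun_coord k)
    then show ?case
    proof (cases rule: crd_cases)
      case (1 i j)
      then show ?thesis using s_g[of i j y] polyfun_coord by (simp add: s_def)
    next
      case 2
      have inv: "\<kappa> (det (y * g)) * \<kappa> (1 / det (y * g)) = 1"
        using G_det[OF mult_in_G[OF polyfun_coord(2) gG]]
        by (simp flip: diff_rat_const_mult) (simp add: diff_rat_const_1)
      then have "\<kappa> (det (y * g)) \<noteq> 0" by auto
      moreover have "\<kappa> (det (y * g)) * S (\<lambda>x. \<kappa> (1 / det x)) y = \<kappa> (det (y * g)) * \<kappa> (1 / det (y * g))"
        unfolding inv by (rule det[OF polyfun_coord(2)])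
      ultimately have "S (\<lambda>x. \<kappa> (1 / det x)) y = \<kappa> (1 / det (y * g))"
        by (simp only: mult_cancel_left simp_thms)
      then show ?thesis using 2 by simp
    qed
  next
    case (polyfun_add f h)
    then show ?case by (simp add: S_add)
  next
    case (polyfun_mult f h)
    then show ?case by (simp add: S_mult)
  next
    case (polyfun_cong f h)
    then show ?case using S_cong[of f h y] gG by simp
  qed
  then have "\<sigma> (enc f) = galois_action g (enc f)" if "f \<in> \<F>" for f
    using that gG S_enc[OF that] enc_cong[of "S f" "\<lambda>x. f (x * g)"] by simp
  then have "\<sigma> r = galois_action g r" if "r \<in> carrier pv" for r
    using that by (elim pvE) simp
  then have "\<sigma> = galois_action g"
    by (intro extensionalityI[OF ext]) (auto simp: galois_action_def)
  then show thesis by (rule that[OF gG])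
qed

lemma galois_action_iso: "galois_action \<in> iso (GL_subgroup m G) Gal"
proof (rule isoI)
  show "galois_action \<in> hom (GL_subgroup m G) Gal"
  proof (rule homI)
    fix g h assume "g \<in> carrier (GL_subgroup m G)" "h \<in> carrier (GL_subgroup m G)"
    then have gh: "g \<in> G" "h \<in> G" by (auto simp: GL_subgroup_def)
    have bij: "galois_action g \<in> Bij (carrier pv)" "galois_action h \<in> Bij (carrier pv)"
      using galois_action_in_Gal gh by (auto simp: differential_galois_group_def)
    have "galois_action (g * h) = compose (carrier pv) (galois_action g) (galois_action h)"
    proof (rule extensionalityI)
      show "galois_action (g * h) \<in> extensional (carrier pv)"
        by (simp add: galois_action_def)
      show "galois_action (g * h) r = compose (carrier pv) (galois_action g) (galois_action h) r"
        if "r \<in> carrier pv" for r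
        using that gh by (simp add: compose_eq galois_action_mult)
    qed (rule compose_extensional)
    then show "galois_action (g \<otimes>\<^bsub>GL_subgroup m G\<^esub> h) = galois_action g \<otimes>\<^bsub>Gal\<^esub> galois_action h"
      using bij by (simp add: GL_subgroup_def differential_galois_group_def BijGroup_def)
  qed (simp add: GL_subgroup_def galois_action_in_Gal)
  show "bij_betw galois_action (carrier (GL_subgroup m G)) (carrier Gal)"
    unfolding bij_betw_def
  proof
    show "inj_on galois_action (carrier (GL_subgroup m G))"
      by (rule inj_onI) (auto simp: GL_subgroup_def intro: galois_action_inj)
    show "galois_action ` carrier (GL_subgroup m G) = carrier Gal"
      by (auto simp: GL_subgroup_def intro: galois_action_in_Gal elim!: galois_action_surj)
  qed
qed

section \<open>The representation by constant matrices\<close>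

text \<open>At the unit the solutions are the distinct variables of index
  \<open>m, 2m, ..., m\<^sup>2\<close>. Their independence over \<open>C\<close> makes the matrix of
  an automorphism unique.\<close>

lemma sol_unit_independent:
  assumes "(\<Sum>i<m. sol i unit * \<kappa> (c i)) = 0" "i < m"
  shows "c i = 0"
proof -
  have sol: "sol i unit = frc (tvar (Suc i * m))" if "i < m" for i
  proof -
    have "sol i unit = (\<Sum>l<m. frc (tvar (Suc l * m)) * (if l = i then 1 else 0))"
      unfolding sol_def row_fun_def using that
      by (simp, intro sum.cong refl) (auto simp: diff_rat_const_0 diff_rat_const_1)
    then show ?thesis using that by (simp add: if_distrib[of "\<lambda>a. _ * a"] cong: if_cong)
  qed
  let ?p = "(\<Sum>i<m. Poly_Mapping.single (Poly_Mapping.single (Suc i * m) 1) (c i)) :: 'c diff_poly"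
  have "frc ?p = (\<Sum>i<m. sol i unit * \<kappa> (c i))"
    unfolding frc_sum
    by (intro sum.cong refl) (simp add: sol tvar_def diff_rat_const_frc mult_single flip: frc_mult)
  then have "?p = 0" using assms(1) by (simp only: frc_eq_0)
  moreover have "Poly_Mapping.lookup ?p (Poly_Mapping.single (Suc i * m) 1) = c i"
  proof -
    have "Poly_Mapping.single (Suc l * m) (1::nat) = Poly_Mapping.single (Suc i * m) 1 \<longleftrightarrow> l = i" if "l < m" for l
    proof
      assume "Poly_Mapping.single (Suc l * m) (1::nat) = Poly_Mapping.single (Suc i * m) 1"
      then have "Suc l * m = Suc i * m"
        by (metis lookup_single_eq lookup_single_not_eq zero_neq_one)
      then show "l = i" using that by simp
    qed simp
    then have "Poly_Mapping.lookup ?p (Poly_Mapping.single (Suc i * m) 1) = (\<Sum>l<m. if l = i then c l else 0)"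
      unfolding lookup_sum by (intro sum.cong refl) (simp add: lookup_single when_def)
    then show ?thesis using assms(2) by simp
  qed
  ultimately show ?thesis by simp
qed

text \<open>The solutions are a row vector over \<open>F\<close> times the generic matrix
  \<open>X\<close>, and translation by \<open>g\<close> replaces \<open>X\<close> by
  \<open>X g\<close>. So in this fundamental system the Galois group is \<open>G\<close> itself, not
  just a conjugate.\<close>

lemma galois_matrix_action:
  assumes g: "g \<in> G"
  shows "galois_matrix pv (pv_const \<circ> \<kappa>) m (\<lambda>j. enc (sol j)) (galois_action g) = g"
  unfolding galois_matrix_def
proof (rule the_equality)
  have s: "sol j \<in> \<F>" for j using sol_regular[of 0 j] by simp
  have comb: "(\<Oplus>\<^bsub>pv\<^esub>i\<in>{0..<m}. enc (sol i) \<otimes>\<^bsub>pv\<^esub> (pv_const \<circ> \<kappa>) (M $$ (i, j))) =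
      enc (\<lambda>x. \<Sum>i<m. sol i x * \<kappa> (M $$ (i, j)))" for M j
    using s by (simp add: pv_const_def polyfun_const pv_finsum polyfun_mult lessThan_atLeast0)
  have act: "galois_action g (enc (sol j)) = enc (\<lambda>x. \<Sum>i<m. sol i x * \<kappa> (g $$ (i, j)))" if j: "j < m" for j
    unfolding galois_action_enc[OF g s]
  proof (rule enc_cong)
    fix x assume x: "x \<in> G"
    have "sol j (x * g) = (\<Sum>l<m. \<Sum>i<m. frc (row_poly 0 l) * \<kappa> (x $$ (l, i)) * \<kappa> (g $$ (i, j)))"
      using j x g by (simp add: sol_def row_fun_def const_sum diff_rat_const_mult sum_distrib_left mult.assoc del: row_poly.simps)
    also have "\<dots> = (\<Sum>i<m. \<Sum>l<m. frc (row_poly 0 l) * \<kappa> (x $$ (l, i)) * \<kappa> (g $$ (i, j)))"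
      by (rule sum.swap)
    also have "\<dots> = (\<Sum>i<m. sol i x * \<kappa> (g $$ (i, j)))"
      by (intro sum.cong refl) (simp add: sol_def row_fun_def sum_distrib_right del: row_poly.simps)
    finally show "sol j (x * g) = (\<Sum>i<m. sol i x * \<kappa> (g $$ (i, j)))" .
  qed
  show "g \<in> carrier_mat m m \<and> (\<forall>j<m. galois_action g (enc (sol j)) =
      (\<Oplus>\<^bsub>pv\<^esub>i\<in>{0..<m}. enc (sol i) \<otimes>\<^bsub>pv\<^esub> (pv_const \<circ> \<kappa>) (g $$ (i, j))))"
    unfolding comb using act g by simp
  fix M assume "M \<in> carrier_mat m m \<and> (\<forall>j<m. galois_action g (enc (sol j)) =
      (\<Oplus>\<^bsub>pv\<^esub>i\<in>{0..<m}. enc (sol i) \<otimes>\<^bsub>pv\<^esub> (pv_const \<circ> \<kappa>) (M $$ (i, j))))"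
  then have M: "M \<in> carrier_mat m m"
    and eq: "\<And>j. j < m \<Longrightarrow> enc (\<lambda>x. \<Sum>i<m. sol i x * \<kappa> (g $$ (i, j))) = enc (\<lambda>x. \<Sum>i<m. sol i x * \<kappa> (M $$ (i, j)))"
    unfolding comb using act by auto
  show "M = g"
  proof (rule eq_matI)
    fix i j assume "i < dim_row g" "j < dim_col g"
    then have ij: "i < m" "j < m" using g by auto
    have "(\<Sum>i<m. sol i unit * \<kappa> (g $$ (i, j))) = (\<Sum>i<m. sol i unit * \<kappa> (M $$ (i, j)))"
      by (rule enc_eqD[OF eq[OF ij(2)] _ _ unit_in_G]) (intro polyfun_sum polyfun_mult s polyfun_const)+
    then have "(\<Sum>i<m. sol i unit * \<kappa> (g $$ (i, j) - M $$ (i, j))) = 0"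
      by (simp add: const_diff right_diff_distrib sum_subtractf)
    from sol_unit_independent[OF this ij(1)] show "M $$ (i, j) = g $$ (i, j)" by simp
  qed (use M g in auto)
qed

lemma algebraic_group_iso_id:
  assumes \<phi>: "\<And>x. x \<in> G \<Longrightarrow> \<phi> x = x"
  shows "algebraic_group_iso m G m G \<phi>"
  unfolding algebraic_group_iso_def
proof (intro conjI)
  have bij: "bij_betw \<phi> G G"
    using \<phi> by (simp add: bij_betw_def inj_on_def)
  show "\<phi> \<in> iso (GL_subgroup m G) (GL_subgroup m G)"
    by (rule isoI, rule homI) (use \<phi> bij in \<open>auto simp: GL_subgroup_def\<close>)
  have reg: "regular_map m G m \<psi>" if "\<And>x. x \<in> G \<Longrightarrow> \<psi> x = x" for \<psi>
    unfolding regular_map_def regular_function_def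
  proof (intro allI impI)
    fix i j assume "i < m" "j < m"
    then show "\<exists>p k. \<forall>A\<in>G. \<psi> A $$ (i, j) = mat_poly m p A / det A ^ k"
      using that by (intro exI[of _ "Poly_Mapping.single (Poly_Mapping.single (i, j) 1) 1"] exI[of _ 0])
        (simp add: mat_poly_def)
  qed
  show "regular_map m G m \<phi>" by (rule reg[OF \<phi>])
  show "regular_map m G m (inv_into G \<phi>)"
    by (rule reg) (use \<phi> bij in \<open>metis bij_betw_def inv_into_f_f\<close>)
qed (rule alg_group)+

theorem has_differential_galois_group:
  "has_differential_galois_group diff_rat_deriv \<kappa> m lde_coeff m G"
proof -
  let ?y = "\<lambda>j. enc (sol j)"
  have "galois_matrix pv (pv_const \<circ> \<kappa>) m ?y ` carrier Gal = G"
  proof -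
    have "carrier Gal = galois_action ` G"
      by (auto intro: galois_action_in_Gal elim!: galois_action_surj)
    then have "galois_matrix pv (pv_const \<circ> \<kappa>) m ?y ` carrier Gal =
        (\<lambda>g. galois_matrix pv (pv_const \<circ> \<kappa>) m ?y (galois_action g)) ` G"
      by (simp add: image_image)
    also have "\<dots> = (\<lambda>g. g) ` G"
      by (rule image_cong[OF refl galois_matrix_action])
    finally show ?thesis by simp
  qed
  moreover have "algebraic_group_iso m G m G
      (galois_matrix pv (pv_const \<circ> \<kappa>) m ?y \<circ> galois_action)"
    by (rule algebraic_group_iso_id) (simp add: galois_matrix_action)
  ultimately show ?thesis
    unfolding has_differential_galois_group_def
    using pv_picard_vessiot fundamental_solutions_sol galois_action_iso
    by (intro exI[of _ pv] exI[of _ pv_deriv] exI[of _ pv_const] exI[of _ ?y] exI[of _ galois_action])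
      simp
qed

end

text \<open>A group of \<open>0 \<times> 0\<close> matrices is replaced by the trivial group of \<open>1 \<times> 1\<close> matrices, since the
  equation must have positive order.\<close>

lemma linear_algebraic_group_trivial: "linear_algebraic_group 1 {1\<^sub>m 1 :: 'c::field mat}"
  unfolding linear_algebraic_group_def
proof
  show "subgroup {1\<^sub>m 1 :: 'c mat} (GL_subgroup 1 (GL 1))"
  proof (rule group.subgroupI[OF group_GL])
    have "\<one>\<^bsub>GL_subgroup 1 (GL 1)\<^esub> = (1\<^sub>m 1 :: 'c mat)"
      by (simp add: GL_subgroup_def)
    then have "inv\<^bsub>GL_subgroup 1 (GL 1)\<^esub> (1\<^sub>m 1 :: 'c mat) = 1\<^sub>m 1"
      using monoid.inv_one[OF group.is_monoid[OF group_GL[of 1, where 'a = 'c]]] by simp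
    then show "inv\<^bsub>GL_subgroup 1 (GL 1)\<^esub> a \<in> {1\<^sub>m 1}" if "a \<in> {1\<^sub>m 1 :: 'c mat}" for a
      using that by simp
  qed (auto simp: GL_subgroup_def GL_def)
  let ?p = "Poly_Mapping.single (Poly_Mapping.single (0, 0) 1) 1 + Poly_Mapping.single 0 (- 1) ::
    (nat \<times> nat, 'c) polys"
  have "mat_poly 1 ?p A = A $$ (0, 0) - 1" for A
    by (simp add: mat_poly_def poly_eval_add)
  then have "{1\<^sub>m 1} = GL_zeros 1 {?p}"
    by (auto simp: GL_zeros_def GL_def intro!: eq_matI)
  then show "closedin (zariski 1) {1\<^sub>m 1 :: 'c mat}"
    by (auto simp: closedin_zariski)
qed

text \<open>Both groups are trivial, so composing with the constant map transports everything; the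
  map back has no matrix entries whose regularity would have to be checked.\<close>

lemma has_differential_galois_group_dim_0:
  assumes G: "linear_algebraic_group 0 G"
    and H: "has_differential_galois_group D \<gamma> n a 1 {1\<^sub>m 1}"
  shows "has_differential_galois_group D \<gamma> n a 0 G"
proof -
  obtain R :: "(nat, 'b) polys set ring" and \<delta> \<iota> y \<psi> where
    pv: "picard_vessiot_ring D n a R \<delta> \<iota>" "fundamental_solutions R \<delta> \<iota> n a y"
    and \<psi>: "\<psi> \<in> iso (GL_subgroup 1 {1\<^sub>m 1}) (differential_galois_group R \<delta> \<iota>)"
    and iso: "algebraic_group_iso 1 {1\<^sub>m 1} n
        (galois_matrix R (\<iota> \<circ> \<gamma>) n y ` carrier (differential_galois_group R \<delta> \<iota>))
        (galois_matrix R (\<iota> \<circ> \<gamma>) n y \<circ> \<psi>)"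
    using H unfolding has_differential_galois_group_def by blast
  interpret matrix_group 0 G by unfold_locales (rule G)
  have G_eq: "G = {1\<^sub>m 0}"
    using unit_in_G G_carrier by auto
  let ?c = "\<lambda>_. 1\<^sub>m 1"
  have c: "?c \<in> iso (GL_subgroup 0 G) (GL_subgroup 1 {1\<^sub>m 1})"
    by (rule isoI, rule homI) (auto simp: GL_subgroup_def G_eq bij_betw_def)
  let ?H = "galois_matrix R (\<iota> \<circ> \<gamma>) n y ` carrier (differential_galois_group R \<delta> \<iota>)"
  let ?\<phi> = "galois_matrix R (\<iota> \<circ> \<gamma>) n y \<circ> \<psi>"
  have "\<psi> \<circ> ?c \<in> iso (GL_subgroup 0 G) (differential_galois_group R \<delta> \<iota>)"
    by (rule iso_set_trans[OF c \<psi>])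
  moreover have "algebraic_group_iso 0 G n ?H (?\<phi> \<circ> ?c)"
    unfolding algebraic_group_iso_def
  proof (intro conjI)
    show "linear_algebraic_group n ?H" using iso by (simp add: algebraic_group_iso_def)
    show "?\<phi> \<circ> ?c \<in> iso (GL_subgroup 0 G) (GL_subgroup n ?H)"
      using iso by (intro iso_set_trans[OF c]) (simp add: algebraic_group_iso_def)
    show "regular_map 0 G n (?\<phi> \<circ> ?c)"
      unfolding regular_map_def regular_function_def
    proof (intro allI impI)
      fix i j
      show "\<exists>p k. \<forall>A\<in>G. (?\<phi> \<circ> ?c) A $$ (i, j) = mat_poly 0 p A / det A ^ k"
        by (rule exI[of _ "Poly_Mapping.single 0 (?\<phi> (1\<^sub>m 1) $$ (i, j))"], rule exI[of _ 0])
          (simp add: mat_poly_def)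
    qed
    show "regular_map n ?H 0 (inv_into G (?\<phi> \<circ> ?c))" by (simp add: regular_map_def)
  qed (rule G)
  ultimately show ?thesis
    unfolding has_differential_galois_group_def using pv
    by (intro exI[of _ R] exI[of _ \<delta>] exI[of _ \<iota>] exI[of _ y] exI[of _ "\<psi> \<circ> ?c"])
      (simp add: comp_assoc)
qed

theorem theorem5p2:
  fixes G :: "'c::{alg_closed_field, field_char_0} mat set" and m :: nat
  assumes "linear_algebraic_group m G"
    and "connectedin (zariski m) G"
  shows "\<exists>n a. n > 0 \<and>
    has_differential_galois_group diff_rat_deriv (diff_rat_const :: 'c \<Rightarrow> 'c diff_rat) n a m G"
proof (cases "m = 0")
  case True
  interpret trivial: connected_matrix_group 1 "{1\<^sub>m 1 :: 'c mat}"
    by unfold_locales (auto simp: linear_algebraic_group_trivial[unfolded One_nat_def] connectedin_sing GL_def)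
  show ?thesis
    using has_differential_galois_group_dim_0[OF _ trivial.has_differential_galois_group] assms True
    by (intro exI[of _ 1] exI[of _ trivial.lde_coeff]) simp
next
  case False
  interpret connected_matrix_group m G
    by unfold_locales (rule assms)+
  show ?thesis
    using has_differential_galois_group False by blast
qed

end
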